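(* (Covariant Noether theorem.) Suppose a Lie group $\mathcal{G}$ acts on $\mathcal{C}$ by bundle automorphisms via $\Phi$ and leaves the action $\mathcal{S}$ invariant, i.e. $\mathcal{S}(\Phi(\eta_Y,\phi))=\mathcal{S}(\phi)$ for all $\eta_Y\in\mathcal{G}$ and $\phi\in\mathcal{C}$. Let $\mathcal{J}^{\mathcal{L}}\in L(\mathfrak{g},\Lambda^n(J^1(Y)))$ be the covariant momentum map, defined by $$j^1(\xi)\lrcorner\,\Omega_{\mathcal{L}}=d\,\mathcal{J}^{\mathcal{L}}(\xi),\qquad \xi\in\mathfrak{g}.$$ Then for every $\phi\in\mathcal{P}$ and every $\xi\in\mathfrak{g}$, $$d\bigl[\,j^1(\phi\circ\phi_X^{-1})^*\mathcal{J}^{\mathcal{L}}(\xi)\bigr]=0\quad\text{on } U_X .$$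
   Context: Let $X$ be an oriented smooth manifold of dimension $n+1$ and $\pi_{XY}:Y\to X$ a smooth fiber bundle. Coordinates on $X$ are $x^\mu$, $\mu=1,\dots,n,0$, fiber coordinates on $Y$ are $y^A$. The first jet bundle $J^1(Y)$ is the affine bundle over $Y$ whose fiber over $y\in Y_x$ consists of linear maps $\gamma:T_xX\to T_yY$ with $T\pi_{XY}\circ\gamma=\mathrm{Id}$; induced fiber coordinates are $v^A{}_\mu$. For a section $\psi$, $j^1(\psi)$ is $x\mapsto T_x\psi$. Put $d^{n+1}x=dx^1\wedge\dots\wedge dx^n\wedge dx^0$, $d^nx_\mu=\partial_\mu\lrcorner\,d^{n+1}x$. A Lagrangian density is a smooth bundle map $\mathcal{L}:J^1(Y)\to\Lambda^{n+1}(X)$ over $X$, $\mathcal{L}(\gamma)=L(x^\mu,y^A,v^A{}_\mu)d^{n+1}x$. The Cartan form is $$\Theta_{\mathcal{L}}=\frac{\partial L}{\partial v^A{}_\mu}dy^A\wedge d^nx_\mu+\left(L-\frac{\partial L}{\partial v^A{}_\mu}v^A{}_\mu\right)d^{n+1}x,\qquad \Omega_{\mathcal{L}}=-d\Theta_{\mathcal{L}} .$$ Let $U$ be a compact smooth $(n+1)$-dimensional manifold with (piecewise) smooth closed boundary. $\mathcal{C}$ is the space of smooth maps $\phi:U\to Y$ such that $\phi_X:=\pi_{XY}\circ\phi:U\to X$ is an embedding; $U_X:=\phi_X(U)$, so $\phi\circ\phi_X^{-1}$ is a section over $U_X$. A bundle automorphism $\eta_Y$ of $Y$ covering the diffeomorphism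 $\eta_X$ of $X$ acts by $\Phi(\eta_Y,\phi)=\eta_Y\circ(\phi\circ\phi_X^{-1})\circ\eta_X^{-1}$. The action function is $\mathcal{S}(\phi)=\int_{U_X}\mathcal{L}(j^1(\phi\circ\phi_X^{-1}))$ (for a section over $\eta_X(U_X)$, the integral is over $\eta_X(U_X)$). The solutions of the Euler–Lagrange equations are $$\mathcal{P}=\{\phi\in\mathcal{C}\mid j^1(\phi\circ\phi_X^{-1})^*[W\lrcorner\,\Omega_{\mathcal{L}}]=0\ \text{for all vector fields } W \text{ on } J^1(Y)\}.$$ $\mathfrak{g}$ is the Lie algebra of $\mathcal{G}$; for $\xi\in\mathfrak{g}$, $j^1(\xi)$ is the vector field on $J^1(Y)$ generating the prolonged action $\gamma\mapsto T\eta_Y\circ\gamma\circ T\eta_X^{-1}$ of the one-parameter group of $\xi$. *)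

theory Defs
  imports "HOL-Analysis.Analysis" "HOL-Algebra.Group_Action"
begin

section \<open>Smooth maps between subsets of Euclidean spaces\<close>

primrec Ck_on :: "nat \<Rightarrow> 'a::euclidean_space set \<Rightarrow> ('a \<Rightarrow> 'b::euclidean_space) \<Rightarrow> bool" where
  "Ck_on 0 S f \<longleftrightarrow> continuous_on S f"
| "Ck_on (Suc k) S f \<longleftrightarrow>
     f differentiable_on S \<and> (\<forall>v. Ck_on k S (\<lambda>x. frechet_derivative f (at x) v))"

text \<open>\<^const>\<open>Ck_on\<close> is meant for open sets only. On an arbitrary set, smoothness means local
  extendability to a smooth function on an open set, as usual for manifolds with boundary.\<close>

definition smooth_on :: "'a::euclidean_space set \<Rightarrow> ('a \<Rightarrow> 'b::euclidean_space) \<Rightarrow> bool" where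
  "smooth_on S f \<longleftrightarrow> (\<forall>x\<in>S. \<exists>N h. open N \<and> x \<in> N \<and> (\<forall>k. Ck_on k N h) \<and> (\<forall>z\<in>S \<inter> N. h z = f z))"

section \<open>Manifolds\<close>

text \<open>A manifold is given by its atlas. The underlying set is the union of the chart domains, and
  the topology is the one induced by the charts. Values of a chart outside its domain are
  irrelevant.\<close>

type_synonym 'm rvec = "real^'m"
type_synonym ('m, 'a) bundle_model = "(real^'m) \<times> (real^'a)"

type_synonym ('a, 'e) chart = "'a set \<times> ('a \<Rightarrow> 'e)"

abbreviation cdom :: "('a, 'e) chart \<Rightarrow> 'a set" where "cdom c \<equiv> fst c"
abbreviation cmap :: "('a, 'e) chart \<Rightarrow> 'a \<Rightarrow> 'e" where "cmap c \<equiv> snd c"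

definition cinv :: "('a, 'e) chart \<Rightarrow> 'e \<Rightarrow> 'a" where
  "cinv c = inv_into (cdom c) (cmap c)"

definition mcarrier :: "('a, 'e) chart set \<Rightarrow> 'a set" where
  "mcarrier A = (\<Union>c\<in>A. cdom c)"

definition mtop :: "('a, 'e::euclidean_space) chart set \<Rightarrow> 'a topology" where
  "mtop A = topology (\<lambda>W. W \<subseteq> mcarrier A \<and>
     (\<forall>c\<in>A. openin (top_of_set (cmap c ` cdom c)) (cmap c ` (W \<inter> cdom c))))"

lemma openin_mtop:
  assumes inj: "\<And>c. c \<in> A \<Longrightarrow> inj_on (cmap c) (cdom c)"
  shows "openin (mtop A) W \<longleftrightarrow> W \<subseteq> mcarrier A \<and>
     (\<forall>c\<in>A. openin (top_of_set (cmap c ` cdom c)) (cmap c ` (W \<inter> cdom c)))"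
proof -
  have int: "cmap c ` (S \<inter> T \<inter> cdom c) = cmap c ` (S \<inter> cdom c) \<inter> cmap c ` (T \<inter> cdom c)"
    if "c \<in> A" for c S T
    using inj[OF that] by (auto simp: inj_on_def)
  have un: "cmap c ` (\<Union>K \<inter> cdom c) = \<Union>((\<lambda>W. cmap c ` (W \<inter> cdom c)) ` K)" for c :: "('a, 'b) chart" and K
    by auto
  have "istopology (\<lambda>W. W \<subseteq> mcarrier A \<and>
     (\<forall>c\<in>A. openin (top_of_set (cmap c ` cdom c)) (cmap c ` (W \<inter> cdom c))))"
    unfolding istopology_def
  proof (intro conjI allI impI ballI; (elim conjE)?)
    fix S T c assume "\<forall>c\<in>A. openin (top_of_set (cmap c ` cdom c)) (cmap c ` (S \<inter> cdom c))"
      "\<forall>c\<in>A. openin (top_of_set (cmap c ` cdom c)) (cmap c ` (T \<inter> cdom c))" "c \<in> A"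
    then show "openin (top_of_set (cmap c ` cdom c)) (cmap c ` (S \<inter> T \<inter> cdom c))"
      unfolding int[OF \<open>c \<in> A\<close>] by (intro openin_Int) auto
  next
    fix K c assume "\<forall>S\<in>K. S \<subseteq> mcarrier A \<and>
      (\<forall>c\<in>A. openin (top_of_set (cmap c ` cdom c)) (cmap c ` (S \<inter> cdom c)))" "c \<in> A"
    then show "openin (top_of_set (cmap c ` cdom c)) (cmap c ` (\<Union>K \<inter> cdom c))"
      unfolding un by (intro openin_Union) auto
  qed auto
  then show ?thesis
    unfolding mtop_def by (simp add: topology_inverse')
qed

text \<open>\<open>H\<close> is the local model: the whole Euclidean space, or an orthant for corners.\<close>

definition model_chart :: "'e::euclidean_space set \<Rightarrow> ('a, 'e) chart \<Rightarrow> bool" where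
  "model_chart H c \<longleftrightarrow> inj_on (cmap c) (cdom c) \<and> openin (top_of_set H) (cmap c ` cdom c)"

definition smooth_transition :: "'e::euclidean_space set \<Rightarrow> ('a, 'e) chart \<Rightarrow> ('a, 'e) chart \<Rightarrow> bool" where
  "smooth_transition H c c' \<longleftrightarrow>
     openin (top_of_set H) (cmap c ` (cdom c \<inter> cdom c')) \<and>
     smooth_on (cmap c ` (cdom c \<inter> cdom c')) (cmap c' \<circ> cinv c)"

definition smooth_manifold_on :: "'e::euclidean_space set \<Rightarrow> ('a, 'e) chart set \<Rightarrow> bool" where
  "smooth_manifold_on H A \<longleftrightarrow>
     (\<forall>c\<in>A. model_chart H c) \<and>
     (\<forall>c\<in>A. \<forall>c'\<in>A. smooth_transition H c c') \<and>
     (\<forall>c. model_chart H c \<and> cdom c \<subseteq> mcarrier A \<and>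
          (\<forall>c'\<in>A. smooth_transition H c c' \<and> smooth_transition H c' c) \<longrightarrow> c \<in> A) \<and>
     Hausdorff_space (mtop A) \<and> second_countable (mtop A)"

abbreviation smooth_manifold :: "('a, 'e::euclidean_space) chart set \<Rightarrow> bool" where
  "smooth_manifold A \<equiv> smooth_manifold_on UNIV A"

definition smooth_manifold_corners :: "('a, 'm::finite rvec) chart set \<Rightarrow> bool" where
  "smooth_manifold_corners A \<longleftrightarrow> smooth_manifold_on {x. \<forall>i. 0 \<le> x $ i} A"

definition euclidean_atlas :: "('e, 'e) chart set" where
  "euclidean_atlas = {(UNIV, id)}"

definition prod_atlas :: "('a, 'e) chart set \<Rightarrow> ('b, 'f) chart set \<Rightarrow> ('a \<times> 'b, 'e \<times> 'f) chart set" where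
  "prod_atlas A B = {(cdom c \<times> cdom c', map_prod (cmap c) (cmap c')) | c c'. c \<in> A \<and> c' \<in> B}"

definition sub_atlas :: "('a, 'e) chart set \<Rightarrow> 'a set \<Rightarrow> ('a, 'e) chart set" where
  "sub_atlas A W = (\<lambda>c. (cdom c \<inter> W, cmap c)) ` A"

definition smooth_map ::
  "('a, 'e::euclidean_space) chart set \<Rightarrow> ('b, 'f::euclidean_space) chart set \<Rightarrow> ('a \<Rightarrow> 'b) \<Rightarrow> bool" where
  "smooth_map A B f \<longleftrightarrow>
     continuous_map (mtop A) (mtop B) f \<and>
     (\<forall>c\<in>A. \<forall>c'\<in>B. smooth_on (cmap c ` (cdom c \<inter> f -` cdom c')) (cmap c' \<circ> f \<circ> cinv c))"

definition diffeomorphism ::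
  "('a, 'e::euclidean_space) chart set \<Rightarrow> ('b, 'f::euclidean_space) chart set \<Rightarrow> ('a \<Rightarrow> 'b) \<Rightarrow> bool" where
  "diffeomorphism A B f \<longleftrightarrow>
     bij_betw f (mcarrier A) (mcarrier B) \<and> smooth_map A B f \<and>
     smooth_map B A (inv_into (mcarrier A) f)"

section \<open>Tangent vectors\<close>

text \<open>A tangent vector is its family of coordinate representations in all charts around the base
  point, transforming by the derivatives of the transition maps; its value on all other charts is 0
  by convention. Derivatives are taken within the images of the domains, because these need not be
  open for manifolds with corners.\<close>

type_synonym ('a, 'e) tvec = "('a, 'e) chart \<Rightarrow> 'e"

definition transition_deriv ::
  "('a, 'e::euclidean_space) chart \<Rightarrow> ('a, 'e) chart \<Rightarrow> 'a \<Rightarrow> 'e \<Rightarrow> 'e" where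
  "transition_deriv c c' p =
     frechet_derivative (cmap c' \<circ> cinv c) (at (cmap c p) within cmap c ` (cdom c \<inter> cdom c'))"

definition tspace :: "('a, 'e::euclidean_space) chart set \<Rightarrow> 'a \<Rightarrow> ('a, 'e) tvec set" where
  "tspace A p = {v.
     (\<forall>c\<in>A. \<forall>c'\<in>A. p \<in> cdom c \<inter> cdom c' \<longrightarrow> v c' = transition_deriv c c' p (v c)) \<and>
     (\<forall>c. \<not> (c \<in> A \<and> p \<in> cdom c) \<longrightarrow> v c = 0)}"

definition lincomb :: "real \<Rightarrow> ('a, 'e::real_vector) tvec \<Rightarrow> real \<Rightarrow> ('a, 'e) tvec \<Rightarrow> ('a, 'e) tvec" where
  "lincomb a v b w = (\<lambda>c. a *\<^sub>R v c + b *\<^sub>R w c)"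

text \<open>The tangent vector at \<open>p\<close> whose representation in the chart \<open>c\<close> is \<open>u\<close>.\<close>

definition tvec_of :: "('a, 'e::euclidean_space) chart set \<Rightarrow> 'a \<Rightarrow> ('a, 'e) chart \<Rightarrow> 'e \<Rightarrow> ('a, 'e) tvec" where
  "tvec_of A p c u = (\<lambda>c'. if c' \<in> A \<and> p \<in> cdom c' then transition_deriv c c' p u else 0)"

definition chart_at :: "('a, 'e) chart set \<Rightarrow> 'a \<Rightarrow> ('a, 'e) chart" where
  "chart_at A p = (SOME c. c \<in> A \<and> p \<in> cdom c)"

text \<open>The tangent map at \<open>p\<close> of a map defined on a subset \<open>S\<close> of the manifold \<open>A\<close>; \<open>S\<close> is the
  whole manifold or a domain with corners such as \<open>U\<^sub>X\<close>.\<close>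

definition tmap ::
  "('a, 'e::euclidean_space) chart set \<Rightarrow> ('b, 'f::euclidean_space) chart set \<Rightarrow> 'a set \<Rightarrow>
   ('a \<Rightarrow> 'b) \<Rightarrow> 'a \<Rightarrow> ('a, 'e) tvec \<Rightarrow> ('b, 'f) tvec" where
  "tmap A B S f p v =
     (let c = chart_at A p; c' = chart_at B (f p)
      in tvec_of B (f p) c'
           (frechet_derivative (cmap c' \<circ> f \<circ> cinv c) (at (cmap c p) within cmap c ` (S \<inter> cdom c)) (v c)))"

definition velocity :: "('b, 'f::euclidean_space) chart set \<Rightarrow> (real \<Rightarrow> 'b) \<Rightarrow> ('b, 'f) tvec" where
  "velocity B \<kappa> = tmap euclidean_atlas B UNIV \<kappa> 0 (tvec_of euclidean_atlas 0 (UNIV, id) 1)"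

definition smooth_vector_field ::
  "('a, 'e::euclidean_space) chart set \<Rightarrow> ('a \<Rightarrow> ('a, 'e) tvec) \<Rightarrow> bool" where
  "smooth_vector_field A W \<longleftrightarrow>
     (\<forall>p\<in>mcarrier A. W p \<in> tspace A p) \<and>
     (\<forall>c\<in>A. smooth_on (cmap c ` cdom c) (\<lambda>x. W (cinv c x) c))"

definition smooth_embedding ::
  "('a, 'e::euclidean_space) chart set \<Rightarrow> ('b, 'f::euclidean_space) chart set \<Rightarrow> ('a \<Rightarrow> 'b) \<Rightarrow> bool" where
  "smooth_embedding A B f \<longleftrightarrow>
     smooth_map A B f \<and> embedding_map (mtop A) (mtop B) f \<and>
     (\<forall>p\<in>mcarrier A. inj_on (tmap A B (mcarrier A) f p) (tspace A p))"

section \<open>Differential forms\<close>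

text \<open>A \<open>k\<close>-form is evaluated on lists of \<open>k\<close> tangent vectors; only its values on lists of this
  length with entries in the tangent space at the base point matter.\<close>

type_synonym ('a, 'e) form = "'a \<Rightarrow> ('a, 'e) tvec list \<Rightarrow> real"

definition alternating_on :: "('a, 'e::real_vector) tvec set \<Rightarrow> nat \<Rightarrow> (('a, 'e) tvec list \<Rightarrow> real) \<Rightarrow> bool" where
  "alternating_on V k \<alpha> \<longleftrightarrow>
     (\<forall>ws. set ws \<subseteq> V \<and> length ws = k \<longrightarrow>
       (\<forall>i<k. \<forall>u\<in>V. \<forall>v\<in>V. \<forall>a b.
          \<alpha> (ws[i := lincomb a u b v]) = a * \<alpha> (ws[i := u]) + b * \<alpha> (ws[i := v])) \<and>
       (\<forall>i<k. \<forall>j<k. i \<noteq> j \<and> ws ! i = ws ! j \<longrightarrow> \<alpha> ws = 0))"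

definition smooth_form :: "('a, 'e::euclidean_space) chart set \<Rightarrow> nat \<Rightarrow> ('a, 'e) form \<Rightarrow> bool" where
  "smooth_form A k \<omega> \<longleftrightarrow>
     (\<forall>p\<in>mcarrier A. alternating_on (tspace A p) k (\<omega> p)) \<and>
     (\<forall>c\<in>A. \<forall>us. length us = k \<longrightarrow>
        smooth_on (cmap c ` cdom c) (\<lambda>x. \<omega> (cinv c x) (map (tvec_of A (cinv c x) c) us)))"

definition form_eq_on ::
  "('a, 'e::euclidean_space) chart set \<Rightarrow> 'a set \<Rightarrow> nat \<Rightarrow> ('a, 'e) form \<Rightarrow> ('a, 'e) form \<Rightarrow> bool" where
  "form_eq_on A S k \<omega> \<eta> \<longleftrightarrow>
     (\<forall>p\<in>S. \<forall>ws. set ws \<subseteq> tspace A p \<and> length ws = k \<longrightarrow> \<omega> p ws = \<eta> p ws)"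

definition interior_product :: "('a \<Rightarrow> ('a, 'e) tvec) \<Rightarrow> ('a, 'e) form \<Rightarrow> ('a, 'e) form" where
  "interior_product W \<omega> = (\<lambda>p ws. \<omega> p (W p # ws))"

definition pullback ::
  "('a, 'e::euclidean_space) chart set \<Rightarrow> ('b, 'f::euclidean_space) chart set \<Rightarrow> 'a set \<Rightarrow>
   ('a \<Rightarrow> 'b) \<Rightarrow> ('b, 'f) form \<Rightarrow> ('a, 'e) form" where
  "pullback A B S f \<omega> = (\<lambda>p ws. \<omega> (f p) (map (tmap A B S f p) ws))"

definition drop_nth :: "nat \<Rightarrow> 'a list \<Rightarrow> 'a list" where
  "drop_nth i ws = take i ws @ drop (Suc i) ws"

text \<open>The exterior derivative of a form defined on \<open>S\<close>, computed in a chart \<open>c\<close> around \<open>p\<close> by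
  \<open>(d\<omega>)(u\<^sub>0,\<dots>,u\<^sub>k) = \<Sum>\<^sub>i (-1)\<^sup>i D\<omega>(u\<^sub>i)(u\<^sub>0,\<dots>,u\<^sub>k without u\<^sub>i)\<close>.\<close>

definition ext_deriv ::
  "('a, 'e::euclidean_space) chart set \<Rightarrow> 'a set \<Rightarrow> ('a, 'e) form \<Rightarrow> ('a, 'e) form" where
  "ext_deriv A S \<omega> = (\<lambda>p ws.
     let c = chart_at A p; us = map (\<lambda>w. w c) ws
     in \<Sum>i<length us. (-1)^i *
          frechet_derivative (\<lambda>x. \<omega> (cinv c x) (map (tvec_of A (cinv c x) c) (drop_nth i us)))
            (at (cmap c p) within cmap c ` (S \<inter> cdom c)) (us ! i))"

section \<open>Orientation and integration\<close>

text \<open>The indices \<open>1,\<dots>,n,0\<close> of the coordinates of \<open>X\<close> are the elements of the index type \<open>'m\<close>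
  in increasing order, so \<open>CARD('m) = n + 1\<close>.\<close>

definition index_pos :: "'m::{finite,linorder} \<Rightarrow> nat" where
  "index_pos j = card {i. i < j}"

definition std_basis :: "('m::{finite,linorder} rvec) list" where
  "std_basis = map (\<lambda>i. axis i 1) (sorted_list_of_set UNIV)"

definition vol :: "('m::{finite,linorder} rvec) list \<Rightarrow> real" where
  "vol us = det (\<chi> i j. (us ! index_pos j) $ i)"

definition orientation :: "('x, 'm::finite rvec) chart set \<Rightarrow> ('x, 'm rvec) chart set \<Rightarrow> bool" where
  "orientation X Or \<longleftrightarrow> Or \<subseteq> X \<and> mcarrier Or = mcarrier X \<and>
     (\<forall>c\<in>Or. \<forall>c'\<in>Or. \<forall>p\<in>cdom c \<inter> cdom c'. det (matrix (transition_deriv c c' p)) > 0)"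

definition partition_of_unity ::
  "('x, 'm::finite rvec) chart set \<Rightarrow> ('x, 'm rvec) chart set \<Rightarrow> 'x set \<Rightarrow>
   nat \<Rightarrow> (nat \<Rightarrow> ('x, 'm rvec) chart) \<Rightarrow> (nat \<Rightarrow> 'x \<Rightarrow> real) \<Rightarrow> bool" where
  "partition_of_unity X Or S k c \<rho> \<longleftrightarrow>
     (\<forall>i<k. c i \<in> Or \<and> smooth_map X euclidean_atlas (\<rho> i) \<and> (\<forall>p\<in>mcarrier X. 0 \<le> \<rho> i p) \<and>
        mtop X closure_of {p\<in>mcarrier X. \<rho> i p \<noteq> 0} \<subseteq> cdom (c i)) \<and>
     (\<forall>p\<in>S. (\<Sum>i<k. \<rho> i p) = 1)"

text \<open>The integral over a compact set \<open>S\<close> of a top degree form; it does not depend on the charts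
  and the partition of unity.\<close>

definition form_integral ::
  "('x, 'm::{finite,linorder} rvec) chart set \<Rightarrow> ('x, 'm rvec) chart set \<Rightarrow> 'x set \<Rightarrow>
   ('x, 'm rvec) form \<Rightarrow> real" where
  "form_integral X Or S \<omega> = (THE I. \<exists>k c \<rho>. partition_of_unity X Or S k c \<rho> \<and>
     I = (\<Sum>i<k. LINT x : cmap (c i) ` (S \<inter> cdom (c i)) | lborel.
            \<rho> i (cinv (c i) x) *
            \<omega> (cinv (c i) x) (map (tvec_of X (cinv (c i) x) (c i)) std_basis)))"

section \<open>Fiber bundles and first jets\<close>

definition fiber_bundle ::
  "('x, 'm::finite rvec) chart set \<Rightarrow> ('y, ('m, 'a::finite) bundle_model) chart set \<Rightarrow>
   ('f, 'a rvec) chart set \<Rightarrow> ('y \<Rightarrow> 'x) \<Rightarrow> bool" where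
  "fiber_bundle X Y F \<pi> \<longleftrightarrow>
     smooth_manifold X \<and> smooth_manifold Y \<and> smooth_manifold F \<and>
     smooth_map Y X \<pi> \<and> \<pi> ` mcarrier Y = mcarrier X \<and>
     (\<forall>x\<in>mcarrier X. \<exists>V \<Psi>. openin (mtop X) V \<and> x \<in> V \<and>
        diffeomorphism (sub_atlas Y (\<pi> -` V)) (prod_atlas (sub_atlas X V) F) \<Psi> \<and>
        (\<forall>y\<in>mcarrier Y \<inter> \<pi> -` V. fst (\<Psi> y) = \<pi> y))"

definition bundle_automorphism ::
  "('x, 'e::euclidean_space) chart set \<Rightarrow> ('y, 'f::euclidean_space) chart set \<Rightarrow> ('y \<Rightarrow> 'x) \<Rightarrow>
   ('y \<Rightarrow> 'y) \<Rightarrow> ('x \<Rightarrow> 'x) \<Rightarrow> bool" where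
  "bundle_automorphism X Y \<pi> \<eta>Y \<eta>X \<longleftrightarrow>
     diffeomorphism Y Y \<eta>Y \<and> diffeomorphism X X \<eta>X \<and> (\<forall>y\<in>mcarrier Y. \<pi> (\<eta>Y y) = \<eta>X (\<pi> y))"

text \<open>A point of \<open>J\<^sup>1(Y)\<close> over \<open>y\<close> is the pair of \<open>y\<close> and a linear map \<open>T\<^sub>xX \<rightarrow> T\<^sub>yY\<close>, which is
  \<^const>\<open>undefined\<close> outside \<open>T\<^sub>xX\<close>.\<close>

type_synonym ('x, 'y, 'm, 'a) jet =
  "'y \<times> (('x, 'm rvec) tvec \<Rightarrow> ('y, ('m, 'a) bundle_model) tvec)"

type_synonym ('m, 'a) jet_model = "(real^'m) \<times> (real^'a) \<times> (real^'m^'a)"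

definition jet_space ::
  "('x, 'm::finite rvec) chart set \<Rightarrow> ('y, ('m, 'a::finite) bundle_model) chart set \<Rightarrow> ('y \<Rightarrow> 'x) \<Rightarrow>
   ('x, 'y, 'm, 'a) jet set" where
  "jet_space X Y \<pi> = {(y, \<gamma>). y \<in> mcarrier Y \<and>
     \<gamma> \<in> extensional (tspace X (\<pi> y)) \<and>
     (\<forall>v\<in>tspace X (\<pi> y). \<gamma> v \<in> tspace Y y) \<and>
     (\<forall>v\<in>tspace X (\<pi> y). \<forall>w\<in>tspace X (\<pi> y). \<forall>a b.
        \<gamma> (lincomb a v b w) = lincomb a (\<gamma> v) b (\<gamma> w)) \<and>
     (\<forall>v\<in>tspace X (\<pi> y). tmap Y X (mcarrier Y) \<pi> y (\<gamma> v) = v)}"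

text \<open>\<open>f = (x\<^sup>\<mu>, y\<^sup>A)\<close> are bundle coordinates of \<open>Y\<close> over the coordinates \<open>g = (x\<^sup>\<mu>)\<close> of \<open>X\<close>.\<close>

definition adapted_charts ::
  "('x, 'm::finite rvec) chart set \<Rightarrow> ('y, ('m, 'a::finite) bundle_model) chart set \<Rightarrow> ('y \<Rightarrow> 'x) \<Rightarrow>
   (('x, 'm rvec) chart \<times> ('y, ('m, 'a) bundle_model) chart) set" where
  "adapted_charts X Y \<pi> = {(g, f). g \<in> X \<and> f \<in> Y \<and> \<pi> ` cdom f \<subseteq> cdom g \<and>
     (\<forall>y\<in>cdom f. fst (cmap f y) = cmap g (\<pi> y))}"

text \<open>The induced coordinates \<open>(x\<^sup>\<mu>, y\<^sup>A, v\<^sup>A\<^sub>\<mu>)\<close> on \<open>J\<^sup>1(Y)\<close>, where \<open>v\<^sup>A\<^sub>\<mu> = dy\<^sup>A(\<gamma>(\<partial>\<^sub>\<mu>))\<close>.\<close>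

definition jet_chart ::
  "('x, 'm::finite rvec) chart set \<Rightarrow> ('y, ('m, 'a::finite) bundle_model) chart set \<Rightarrow> ('y \<Rightarrow> 'x) \<Rightarrow>
   ('x, 'm rvec) chart \<times> ('y, ('m, 'a) bundle_model) chart \<Rightarrow>
   (('x, 'y, 'm, 'a) jet, ('m, 'a) jet_model) chart" where
  "jet_chart X Y \<pi> = (\<lambda>(g, f).
     ({p \<in> jet_space X Y \<pi>. fst p \<in> cdom f},
      \<lambda>(y, \<gamma>). (fst (cmap f y), snd (cmap f y),
         \<chi> A \<mu>. snd (\<gamma> (tvec_of X (\<pi> y) g (axis \<mu> 1)) f) $ A)))"

definition jet_atlas ::
  "('x, 'm::finite rvec) chart set \<Rightarrow> ('y, ('m, 'a::finite) bundle_model) chart set \<Rightarrow> ('y \<Rightarrow> 'x) \<Rightarrow>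
   (('x, 'y, 'm, 'a) jet, ('m, 'a) jet_model) chart set" where
  "jet_atlas X Y \<pi> = jet_chart X Y \<pi> ` adapted_charts X Y \<pi>"

definition jet_section ::
  "('x, 'm::finite rvec) chart set \<Rightarrow> ('y, ('m, 'a::finite) bundle_model) chart set \<Rightarrow>
   'x set \<Rightarrow> ('x \<Rightarrow> 'y) \<Rightarrow> 'x \<Rightarrow> ('x, 'y, 'm, 'a) jet" where
  "jet_section X Y S \<sigma> = (\<lambda>x. (\<sigma> x, restrict (tmap X Y S \<sigma> x) (tspace X x)))"

definition jet_prolongation ::
  "('x, 'm::finite rvec) chart set \<Rightarrow> ('y, ('m, 'a::finite) bundle_model) chart set \<Rightarrow> ('y \<Rightarrow> 'x) \<Rightarrow>
   ('y \<Rightarrow> 'y) \<Rightarrow> ('x \<Rightarrow> 'x) \<Rightarrow> ('x, 'y, 'm, 'a) jet \<Rightarrow> ('x, 'y, 'm, 'a) jet" where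
  "jet_prolongation X Y \<pi> \<eta>Y \<eta>X = (\<lambda>(y, \<gamma>).
     (\<eta>Y y, restrict
        (tmap Y Y (mcarrier Y) \<eta>Y y \<circ> \<gamma> \<circ> tmap X X (mcarrier X) (inv_into (mcarrier X) \<eta>X) (\<eta>X (\<pi> y)))
        (tspace X (\<eta>X (\<pi> y)))))"

section \<open>Lagrangian field theory\<close>

type_synonym ('x, 'y, 'm, 'a) lagrangian = "('x, 'y, 'm, 'a) jet \<Rightarrow> ('x, 'm rvec) tvec list \<Rightarrow> real"

text \<open>The coefficient \<open>L\<close> in \<open>\<L>(\<gamma>) = L d\<^sup>n\<^sup>+\<^sup>1x\<close>, as a function of \<open>(x\<^sup>\<mu>, y\<^sup>A, v\<^sup>A\<^sub>\<mu>)\<close>.\<close>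

definition lagrangian_coord ::
  "('x, 'm::{finite,linorder} rvec) chart set \<Rightarrow> ('y, ('m, 'a::finite) bundle_model) chart set \<Rightarrow>
   ('y \<Rightarrow> 'x) \<Rightarrow> ('x, 'y, 'm, 'a) lagrangian \<Rightarrow>
   ('x, 'm rvec) chart \<times> ('y, ('m, 'a) bundle_model) chart \<Rightarrow> ('m, 'a) jet_model \<Rightarrow> real" where
  "lagrangian_coord X Y \<pi> \<L> gf z =
     (let p = cinv (jet_chart X Y \<pi> gf) z
      in \<L> p (map (tvec_of X (\<pi> (fst p)) (fst gf)) std_basis))"

definition lagrangian_density ::
  "('x, 'm::{finite,linorder} rvec) chart set \<Rightarrow> ('y, ('m, 'a::finite) bundle_model) chart set \<Rightarrow>
   ('y \<Rightarrow> 'x) \<Rightarrow> ('x, 'y, 'm, 'a) lagrangian \<Rightarrow> bool" where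
  "lagrangian_density X Y \<pi> \<L> \<longleftrightarrow>
     (\<forall>p\<in>jet_space X Y \<pi>. alternating_on (tspace X (\<pi> (fst p))) CARD('m) (\<L> p)) \<and>
     (\<forall>gf\<in>adapted_charts X Y \<pi>.
        smooth_on (cmap (jet_chart X Y \<pi> gf) ` cdom (jet_chart X Y \<pi> gf)) (lagrangian_coord X Y \<pi> \<L> gf))"

text \<open>The Cartan form in coordinates. Since \<open>d\<^sup>nx\<^sub>\<mu> = \<partial>\<^sub>\<mu> \<lrcorner> d\<^sup>n\<^sup>+\<^sup>1x\<close>, the form
  \<open>dy\<^sup>A \<and> d\<^sup>nx\<^sub>\<mu>\<close> is \<open>(w\<^sub>0,\<dots>,w\<^sub>n) \<mapsto> \<Sum>\<^sub>i (-1)\<^sup>i dy\<^sup>A(w\<^sub>i) d\<^sup>n\<^sup>+\<^sup>1x(\<partial>\<^sub>\<mu>, w\<^sub>0,\<dots>,w\<^sub>n without w\<^sub>i)\<close>.\<close>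

definition dy_wedge_dx :: "'a \<Rightarrow> 'm \<Rightarrow> ('m::{finite,linorder}, 'a::finite) jet_model list \<Rightarrow> real" where
  "dy_wedge_dx A \<mu> us =
     (\<Sum>i<length us. (-1)^i * (fst (snd (us ! i)) $ A) * vol (axis \<mu> 1 # map fst (drop_nth i us)))"

definition cartan_form ::
  "('x, 'm::{finite,linorder} rvec) chart set \<Rightarrow> ('y, ('m, 'a::finite) bundle_model) chart set \<Rightarrow>
   ('y \<Rightarrow> 'x) \<Rightarrow> ('x, 'y, 'm, 'a) lagrangian \<Rightarrow> (('x, 'y, 'm, 'a) jet, ('m, 'a) jet_model) form" where
  "cartan_form X Y \<pi> \<L> = (\<lambda>p ws.
     let gf = (SOME gf. gf \<in> adapted_charts X Y \<pi> \<and> fst p \<in> cdom (snd gf));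
         h = jet_chart X Y \<pi> gf;
         z = cmap h p;
         v = snd (snd z);
         L = lagrangian_coord X Y \<pi> \<L> gf;
         L' = (\<lambda>A \<mu>. frechet_derivative L (at z) (0, 0, axis A (axis \<mu> 1)));
         us = map (\<lambda>w. w h) ws
     in (\<Sum>A\<in>UNIV. \<Sum>\<mu>\<in>UNIV. L' A \<mu> * dy_wedge_dx A \<mu> us) +
        (L z - (\<Sum>A\<in>UNIV. \<Sum>\<mu>\<in>UNIV. L' A \<mu> * v $ A $ \<mu>)) * vol (map fst us))"

definition cartan_omega ::
  "('x, 'm::{finite,linorder} rvec) chart set \<Rightarrow> ('y, ('m, 'a::finite) bundle_model) chart set \<Rightarrow>
   ('y \<Rightarrow> 'x) \<Rightarrow> ('x, 'y, 'm, 'a) lagrangian \<Rightarrow> (('x, 'y, 'm, 'a) jet, ('m, 'a) jet_model) form" where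
  "cartan_omega X Y \<pi> \<L> = (\<lambda>p ws. - ext_deriv (jet_atlas X Y \<pi>) (jet_space X Y \<pi>) (cartan_form X Y \<pi> \<L>) p ws)"

definition configurations ::
  "('x, 'm::finite rvec) chart set \<Rightarrow> ('y, ('m, 'a::finite) bundle_model) chart set \<Rightarrow> ('y \<Rightarrow> 'x) \<Rightarrow>
   ('u, 'm rvec) chart set \<Rightarrow> ('u \<Rightarrow> 'y) set" where
  "configurations X Y \<pi> U = {\<phi>. smooth_map U Y \<phi> \<and> smooth_embedding U X (\<pi> \<circ> \<phi>)}"

definition base_image :: "('y \<Rightarrow> 'x) \<Rightarrow> ('u, 'e) chart set \<Rightarrow> ('u \<Rightarrow> 'y) \<Rightarrow> 'x set" where
  "base_image \<pi> U \<phi> = (\<pi> \<circ> \<phi>) ` mcarrier U"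

definition section_of :: "('y \<Rightarrow> 'x) \<Rightarrow> ('u, 'e) chart set \<Rightarrow> ('u \<Rightarrow> 'y) \<Rightarrow> 'x \<Rightarrow> 'y" where
  "section_of \<pi> U \<phi> = \<phi> \<circ> inv_into (mcarrier U) (\<pi> \<circ> \<phi>)"

definition section_action ::
  "('x, 'm::{finite,linorder} rvec) chart set \<Rightarrow> ('x, 'm rvec) chart set \<Rightarrow>
   ('y, ('m, 'a::finite) bundle_model) chart set \<Rightarrow> ('x, 'y, 'm, 'a) lagrangian \<Rightarrow>
   'x set \<Rightarrow> ('x \<Rightarrow> 'y) \<Rightarrow> real" where
  "section_action X Or Y \<L> S \<sigma> = form_integral X Or S (\<lambda>x. \<L> (jet_section X Y S \<sigma> x))"

text \<open>\<open>\<Phi>(\<eta>\<^sub>Y, \<phi>)\<close> is a section over \<open>\<eta>\<^sub>X(U\<^sub>X)\<close>, not a map on \<open>U\<close>; its action is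
  \<open>section_action\<close> over that set.\<close>

definition action_function ::
  "('x, 'm::{finite,linorder} rvec) chart set \<Rightarrow> ('x, 'm rvec) chart set \<Rightarrow>
   ('y, ('m, 'a::finite) bundle_model) chart set \<Rightarrow> ('y \<Rightarrow> 'x) \<Rightarrow> ('x, 'y, 'm, 'a) lagrangian \<Rightarrow>
   ('u, 'm rvec) chart set \<Rightarrow> ('u \<Rightarrow> 'y) \<Rightarrow> real" where
  "action_function X Or Y \<pi> \<L> U \<phi> = section_action X Or Y \<L> (base_image \<pi> U \<phi>) (section_of \<pi> U \<phi>)"

definition transformed_section ::
  "('x, 'e) chart set \<Rightarrow> ('y \<Rightarrow> 'x) \<Rightarrow> ('u, 'f) chart set \<Rightarrow> ('y \<Rightarrow> 'y) \<Rightarrow> ('x \<Rightarrow> 'x) \<Rightarrow> ('u \<Rightarrow> 'y) \<Rightarrow> 'x \<Rightarrow> 'y" where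
  "transformed_section X \<pi> U \<eta>Y \<eta>X \<phi> = \<eta>Y \<circ> section_of \<pi> U \<phi> \<circ> inv_into (mcarrier X) \<eta>X"

definition el_solutions ::
  "('x, 'm::{finite,linorder} rvec) chart set \<Rightarrow> ('y, ('m, 'a::finite) bundle_model) chart set \<Rightarrow>
   ('y \<Rightarrow> 'x) \<Rightarrow> ('x, 'y, 'm, 'a) lagrangian \<Rightarrow> ('u, 'm rvec) chart set \<Rightarrow> ('u \<Rightarrow> 'y) set" where
  "el_solutions X Y \<pi> \<L> U = {\<phi> \<in> configurations X Y \<pi> U.
     \<forall>W. smooth_vector_field (jet_atlas X Y \<pi>) W \<longrightarrow>
       form_eq_on X (base_image \<pi> U \<phi>) CARD('m)
         (pullback X (jet_atlas X Y \<pi>) (base_image \<pi> U \<phi>)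
            (jet_section X Y (base_image \<pi> U \<phi>) (section_of \<pi> U \<phi>))
            (interior_product W (cartan_omega X Y \<pi> \<L>)))
         (\<lambda>_ _. 0)}"

section \<open>Lie group actions by bundle automorphisms\<close>

definition lie_group :: "('g, 'k) monoid_scheme \<Rightarrow> ('g, 'h::euclidean_space) chart set \<Rightarrow> bool" where
  "lie_group G A \<longleftrightarrow> group G \<and> smooth_manifold A \<and> carrier G = mcarrier A \<and>
     smooth_map (prod_atlas A A) A (\<lambda>(a, b). a \<otimes>\<^bsub>G\<^esub> b) \<and> smooth_map A A (\<lambda>a. inv\<^bsub>G\<^esub> a)"

abbreviation lie_algebra :: "('g, 'k) monoid_scheme \<Rightarrow> ('g, 'h::euclidean_space) chart set \<Rightarrow> ('g, 'h) tvec set" where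
  "lie_algebra G A \<equiv> tspace A \<one>\<^bsub>G\<^esub>"

text \<open>\<open>t \<mapsto> exp(t\<xi>)\<close>, the unique one-parameter subgroup with velocity \<open>\<xi>\<close> at the identity.\<close>

definition one_param_group ::
  "('g, 'k) monoid_scheme \<Rightarrow> ('g, 'h::euclidean_space) chart set \<Rightarrow> ('g, 'h) tvec \<Rightarrow> real \<Rightarrow> 'g" where
  "one_param_group G A \<xi> = (SOME \<kappa>. smooth_map euclidean_atlas A \<kappa> \<and>
     (\<forall>s t. \<kappa> (s + t) = \<kappa> s \<otimes>\<^bsub>G\<^esub> \<kappa> t) \<and> velocity A \<kappa> = \<xi>)"

text \<open>\<open>\<rho> g\<close> is the automorphism of \<open>Y\<close> given by \<open>g\<close>, and \<open>\<rho>X g\<close> the diffeomorphism of \<open>X\<close> that it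
  covers.\<close>

definition acts_by_bundle_automorphisms ::
  "('g, 'k) monoid_scheme \<Rightarrow> ('g, 'h::euclidean_space) chart set \<Rightarrow> ('x, 'e::euclidean_space) chart set \<Rightarrow>
   ('y, 'f::euclidean_space) chart set \<Rightarrow> ('y \<Rightarrow> 'x) \<Rightarrow> ('g \<Rightarrow> 'y \<Rightarrow> 'y) \<Rightarrow> ('g \<Rightarrow> 'x \<Rightarrow> 'x) \<Rightarrow> bool" where
  "acts_by_bundle_automorphisms G A X Y \<pi> \<rho> \<rho>X \<longleftrightarrow>
     lie_group G A \<and> group_action G (mcarrier Y) \<rho> \<and>
     smooth_map (prod_atlas A Y) Y (\<lambda>(g, y). \<rho> g y) \<and>
     (\<forall>g\<in>carrier G. bundle_automorphism X Y \<pi> (\<rho> g) (\<rho>X g))"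

definition action_invariant ::
  "('g, 'k) monoid_scheme \<Rightarrow> ('x, 'm::{finite,linorder} rvec) chart set \<Rightarrow> ('x, 'm rvec) chart set \<Rightarrow>
   ('y, ('m, 'a::finite) bundle_model) chart set \<Rightarrow> ('y \<Rightarrow> 'x) \<Rightarrow> ('x, 'y, 'm, 'a) lagrangian \<Rightarrow>
   ('u, 'm rvec) chart set \<Rightarrow> ('g \<Rightarrow> 'y \<Rightarrow> 'y) \<Rightarrow> ('g \<Rightarrow> 'x \<Rightarrow> 'x) \<Rightarrow> bool" where
  "action_invariant G X Or Y \<pi> \<L> U \<rho> \<rho>X \<longleftrightarrow>
     (\<forall>g\<in>carrier G. \<forall>\<phi>\<in>configurations X Y \<pi> U.
        section_action X Or Y \<L> (\<rho>X g ` base_image \<pi> U \<phi>) (transformed_section X \<pi> U (\<rho> g) (\<rho>X g) \<phi>) =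
        action_function X Or Y \<pi> \<L> U \<phi>)"

definition jet_generator ::
  "('g, 'k) monoid_scheme \<Rightarrow> ('g, 'h::euclidean_space) chart set \<Rightarrow>
   ('x, 'm::finite rvec) chart set \<Rightarrow> ('y, ('m, 'a::finite) bundle_model) chart set \<Rightarrow> ('y \<Rightarrow> 'x) \<Rightarrow>
   ('g \<Rightarrow> 'y \<Rightarrow> 'y) \<Rightarrow> ('g \<Rightarrow> 'x \<Rightarrow> 'x) \<Rightarrow> ('g, 'h) tvec \<Rightarrow>
   ('x, 'y, 'm, 'a) jet \<Rightarrow> (('x, 'y, 'm, 'a) jet, ('m, 'a) jet_model) tvec" where
  "jet_generator G A X Y \<pi> \<rho> \<rho>X \<xi> = (\<lambda>p. velocity (jet_atlas X Y \<pi>)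
     (\<lambda>t. let g = one_param_group G A \<xi> t in jet_prolongation X Y \<pi> (\<rho> g) (\<rho>X g) p))"

text \<open>Membership of \<open>\<J>\<close> in \<open>L(\<g>, \<Lambda>\<^sup>n(J\<^sup>1(Y)))\<close> and the equation \<open>j\<^sup>1(\<xi>) \<lrcorner> \<Omega> = d\<J>(\<xi>)\<close>.\<close>

definition covariant_momentum_map ::
  "('g, 'k) monoid_scheme \<Rightarrow> ('g, 'h::euclidean_space) chart set \<Rightarrow>
   ('x, 'm::{finite,linorder} rvec) chart set \<Rightarrow> ('y, ('m, 'a::finite) bundle_model) chart set \<Rightarrow>
   ('y \<Rightarrow> 'x) \<Rightarrow> ('x, 'y, 'm, 'a) lagrangian \<Rightarrow> ('g \<Rightarrow> 'y \<Rightarrow> 'y) \<Rightarrow> ('g \<Rightarrow> 'x \<Rightarrow> 'x) \<Rightarrow>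
   (('g, 'h) tvec \<Rightarrow> (('x, 'y, 'm, 'a) jet, ('m, 'a) jet_model) form) \<Rightarrow> bool" where
  "covariant_momentum_map G A X Y \<pi> \<L> \<rho> \<rho>X \<J> \<longleftrightarrow>
     (\<forall>\<xi>\<in>lie_algebra G A. smooth_form (jet_atlas X Y \<pi>) (CARD('m) - 1) (\<J> \<xi>)) \<and>
     (\<forall>\<xi>\<in>lie_algebra G A. \<forall>\<zeta>\<in>lie_algebra G A. \<forall>a b.
        form_eq_on (jet_atlas X Y \<pi>) (jet_space X Y \<pi>) (CARD('m) - 1)
          (\<J> (lincomb a \<xi> b \<zeta>)) (\<lambda>p ws. a * \<J> \<xi> p ws + b * \<J> \<zeta> p ws)) \<and>
     (\<forall>\<xi>\<in>lie_algebra G A.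
        form_eq_on (jet_atlas X Y \<pi>) (jet_space X Y \<pi>) CARD('m)
          (interior_product (jet_generator G A X Y \<pi> \<rho> \<rho>X \<xi>) (cartan_omega X Y \<pi> \<L>))
          (ext_deriv (jet_atlas X Y \<pi>) (jet_space X Y \<pi>) (\<J> \<xi>)))"

end

theory Submission
  imports Defs
begin

text \<open>
  Let \<open>s\<close> be the jet prolongation of the section that belongs to a solution \<open>\<phi>\<close>. Noether's theorem
  is the computation
  \<open>d (s\<^sup>* \<J>(\<xi>)) = s\<^sup>* (d \<J>(\<xi>)) = s\<^sup>* (j\<^sup>1(\<xi>) \<lrcorner> \<Omega>) = 0\<close>.
  The second equation defines the momentum map and the last one is the Euler--Lagrange equation for
  the vector field \<open>j\<^sup>1(\<xi>)\<close>. The work lies in two points.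

  The first is that \<open>d\<close> commutes with pullback by \<open>s\<close> (\<open>ext_deriv_pullback\<close>), although \<open>s\<close> is
  defined only on the domain with corners \<open>U\<^sub>X\<close>, where derivatives are derivatives within the image
  of \<open>U\<^sub>X\<close> in a chart. Two properties make such derivatives tractable. They are unique
  (\<open>embedding_unique_deriv\<close>): this holds for the orthant, and the embedding is in charts the
  restriction of a local diffeomorphism, by the inverse function theorem. Moreover the section and its
  jet extend smoothly, in charts, beyond the boundary (\<open>embedding_extendable_section\<close>,
  \<open>extendable_jet_section\<close>). Hence the usual proof applies to the extensions: the product rule for
  multilinear forms produces the pullback of the exterior derivative and terms with second
  derivatives, which cancel by symmetry.

  The second point is the choice of the vector field in the Euler--Lagrange equation. The equation is
  to be used at one point at a time, and there \<open>\<Omega>\<close> sees its arguments only through their components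
  in one chart. So it is enough to have, for every jet \<open>q\<close> and every vector \<open>u\<close> of the model space, a
  smooth vector field on \<open>J\<^sup>1(Y)\<close> with components \<open>u\<close> at \<open>q\<close> (\<open>vector_field_extension\<close>). It is a
  coordinate vector field multiplied by a bump function that is pulled back from \<open>Y\<close>. This requires
  that the charts of \<open>J\<^sup>1(Y)\<close> induced by adapted charts form a smooth atlas
  (\<open>smooth_atlas_jet\<close>), and that adapted charts exist around every point
  (\<open>adapted_chart_exists\<close>).
\<close>

section \<open>Smooth functions\<close>

lemma open_differentiable_on:
  "open S \<Longrightarrow> f differentiable_on S \<longleftrightarrow> (\<forall>x\<in>S. f differentiable (at x))"
  by (simp add: differentiable_on_eq_differentiable_at)

lemma Ck_on_cong:
  assumes "open S" "\<And>x. x \<in> S \<Longrightarrow> f x = g x"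
  shows "Ck_on k S f \<Longrightarrow> Ck_on k S g"
  using assms(2)
proof (induction k arbitrary: f g)
  case 0
  then show ?case using continuous_on_cong by fastforce
next
  case (Suc k)
  have tr: "(f has_derivative D) (at x) \<longleftrightarrow> (g has_derivative D) (at x)" if "x \<in> S" for x D
    using has_derivative_transform_within_open[OF _ assms(1) that]
    by (metis Suc.prems(2))
  have fr: "frechet_derivative f (at x) = frechet_derivative g (at x)" if "x \<in> S" for x
    unfolding frechet_derivative_def using tr[OF that] by simp
  have "g differentiable_on S"
    using Suc.prems(1) tr by (auto simp: open_differentiable_on[OF assms(1)] differentiable_def)
  moreover have "Ck_on k S (\<lambda>x. frechet_derivative g (at x) v)" for v
    by (rule Suc.IH[of "\<lambda>x. frechet_derivative f (at x) v"]) (use Suc.prems(1) fr in auto)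
  ultimately show ?case by simp
qed

lemma Ck_on_subset: "Ck_on k S f \<Longrightarrow> T \<subseteq> S \<Longrightarrow> Ck_on k T f"
  by (induction k arbitrary: f) (auto intro: continuous_on_subset differentiable_on_subset)

lemma Ck_on_SucD: "Ck_on (Suc k) S f \<Longrightarrow> Ck_on k S f"
proof (induction k arbitrary: f)
  case 0
  then show ?case by (simp add: differentiable_imp_continuous_on)
next
  case (Suc k)
  then show ?case unfolding Ck_on.simps(2)[of "Suc k"] Ck_on.simps(2)[of k S f] by blast
qed

lemma Ck_on_has_derivative:
  assumes "Ck_on (Suc k) S f" "open S" "x \<in> S"
  shows "(f has_derivative frechet_derivative f (at x)) (at x)"
  using assms frechet_derivative_works by (auto simp: open_differentiable_on)

lemma Ck_on_SucI:
  assumes "open S" "\<And>x. x \<in> S \<Longrightarrow> (f has_derivative D x) (at x)"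
    "\<And>v. Ck_on k S (\<lambda>x. D x v)"
  shows "Ck_on (Suc k) S f"
proof -
  have "frechet_derivative f (at x) = D x" if "x \<in> S" for x
    using frechet_derivative_at assms(2)[OF that] by metis
  then have "Ck_on k S (\<lambda>x. frechet_derivative f (at x) v)" for v
    using Ck_on_cong[OF assms(1) _ assms(3)[of v]] by auto
  then show ?thesis
    using assms by (auto simp: open_differentiable_on differentiable_def)
qed

lemma Ck_on_const [simp]: "open S \<Longrightarrow> Ck_on k S (\<lambda>x. c)"
proof (induction k arbitrary: c)
  case (Suc k)
  then show ?case by (intro Ck_on_SucI[where D="\<lambda>_ _. 0"]) auto
qed auto

lemma Ck_on_linear:
  assumes "open S" "bounded_linear f" shows "Ck_on k S f"
proof (cases k)
  case 0
  then show ?thesis using assms linear_continuous_on by auto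
next
  case (Suc j)
  show ?thesis unfolding Suc
    by (rule Ck_on_SucI[where D="\<lambda>_. f"]) (use assms in \<open>auto intro: bounded_linear_imp_has_derivative\<close>)
qed

lemma Ck_on_add:
  assumes "open S" shows "Ck_on k S f \<Longrightarrow> Ck_on k S g \<Longrightarrow> Ck_on k S (\<lambda>x. f x + g x)"
proof (induction k arbitrary: f g)
  case 0 then show ?case by (auto intro: continuous_intros)
next
  case (Suc k)
  show ?case
    by (rule Ck_on_SucI[where D="\<lambda>x v. frechet_derivative f (at x) v + frechet_derivative g (at x) v"])
       (use Suc assms in \<open>auto intro!: has_derivative_add Ck_on_has_derivative simp del: Ck_on.simps(2)\<close>,
        use Suc in auto)
qed

lemma Ck_on_sum:
  assumes "open S" "\<And>i. i \<in> I \<Longrightarrow> Ck_on k S (f i)"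
  shows "Ck_on k S (\<lambda>x. \<Sum>i\<in>I. f i x)"
  using assms(2) by (induction I rule: infinite_finite_induct) (auto simp: assms(1) intro: Ck_on_add)

lemma Ck_on_bilinear:
  fixes prod :: "'b::euclidean_space \<Rightarrow> 'c::euclidean_space \<Rightarrow> 'd::euclidean_space"
  assumes "open S" "bounded_bilinear prod"
  shows "Ck_on k S f \<Longrightarrow> Ck_on k S g \<Longrightarrow> Ck_on k S (\<lambda>x. prod (f x) (g x))"
proof (induction k arbitrary: f g)
  case 0 then show ?case using bounded_bilinear.continuous_on[OF assms(2)] by auto
next
  case (Suc k)
  have "Ck_on k S f" "Ck_on k S g" using Suc.prems Ck_on_SucD by blast+
  then show ?case
    by (intro Ck_on_SucI[where D="\<lambda>x v. prod (f x) (frechet_derivative g (at x) v) + prod (frechet_derivative f (at x) v) (g x)"]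
        bounded_bilinear.FDERIV[OF assms(2)] Ck_on_has_derivative Ck_on_add Suc.IH assms(1))
       (use Suc.prems assms in \<open>auto\<close>)
qed

lemma linear_sum_Basis:
  fixes f :: "'a::euclidean_space \<Rightarrow> 'b::euclidean_space"
  assumes "linear f" shows "f v = (\<Sum>b\<in>Basis. (v \<bullet> b) *\<^sub>R f b)"
proof -
  have "f v = f (\<Sum>b\<in>Basis. (v \<bullet> b) *\<^sub>R b)" by (simp add: euclidean_representation)
  also have "\<dots> = (\<Sum>b\<in>Basis. (v \<bullet> b) *\<^sub>R f b)" by (simp add: linear_sum[OF assms] linear_cmul[OF assms])
  finally show ?thesis .
qed

text \<open>The chain rule, expanded over a basis, expresses the derivative of the composite by sums and
  products of functions of one order less, among them a composite to which the induction applies.\<close>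

lemma Ck_on_compose:
  assumes "open S" "open T"
  shows "Ck_on k S f \<Longrightarrow> Ck_on k T g \<Longrightarrow> f ` S \<subseteq> T \<Longrightarrow> Ck_on k S (\<lambda>x. g (f x))"
proof (induction k arbitrary: f g)
  case 0 then show ?case by (auto intro: continuous_on_compose2)
next
  case (Suc k)
  let ?D = "\<lambda>x v. \<Sum>b\<in>Basis. (frechet_derivative f (at x) v \<bullet> b) *\<^sub>R frechet_derivative g (at (f x)) b"
  have f: "Ck_on k S f" using Suc.prems Ck_on_SucD by blast
  show ?case
  proof (rule Ck_on_SucI[where D="?D", OF assms(1)])
    fix x assume x: "x \<in> S"
    have g: "(g has_derivative frechet_derivative g (at (f x))) (at (f x))"
      using Ck_on_has_derivative[OF Suc.prems(2) assms(2)] x Suc.prems(3) by auto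
    have "((\<lambda>x. g (f x)) has_derivative (\<lambda>v. frechet_derivative g (at (f x)) (frechet_derivative f (at x) v))) (at x)"
      using has_derivative_compose[OF Ck_on_has_derivative[OF Suc.prems(1) assms(1) x] g] .
    moreover have "(\<lambda>v. frechet_derivative g (at (f x)) (frechet_derivative f (at x) v)) = ?D x"
      by (intro ext linear_sum_Basis[OF has_derivative_linear[OF g]])
    ultimately show "((\<lambda>x. g (f x)) has_derivative ?D x) (at x)" by simp
  next
    fix v
    have "Ck_on k S (\<lambda>x. frechet_derivative g (at (f x)) b)" for b
      by (rule Suc.IH[OF f _ Suc.prems(3)]) (use Suc.prems(2) in simp)
    moreover have "Ck_on k S (\<lambda>x. frechet_derivative f (at x) v \<bullet> b)" for b
      by (rule Ck_on_bilinear[OF assms(1) bounded_bilinear_inner _ Ck_on_const[OF assms(1)]]) (use Suc.prems(1) in simp)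
    ultimately show "Ck_on k S (\<lambda>x. ?D x v)"
      by (intro Ck_on_sum[OF assms(1)] Ck_on_bilinear[OF assms(1) bounded_bilinear_scaleR]) blast+
  qed
qed

lemma Ck_on_local:
  assumes "open S" "\<And>x. x \<in> S \<Longrightarrow> \<exists>N. open N \<and> x \<in> N \<and> Ck_on k N f"
  shows "Ck_on k S f"
  using assms(2)
proof (induction k arbitrary: f)
  case 0
  have "continuous (at x) f" if x: "x \<in> S" for x
  proof -
    obtain N where "open N" "x \<in> N" "Ck_on 0 N f" using 0 x by blast
    then show ?thesis by (simp add: continuous_on_eq_continuous_at)
  qed
  then show ?case by (simp add: continuous_at_imp_continuous_on)
next
  case (Suc k)
  have d: "(f has_derivative frechet_derivative f (at x)) (at x)" if x: "x \<in> S" for x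
    using Suc.prems[OF x] Ck_on_has_derivative by blast
  moreover have "Ck_on k S (\<lambda>x. frechet_derivative f (at x) v)" for v
  proof (rule Suc.IH)
    fix x assume "x \<in> S"
    then show "\<exists>N. open N \<and> x \<in> N \<and> Ck_on k N (\<lambda>x. frechet_derivative f (at x) v)"
      using Suc.prems[of x] by auto
  qed
  ultimately show ?case by (intro Ck_on_SucI[OF assms(1) d])
qed

text \<open>Smoothness is a local property, and on an open set the local extensions are restrictions of
  the function itself.\<close>

lemma smooth_on_open_iff:
  assumes "open S" shows "smooth_on S f \<longleftrightarrow> (\<forall>k. Ck_on k S f)"
proof
  assume f: "smooth_on S f"
  show "\<forall>k. Ck_on k S f"
  proof (intro allI Ck_on_local[OF assms])
    fix k x assume "x \<in> S"
    then have "\<exists>N h. open N \<and> x \<in> N \<and> (\<forall>k. Ck_on k N h) \<and> (\<forall>z\<in>S \<inter> N. h z = f z)"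
      using f unfolding smooth_on_def by (rule bspec[rotated])
    then obtain N h where N: "open N" "x \<in> N" "\<forall>k. Ck_on k N h" "\<forall>z\<in>S \<inter> N. h z = f z"
      by (elim exE conjE)
    have o: "open (S \<inter> N)" using N(1) assms by blast
    have "Ck_on k (S \<inter> N) h" using N(3) Ck_on_subset[of k N h "S \<inter> N"] by simp
    then have "Ck_on k (S \<inter> N) f" using Ck_on_cong[OF o, of h f k] N(4) by simp
    then show "\<exists>N. open N \<and> x \<in> N \<and> Ck_on k N f"
      using o N(2) \<open>x \<in> S\<close> by blast
  qed
next
  assume "\<forall>k. Ck_on k S f"
  then show "smooth_on S f"
    unfolding smooth_on_def using assms by (intro ballI exI[of _ S] exI[of _ f]) simp
qed

lemma smooth_on_Ck: "open S \<Longrightarrow> smooth_on S f \<Longrightarrow> Ck_on k S f"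
  by (simp add: smooth_on_open_iff)

lemma smooth_on_local_ext:
  "smooth_on S f \<longleftrightarrow> (\<forall>x\<in>S. \<exists>N h. open N \<and> x \<in> N \<and> smooth_on N h \<and> (\<forall>z\<in>S \<inter> N. h z = f z))"
  unfolding smooth_on_def[of S] by (simp add: smooth_on_open_iff cong: conj_cong)

lemma smooth_onE:
  assumes "smooth_on S f" "x \<in> S"
  obtains N h where "open N" "x \<in> N" "smooth_on N h" "\<And>z. z \<in> S \<Longrightarrow> z \<in> N \<Longrightarrow> h z = f z"
proof -
  have "\<exists>N h. open N \<and> x \<in> N \<and> smooth_on N h \<and> (\<forall>z\<in>S \<inter> N. h z = f z)"
    using assms unfolding smooth_on_local_ext[of S] by simp
  then obtain N h where N: "open N" "x \<in> N" "smooth_on N h" "\<forall>z\<in>S \<inter> N. h z = f z"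
    by (elim exE conjE)
  show thesis by (rule that[OF N(1-3)]) (use N(4) in blast)
qed

lemma smooth_onI:
  assumes "\<And>x. x \<in> S \<Longrightarrow> \<exists>N h. open N \<and> x \<in> N \<and> smooth_on N h \<and> (\<forall>z\<in>S \<inter> N. h z = f z)"
  shows "smooth_on S f"
  using assms unfolding smooth_on_local_ext[of S] by simp

lemma smooth_on_cong_subset:
  assumes "smooth_on S f" "T \<subseteq> S" "\<And>x. x \<in> T \<Longrightarrow> g x = f x"
  shows "smooth_on T g"
proof (rule smooth_onI)
  fix x assume "x \<in> T"
  then have "x \<in> S" using assms(2) by blast
  from smooth_onE[OF assms(1) this] obtain N h where
    "open N" "x \<in> N" "smooth_on N h" "\<And>z. z \<in> S \<Longrightarrow> z \<in> N \<Longrightarrow> h z = f z"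
    by metis
  then show "\<exists>N h. open N \<and> x \<in> N \<and> smooth_on N h \<and> (\<forall>z\<in>T \<inter> N. h z = g z)"
    using assms(2,3) by (intro exI[of _ N] exI[of _ h]) auto
qed

lemma smooth_on_subset: "smooth_on S f \<Longrightarrow> T \<subseteq> S \<Longrightarrow> smooth_on T f"
  by (rule smooth_on_cong_subset) auto

lemma smooth_on_cong: "smooth_on S f \<Longrightarrow> (\<And>x. x \<in> S \<Longrightarrow> g x = f x) \<Longrightarrow> smooth_on S g"
  by (rule smooth_on_cong_subset) auto

lemma smooth_on_continuous: "smooth_on S f \<Longrightarrow> continuous_on S f"
proof (subst continuous_on_eq_continuous_within, intro ballI)
  fix x assume f: "smooth_on S f" and x: "x \<in> S"
  from smooth_onE[OF this] obtain N h where N: "open N" "x \<in> N" "smooth_on N h" "\<And>z. z \<in> S \<Longrightarrow> z \<in> N \<Longrightarrow> h z = f z"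
    by metis
  have "continuous (at x) h"
    using smooth_on_Ck[OF N(1,3), of 0] N by (simp add: continuous_on_eq_continuous_at)
  then have "continuous (at x within S) h" using continuous_at_imp_continuous_at_within by blast
  moreover obtain d where "d > 0" "ball x d \<subseteq> N" using N openE by blast
  ultimately show "continuous (at x within S) f"
    using continuous_transform_within[of x S h d f] x N(4) by (simp add: dist_commute subset_eq)
qed

lemma smooth_on_compose:
  assumes f: "smooth_on S f" and g: "smooth_on T g" and sub: "f ` S \<subseteq> T"
  shows "smooth_on S (\<lambda>x. g (f x))"
proof (rule smooth_onI)
  fix x assume x: "x \<in> S"
  obtain N h where N: "open N" "x \<in> N" "smooth_on N h" "\<And>z. z \<in> S \<Longrightarrow> z \<in> N \<Longrightarrow> h z = f z"
    using smooth_onE[OF f x] by metis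
  have fx: "f x \<in> T" using x sub by blast
  obtain M k where M: "open M" "f x \<in> M" "smooth_on M k" "\<And>z. z \<in> T \<Longrightarrow> z \<in> M \<Longrightarrow> k z = g z"
    using smooth_onE[OF g fx] by metis
  define N' where "N' = N \<inter> h -` M"
  have o: "open N'" using continuous_open_preimage[OF smooth_on_continuous[OF N(3)] N(1) M(1)] by (simp add: N'_def)
  have "smooth_on N' (\<lambda>x. k (h x))"
    unfolding smooth_on_open_iff[OF o]
  proof
    fix j
    have "Ck_on j N' h" by (rule Ck_on_subset[OF smooth_on_Ck[OF N(1,3)]]) (simp add: N'_def)
    then show "Ck_on j N' (\<lambda>x. k (h x))"
      by (rule Ck_on_compose[OF o M(1) _ smooth_on_Ck[OF M(1,3)]]) (auto simp: N'_def)
  qed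
  moreover have "x \<in> N'" using N(2) M(2) N(4)[OF x N(2)] by (simp add: N'_def)
  moreover have "k (h z) = g (f z)" if "z \<in> S \<inter> N'" for z
  proof -
    have "h z = f z" "h z \<in> M" using that N(4) by (auto simp: N'_def)
    then show ?thesis using that sub M(4)[of "f z"] by auto
  qed
  ultimately show "\<exists>N h. open N \<and> x \<in> N \<and> smooth_on N h \<and> (\<forall>z\<in>S \<inter> N. h z = g (f z))"
    using o by (intro exI[of _ N'] exI[of _ "\<lambda>x. k (h x)"] conjI ballI)
qed

lemma smooth_on_const [simp]: "smooth_on S (\<lambda>x. c)"
  by (rule smooth_on_subset[of UNIV]) (simp_all add: smooth_on_open_iff)

lemma smooth_on_linear: "bounded_linear f \<Longrightarrow> smooth_on S f"
  by (rule smooth_on_subset[of UNIV]) (auto simp: smooth_on_open_iff intro: Ck_on_linear)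

lemma smooth_on_linear_compose: "bounded_linear g \<Longrightarrow> smooth_on S f \<Longrightarrow> smooth_on S (\<lambda>x. g (f x))"
  using smooth_on_compose[of S f UNIV g] smooth_on_linear by blast

lemma smooth_on_id [simp]: "smooth_on S (\<lambda>x. x)"
  by (rule smooth_on_linear) simp

lemma smooth_on_add:
  assumes f: "smooth_on S f" and g: "smooth_on S g"
  shows "smooth_on S (\<lambda>x. f x + g x)"
proof (rule smooth_onI)
  fix x assume x: "x \<in> S"
  obtain N h where N: "open N" "x \<in> N" "smooth_on N h" "\<And>z. z \<in> S \<Longrightarrow> z \<in> N \<Longrightarrow> h z = f z"
    using smooth_onE[OF f x] by metis
  obtain M k where M: "open M" "x \<in> M" "smooth_on M k" "\<And>z. z \<in> S \<Longrightarrow> z \<in> M \<Longrightarrow> k z = g z"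
    using smooth_onE[OF g x] by metis
  have o: "open (N \<inter> M)" using N M by blast
  have "Ck_on j (N \<inter> M) (\<lambda>x. h x + k x)" for j
    using Ck_on_add[OF o Ck_on_subset[OF smooth_on_Ck[OF N(1,3)]] Ck_on_subset[OF smooth_on_Ck[OF M(1,3)]]] by simp
  then have "smooth_on (N \<inter> M) (\<lambda>x. h x + k x)" by (simp add: smooth_on_open_iff[OF o])
  then show "\<exists>N h. open N \<and> x \<in> N \<and> smooth_on N h \<and> (\<forall>z\<in>S \<inter> N. h z = f z + g z)"
    using o N(2,4) M(2,4) by (intro exI[of _ "N \<inter> M"] exI[of _ "\<lambda>x. h x + k x"]) simp
qed

lemma smooth_on_Pair:
  assumes "smooth_on S f" "smooth_on S g"
  shows "smooth_on S (\<lambda>x. (f x, g x))"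
proof -
  have bl: "bounded_linear (\<lambda>x. (x, 0))" "bounded_linear (\<lambda>x. (0, x))"
    by (auto intro!: bounded_linear_Pair)
  show ?thesis
    using smooth_on_add[OF smooth_on_linear_compose[OF bl(1) assms(1)] smooth_on_linear_compose[OF bl(2) assms(2)]]
    by simp
qed

lemma smooth_on_bilinear:
  fixes prod :: "'b::euclidean_space \<Rightarrow> 'c::euclidean_space \<Rightarrow> 'd::euclidean_space"
  assumes "bounded_bilinear prod" "smooth_on S f" "smooth_on S g"
  shows "smooth_on S (\<lambda>x. prod (f x) (g x))"
proof -
  have "smooth_on UNIV (\<lambda>p. prod (fst p) (snd p))"
    by (simp add: smooth_on_open_iff Ck_on_bilinear[OF _ assms(1)] Ck_on_linear bounded_linear_fst bounded_linear_snd)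
  from smooth_on_compose[OF smooth_on_Pair[OF assms(2,3)] this] show ?thesis by simp
qed

lemmas smooth_on_scaleR = smooth_on_bilinear[OF bounded_bilinear_scaleR]
lemmas smooth_on_mult = smooth_on_bilinear[OF bounded_bilinear_mult]
lemmas smooth_on_inner = smooth_on_bilinear[OF bounded_bilinear_inner]
lemmas smooth_on_fst = smooth_on_linear_compose[OF bounded_linear_fst]
lemmas smooth_on_snd = smooth_on_linear_compose[OF bounded_linear_snd]
lemmas smooth_on_nth = smooth_on_linear_compose[OF bounded_linear_vec_nth]

lemma smooth_on_minus: "smooth_on S f \<Longrightarrow> smooth_on S (\<lambda>x. - f x)"
  using smooth_on_linear_compose[OF bounded_linear_minus[OF bounded_linear_ident]] by fastforce

lemma smooth_on_diff: "smooth_on S f \<Longrightarrow> smooth_on S g \<Longrightarrow> smooth_on S (\<lambda>x. f x - g x)"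
  using smooth_on_add[OF _ smooth_on_minus] by fastforce

lemma smooth_on_sum: "(\<And>i. i \<in> I \<Longrightarrow> smooth_on S (f i)) \<Longrightarrow> smooth_on S (\<lambda>x. \<Sum>i\<in>I. f i x)"
  by (induction I rule: infinite_finite_induct) (auto intro: smooth_on_add)

lemma smooth_on_prod:
  fixes f :: "'i \<Rightarrow> 'a::euclidean_space \<Rightarrow> real"
  shows "(\<And>i. i \<in> I \<Longrightarrow> smooth_on S (f i)) \<Longrightarrow> smooth_on S (\<lambda>x. \<Prod>i\<in>I. f i x)"
  by (induction I rule: infinite_finite_induct) (auto intro: smooth_on_mult)

lemma smooth_on_componentwise:
  fixes f :: "'a::euclidean_space \<Rightarrow> 'b::euclidean_space"
  assumes "\<And>b. b \<in> Basis \<Longrightarrow> smooth_on S (\<lambda>x. f x \<bullet> b)" shows "smooth_on S f"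
proof -
  have "smooth_on S (\<lambda>x. \<Sum>b\<in>Basis. (f x \<bullet> b) *\<^sub>R b)"
    by (intro smooth_on_sum smooth_on_scaleR assms smooth_on_const)
  then show ?thesis by (simp add: euclidean_representation)
qed

lemma smooth_on_vec_lambda:
  fixes f :: "'a::euclidean_space \<Rightarrow> 'i::finite \<Rightarrow> 'b::euclidean_space"
  assumes "\<And>i. smooth_on S (\<lambda>x. f x i)" shows "smooth_on S (\<lambda>x. \<chi> i. f x i)"
proof (rule smooth_on_componentwise)
  fix b :: "'b^'i" assume "b \<in> Basis"
  then obtain i u where "b = axis i u" by (auto simp: Basis_vec_def)
  then show "smooth_on S (\<lambda>x. (\<chi> i. f x i) \<bullet> b)"
    using smooth_on_inner[OF assms[of i] smooth_on_const[of S u]] by (simp add: inner_axis)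
qed

lemma smooth_on_has_derivative:
  assumes "smooth_on S f" "open S" "x \<in> S"
  shows "(f has_derivative frechet_derivative f (at x)) (at x)"
  using Ck_on_has_derivative smooth_on_Ck assms by blast

lemma smooth_on_frechet:
  assumes "smooth_on S f" "open S"
  shows "smooth_on S (\<lambda>x. frechet_derivative f (at x) v)"
  using assms by (metis Ck_on.simps(2) smooth_on_open_iff)

text \<open>By linearity in the direction it suffices to consider the finitely many derivatives in the
  directions of the basis.\<close>

lemma smooth_on_frechet_compose:
  assumes f: "smooth_on T f" "open T" and a: "smooth_on S a" "a ` S \<subseteq> T" and w: "smooth_on S w"
  shows "smooth_on S (\<lambda>x. frechet_derivative f (at (a x)) (w x))"
proof -
  have "smooth_on S (\<lambda>x. \<Sum>b\<in>Basis. (w x \<bullet> b) *\<^sub>R frechet_derivative f (at (a x)) b)"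
    by (intro smooth_on_sum smooth_on_scaleR smooth_on_inner w smooth_on_const
        smooth_on_compose[OF a(1) smooth_on_frechet[OF f] a(2)])
  then show ?thesis
    by (rule smooth_on_cong)
       (use a(2) in \<open>blast intro: linear_sum_Basis[OF has_derivative_linear[OF smooth_on_has_derivative[OF f]]]\<close>)
qed

lemma smooth_on_within_derivative:
  assumes "smooth_on S f" "x \<in> S"
  shows "f differentiable (at x within S)"
proof -
  obtain N h where N: "open N" "x \<in> N" "smooth_on N h" "\<And>z. z \<in> S \<Longrightarrow> z \<in> N \<Longrightarrow> h z = f z"
    using smooth_onE[OF assms] by metis
  have "(h has_derivative frechet_derivative h (at x)) (at x within S)"
    using smooth_on_has_derivative[OF N(3,1,2)] has_derivative_at_withinI by blast
  moreover obtain d where "d > 0" "ball x d \<subseteq> N" using N openE by blast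
  ultimately have "(f has_derivative frechet_derivative h (at x)) (at x within S)"
    using N(4) assms(2) has_derivative_transform_within[of h _ x S d f] by (simp add: dist_commute subset_eq)
  then show ?thesis by (auto simp: differentiable_def)
qed

subsection \<open>Division and determinants\<close>

lemma Ck_on_real:
  fixes f :: "real \<Rightarrow> real"
  assumes "open S" "\<And>x. x \<in> S \<Longrightarrow> (f has_real_derivative f' x) (at x)" "Ck_on k S f'"
  shows "Ck_on (Suc k) S f"
proof (rule Ck_on_SucI[OF assms(1), where D="\<lambda>x v. f' x * v"])
  show "(f has_derivative (*) (f' x)) (at x)" if "x \<in> S" for x
    using assms(2)[OF that] by (simp add: has_field_derivative_def)
  show "Ck_on k S (\<lambda>x. f' x * v)" for v
    by (rule Ck_on_bilinear[OF assms(1) bounded_bilinear_mult assms(3) Ck_on_const[OF assms(1)]])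
qed

lemma smooth_on_inverse: "smooth_on {x::real. x \<noteq> 0} inverse"
proof -
  have o: "open {x::real. x \<noteq> 0}" by (simp add: open_Collect_neq)
  have "Ck_on k {x::real. x \<noteq> 0} inverse" for k
  proof (induction k)
    case 0 show ?case by (auto intro!: continuous_intros)
  next
    case (Suc k)
    have "Ck_on k {x::real. x \<noteq> 0} (\<lambda>x. - (inverse x * inverse x))"
      using Ck_on_bilinear[OF o bounded_bilinear_mult
          Ck_on_bilinear[OF o bounded_bilinear_mult Suc Suc] Ck_on_const[OF o, of _ "-1"]] by simp
    moreover have "(inverse has_real_derivative - (inverse x * inverse x)) (at x)" if "x \<noteq> 0" for x :: real
      using DERIV_inverse[OF that] by (simp add: power2_eq_square)
    ultimately show ?case by (intro Ck_on_real[OF o]) auto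
  qed
  then show ?thesis by (simp add: smooth_on_open_iff[OF o])
qed

lemma smooth_on_divide:
  fixes f g :: "'a::euclidean_space \<Rightarrow> real"
  assumes "smooth_on S f" "smooth_on S g" "\<And>x. x \<in> S \<Longrightarrow> g x \<noteq> 0"
  shows "smooth_on S (\<lambda>x. f x / g x)"
proof -
  have "smooth_on S (\<lambda>x. f x * inverse (g x))"
    by (rule smooth_on_mult[OF assms(1) smooth_on_compose[OF assms(2) smooth_on_inverse]]) (use assms(3) in auto)
  then show ?thesis by (simp add: divide_inverse)
qed

lemma smooth_on_det:
  fixes f :: "'a::euclidean_space \<Rightarrow> real^'n^'n"
  assumes "\<And>i j. smooth_on S (\<lambda>x. f x $ i $ j)"
  shows "smooth_on S (\<lambda>x. det (f x))"
  unfolding det_def by (intro smooth_on_sum smooth_on_mult smooth_on_const smooth_on_prod assms)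

subsection \<open>A bump function\<close>

text \<open>The functions \<open>exp (-1/t) / t^j\<close>, extended by \<open>0\<close>. The powers of \<open>1/t\<close> are included because
  the family is then closed under differentiation, up to linear combinations.\<close>

definition flat_exp :: "nat \<Rightarrow> real \<Rightarrow> real" where
  "flat_exp j t = (if t > 0 then exp (- inverse t) * inverse t ^ j else 0)"

lemma flat_exp_tendsto: "(flat_exp j \<longlongrightarrow> 0) (at 0)"
proof -
  have "((\<lambda>t. t ^ j / exp t) \<longlongrightarrow> 0) (at_top :: real filter)"
    by (rule tendsto_power_div_exp_0)
  then have "((\<lambda>t. inverse t ^ j / exp (inverse t)) \<longlongrightarrow> 0) (at_right (0::real))"
    by (rule filterlim_compose) (rule filterlim_inverse_at_top_right)
  then have "(flat_exp j \<longlongrightarrow> 0) (at_right 0)"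
    by (rule Lim_transform_eventually)
       (auto simp: eventually_at_filter flat_exp_def exp_minus field_simps)
  moreover have "(flat_exp j \<longlongrightarrow> 0) (at_left 0)"
    by (rule tendsto_eventually) (auto simp: eventually_at_filter flat_exp_def)
  ultimately show ?thesis by (simp add: filterlim_split_at)
qed

text \<open>At \<open>0\<close> the difference quotient of one member of the family is the next member, which tends to
  \<open>0\<close>; elsewhere this is the product rule.\<close>

lemma flat_exp_deriv:
  "(flat_exp j has_real_derivative flat_exp (j + 2) t - real j * flat_exp (j + 1) t) (at t)"
proof (cases "t = 0")
  case True
  have "((\<lambda>h. (flat_exp j (0 + h) - flat_exp j 0) / h) \<longlongrightarrow> 0) (at 0)"
    by (rule Lim_transform_eventually[OF flat_exp_tendsto[of "Suc j"]])
       (auto simp: eventually_at_filter flat_exp_def field_simps)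
  then show ?thesis using True by (simp add: DERIV_def flat_exp_def)
next
  case False
  show ?thesis
  proof (cases "t > 0")
    case True
    have i: "(inverse has_real_derivative - (inverse t ^ 2)) (at t)"
      using DERIV_inverse[OF \<open>t \<noteq> 0\<close>] by (simp add: numeral_2_eq_2)
    have e: "((\<lambda>t. exp (- inverse t)) has_real_derivative exp (- inverse t) * inverse t ^ 2) (at t)"
      using DERIV_fun_exp[OF DERIV_minus[OF i]] by simp
    have "((\<lambda>t. exp (- inverse t) * inverse t ^ j) has_real_derivative
       exp (- inverse t) * inverse t ^ 2 * inverse t ^ j +
       real j * (- (inverse t ^ 2) * inverse t ^ (j - Suc 0)) * exp (- inverse t)) (at t)"
      using DERIV_mult[OF e DERIV_power[OF i, of j]] by simp
    also have "exp (- inverse t) * inverse t ^ 2 * inverse t ^ j +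
       real j * (- (inverse t ^ 2) * inverse t ^ (j - Suc 0)) * exp (- inverse t) =
       flat_exp (j + 2) t - real j * flat_exp (j + 1) t"
      using True by (cases j) (simp_all add: flat_exp_def power2_eq_square)
    finally show ?thesis
      by (rule has_field_derivative_transform_within_open[of _ _ _ "{0<..}"])
         (use True in \<open>auto simp: flat_exp_def\<close>)
  next
    case False
    with \<open>t \<noteq> 0\<close> have t: "t < 0" by simp
    have "(flat_exp j has_real_derivative 0) (at t)"
      by (rule has_field_derivative_transform_within_open[OF DERIV_const, of "{..<0}"])
         (use t in \<open>auto simp: flat_exp_def\<close>)
    then show ?thesis using t by (simp add: flat_exp_def)
  qed
qed

lemma smooth_on_flat_exp: "smooth_on UNIV (flat_exp j)"
proof -
  have "Ck_on k UNIV (flat_exp j)" for k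
  proof (induction k arbitrary: j)
    case 0
    show ?case using DERIV_isCont[OF flat_exp_deriv] by (simp add: continuous_at_imp_continuous_on)
  next
    case (Suc k)
    have "Ck_on k UNIV (\<lambda>t. flat_exp (j+2) t + flat_exp (j+1) t * (- real j))"
      by (intro Ck_on_add open_UNIV Suc Ck_on_bilinear[OF _ bounded_bilinear_mult] Ck_on_const)
    then show ?case
      by (intro Ck_on_real[OF open_UNIV flat_exp_deriv]) (simp add: algebra_simps)
  qed
  then show ?thesis by (simp add: smooth_on_open_iff)
qed

lemma bump_exists:
  fixes z0 :: "'a::euclidean_space"
  assumes "r > 0"
  obtains \<beta> :: "'a \<Rightarrow> real" where "smooth_on UNIV \<beta>" "\<beta> z0 = 1" "\<And>z. z \<notin> cball z0 r \<Longrightarrow> \<beta> z = 0"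
proof
  let ?\<beta> = "\<lambda>z. flat_exp 0 (r^2 - (z - z0) \<bullet> (z - z0)) * exp (inverse (r^2))"
  have "smooth_on UNIV (\<lambda>z. r^2 - (z - z0) \<bullet> (z - z0))"
    by (intro smooth_on_diff smooth_on_inner smooth_on_const smooth_on_id)
  then show "smooth_on UNIV ?\<beta>"
    by (intro smooth_on_mult smooth_on_const smooth_on_compose[OF _ smooth_on_flat_exp]) auto
  show "?\<beta> z0 = 1" using assms by (simp add: flat_exp_def exp_minus)
  show "?\<beta> z = 0" if "z \<notin> cball z0 r" for z
  proof -
    have "r < norm (z - z0)" using that by (simp add: dist_norm norm_minus_commute)
    then have "r^2 < (norm (z - z0))^2" using assms by (simp add: power_strict_mono)
    then show ?thesis by (simp add: flat_exp_def power2_norm_eq_inner)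
  qed
qed

subsection \<open>Symmetry of the second derivative\<close>

text \<open>Two applications of the mean value theorem. The second difference is symmetric in \<open>u\<close> and \<open>v\<close>,
  so it is also a second derivative in the opposite order, taken at another nearby point; by
  continuity the two mixed derivatives agree in the limit.\<close>

lemma second_difference_mvt:
  fixes f :: "'a::euclidean_space \<Rightarrow> real"
  assumes f: "smooth_on N f" "open N" and d: "d > 0"
    and sub: "\<And>s t. 0 \<le> s \<Longrightarrow> s \<le> d \<Longrightarrow> 0 \<le> t \<Longrightarrow> t \<le> d \<Longrightarrow> x + s *\<^sub>R u + t *\<^sub>R v \<in> N"
  shows "\<exists>s t. 0 < s \<and> s < d \<and> 0 < t \<and> t < d \<and>
     f (x + d *\<^sub>R u + d *\<^sub>R v) - f (x + d *\<^sub>R u) - f (x + d *\<^sub>R v) + f x =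
     d * d * frechet_derivative (\<lambda>z. frechet_derivative f (at z) u) (at (x + s *\<^sub>R u + t *\<^sub>R v)) v"
proof -
  let ?D = "\<lambda>z. frechet_derivative f (at z) u"
  have D: "(f has_derivative frechet_derivative f (at z)) (at z)"
    "(?D has_derivative frechet_derivative ?D (at z)) (at z)" if "z \<in> N" for z
    using smooth_on_has_derivative[OF f that] smooth_on_has_derivative[OF smooth_on_frechet[OF f] f(2) that] by auto
  have du: "((\<lambda>s. f (x + s *\<^sub>R u + t *\<^sub>R v)) has_real_derivative ?D (x + s *\<^sub>R u + t *\<^sub>R v)) (at s)"
    if "0 \<le> s" "s \<le> d" "0 \<le> t" "t \<le> d" for s t
  proof -
    have "((\<lambda>s. f (x + s *\<^sub>R u + t *\<^sub>R v)) has_derivative (\<lambda>h. frechet_derivative f (at (x + s *\<^sub>R u + t *\<^sub>R v)) (h *\<^sub>R u))) (at s)"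
      by (rule has_derivative_compose[where f="\<lambda>s. x + s *\<^sub>R u + t *\<^sub>R v", OF _ D(1)[OF sub[OF that]]])
         (auto intro!: derivative_eq_intros)
    then show ?thesis
      using linear_cmul[OF has_derivative_linear[OF D(1)[OF sub[OF that]]]]
      by (simp add: has_field_derivative_def mult.commute[of _ "?D _"])
  qed
  have dv: "((\<lambda>t. ?D (x + s *\<^sub>R u + t *\<^sub>R v)) has_real_derivative frechet_derivative ?D (at (x + s *\<^sub>R u + t *\<^sub>R v)) v) (at t)"
    if "0 \<le> s" "s \<le> d" "0 \<le> t" "t \<le> d" for s t
  proof -
    have "((\<lambda>t. ?D (x + s *\<^sub>R u + t *\<^sub>R v)) has_derivative (\<lambda>h. frechet_derivative ?D (at (x + s *\<^sub>R u + t *\<^sub>R v)) (h *\<^sub>R v))) (at t)"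
      by (rule has_derivative_compose[where f="\<lambda>t. x + s *\<^sub>R u + t *\<^sub>R v", OF _ D(2)[OF sub[OF that]]])
         (auto intro!: derivative_eq_intros)
    then show ?thesis
      using linear_cmul[OF has_derivative_linear[OF D(2)[OF sub[OF that]]]]
      by (simp add: has_field_derivative_def mult.commute[of _ "frechet_derivative ?D _ _"])
  qed
  have "\<exists>s. 0 < s \<and> s < d \<and> (f (x + d *\<^sub>R u + d *\<^sub>R v) - f (x + d *\<^sub>R u + 0 *\<^sub>R v)) -
      (f (x + 0 *\<^sub>R u + d *\<^sub>R v) - f (x + 0 *\<^sub>R u + 0 *\<^sub>R v)) =
      (d - 0) * (?D (x + s *\<^sub>R u + d *\<^sub>R v) - ?D (x + s *\<^sub>R u + 0 *\<^sub>R v))"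
    by (rule MVT2[OF d, of "\<lambda>s. f (x + s *\<^sub>R u + d *\<^sub>R v) - f (x + s *\<^sub>R u + 0 *\<^sub>R v)"])
       (use d in \<open>intro DERIV_diff du; simp\<close>)
  then obtain s where s: "0 < s" "s < d" and eq1: "f (x + d *\<^sub>R u + d *\<^sub>R v) - f (x + d *\<^sub>R u) -
      (f (x + d *\<^sub>R v) - f x) = d * (?D (x + s *\<^sub>R u + d *\<^sub>R v) - ?D (x + s *\<^sub>R u))"
    by auto
  have "\<exists>t. 0 < t \<and> t < d \<and> ?D (x + s *\<^sub>R u + d *\<^sub>R v) - ?D (x + s *\<^sub>R u + 0 *\<^sub>R v) =
     (d - 0) * frechet_derivative ?D (at (x + s *\<^sub>R u + t *\<^sub>R v)) v"
    by (rule MVT2[OF d, of "\<lambda>t. ?D (x + s *\<^sub>R u + t *\<^sub>R v)"]) (use s in \<open>intro dv; simp\<close>)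
  then obtain t where t: "0 < t" "t < d" "?D (x + s *\<^sub>R u + d *\<^sub>R v) - ?D (x + s *\<^sub>R u) =
     d * frechet_derivative ?D (at (x + s *\<^sub>R u + t *\<^sub>R v)) v" by auto
  show ?thesis
    by (rule exI[of _ s], rule exI[of _ t]) (use s t eq1 in \<open>simp add: algebra_simps\<close>)
qed

lemma second_derivative_symmetric_real:
  fixes f :: "'a::euclidean_space \<Rightarrow> real"
  assumes f: "smooth_on N f" "open N" "x \<in> N"
  shows "frechet_derivative (\<lambda>z. frechet_derivative f (at z) u) (at x) v =
         frechet_derivative (\<lambda>z. frechet_derivative f (at z) v) (at x) u" (is "?P x = ?Q x")
proof (rule ccontr)
  let ?P = "\<lambda>x. frechet_derivative (\<lambda>z. frechet_derivative f (at z) u) (at x) v"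
  let ?Q = "\<lambda>x. frechet_derivative (\<lambda>z. frechet_derivative f (at z) v) (at x) u"
  assume ne: "?P x \<noteq> ?Q x"
  define \<epsilon> where "\<epsilon> = dist (?P x) (?Q x) / 2"
  have \<epsilon>: "\<epsilon> > 0" using ne by (simp add: \<epsilon>_def)
  have c: "continuous (at x) ?P" "continuous (at x) ?Q"
    using smooth_on_continuous[OF smooth_on_frechet[OF smooth_on_frechet[OF f(1,2)] f(2)]] f(2,3)
    by (simp_all add: continuous_on_eq_continuous_at)
  obtain d1 where d1: "d1 > 0" "\<And>y. dist y x < d1 \<Longrightarrow> dist (?P y) (?P x) < \<epsilon>"
    using c(1) \<epsilon> unfolding continuous_at_eps_delta by metis
  obtain d2 where d2: "d2 > 0" "\<And>y. dist y x < d2 \<Longrightarrow> dist (?Q y) (?Q x) < \<epsilon>"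
    using c(2) \<epsilon> unfolding continuous_at_eps_delta by metis
  obtain d3 where d3: "d3 > 0" "ball x d3 \<subseteq> N" using f openE by blast
  define e where "e = min d1 (min d2 d3)"
  have e: "e > 0" "e \<le> d1" "e \<le> d2" "e \<le> d3" using d1 d2 d3 by (auto simp: e_def)
  \<comment> \<open>The added \<open>1\<close> avoids a division by \<open>0\<close> and makes the estimate strict.\<close>
  define d where "d = e / (norm u + norm v + 1)"
  have nn: "norm u + norm v + 1 > 0" by (simp add: add_nonneg_pos)
  have d: "d > 0" using e nn by (simp add: d_def)
  have close: "dist (x + s *\<^sub>R a + t *\<^sub>R b) x < e"
    if "0 \<le> s" "s \<le> d" "0 \<le> t" "t \<le> d" "norm a + norm b = norm u + norm v" for s t a b
  proof -
    have "norm (s *\<^sub>R a + t *\<^sub>R b) \<le> s * norm a + t * norm b"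
      using that norm_triangle_ineq[of "s *\<^sub>R a" "t *\<^sub>R b"] by simp
    also have "\<dots> \<le> d * norm a + d * norm b" using that by (intro add_mono mult_right_mono) auto
    also have "\<dots> = d * (norm u + norm v)" using that by (metis distrib_left)
    also have "\<dots> < d * (norm u + norm v + 1)" using d by simp
    also have "\<dots> = e" using nn by (simp add: d_def)
    finally show ?thesis by (simp add: dist_norm add.assoc)
  qed
  have sub: "x + s *\<^sub>R a + t *\<^sub>R b \<in> N"
    if "0 \<le> s" "s \<le> d" "0 \<le> t" "t \<le> d" "norm a + norm b = norm u + norm v" for s t a b
    using close[OF that] d3(2) e(4) by (auto simp: subset_eq dist_commute)
  have "\<exists>s t. 0 < s \<and> s < d \<and> 0 < t \<and> t < d \<and>
     f (x + d *\<^sub>R u + d *\<^sub>R v) - f (x + d *\<^sub>R u) - f (x + d *\<^sub>R v) + f x = d * d * ?P (x + s *\<^sub>R u + t *\<^sub>R v)"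
    by (rule second_difference_mvt[OF f(1,2) d]) (rule sub; simp)
  then obtain s t where st: "0 < s" "s < d" "0 < t" "t < d" and 1:
    "f (x + d *\<^sub>R u + d *\<^sub>R v) - f (x + d *\<^sub>R u) - f (x + d *\<^sub>R v) + f x = d * d * ?P (x + s *\<^sub>R u + t *\<^sub>R v)"
    by (elim exE conjE)
  have "\<exists>s t. 0 < s \<and> s < d \<and> 0 < t \<and> t < d \<and>
     f (x + d *\<^sub>R v + d *\<^sub>R u) - f (x + d *\<^sub>R v) - f (x + d *\<^sub>R u) + f x = d * d * ?Q (x + s *\<^sub>R v + t *\<^sub>R u)"
    by (rule second_difference_mvt[OF f(1,2) d]) (rule sub; simp)
  then obtain s' t' where st': "0 < s'" "s' < d" "0 < t'" "t' < d" and 2: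
    "f (x + d *\<^sub>R v + d *\<^sub>R u) - f (x + d *\<^sub>R v) - f (x + d *\<^sub>R u) + f x = d * d * ?Q (x + s' *\<^sub>R v + t' *\<^sub>R u)"
    by (elim exE conjE)
  have eq: "x + d *\<^sub>R v + d *\<^sub>R u = x + d *\<^sub>R u + d *\<^sub>R v" by simp
  have "d * d * ?P (x + s *\<^sub>R u + t *\<^sub>R v) = d * d * ?Q (x + s' *\<^sub>R v + t' *\<^sub>R u)"
    using 1 2 unfolding eq by linarith
  then have "?P (x + s *\<^sub>R u + t *\<^sub>R v) = ?Q (x + s' *\<^sub>R v + t' *\<^sub>R u)" using d by simp
  moreover have "dist (?P (x + s *\<^sub>R u + t *\<^sub>R v)) (?P x) < \<epsilon>"
    by (rule d1(2)[OF less_le_trans[OF close e(2)]]) (use st in auto)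
  moreover have "dist (?Q (x + s' *\<^sub>R v + t' *\<^sub>R u)) (?Q x) < \<epsilon>"
    by (rule d2(2)[OF less_le_trans[OF close e(3)]]) (use st' in auto)
  ultimately have "dist (?P x) (?Q x) < \<epsilon> + \<epsilon>"
    using dist_triangle[of "?P x" "?Q x" "?P (x + s *\<^sub>R u + t *\<^sub>R v)"]
    by (simp add: dist_commute)
  then show False by (simp add: \<epsilon>_def)
qed

lemma frechet_derivative_inner:
  assumes "(f has_derivative D) (at x)"
  shows "frechet_derivative (\<lambda>z. f z \<bullet> b) (at x) = (\<lambda>v. D v \<bullet> b)"
  using frechet_derivative_at[OF has_derivative_inner_left[OF assms]] by metis

lemma second_derivative_symmetric:
  fixes f :: "'a::euclidean_space \<Rightarrow> 'b::euclidean_space"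
  assumes f: "smooth_on N f" "open N" "x \<in> N"
  shows "frechet_derivative (\<lambda>z. frechet_derivative f (at z) u) (at x) v =
         frechet_derivative (\<lambda>z. frechet_derivative f (at z) v) (at x) u"
proof (rule euclidean_eqI)
  fix b :: 'b assume "b \<in> Basis"
  have *: "frechet_derivative (\<lambda>z. frechet_derivative f (at z) a) (at x) c \<bullet> b =
     frechet_derivative (\<lambda>z. frechet_derivative (\<lambda>z. f z \<bullet> b) (at z) a) (at x) c" for a c
  proof -
    have "((\<lambda>z. frechet_derivative f (at z) a \<bullet> b) has_derivative
        (\<lambda>c. frechet_derivative (\<lambda>z. frechet_derivative f (at z) a) (at x) c \<bullet> b)) (at x)"
      by (rule has_derivative_inner_left[OF smooth_on_has_derivative[OF smooth_on_frechet[OF f(1,2)] f(2,3)]])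
    then have "((\<lambda>z. frechet_derivative (\<lambda>z. f z \<bullet> b) (at z) a) has_derivative
        (\<lambda>c. frechet_derivative (\<lambda>z. frechet_derivative f (at z) a) (at x) c \<bullet> b)) (at x)"
      by (rule has_derivative_transform_within_open[OF _ f(2,3)])
         (simp add: frechet_derivative_inner[OF smooth_on_has_derivative[OF f(1,2)]])
    from frechet_derivative_at[OF this] show ?thesis by metis
  qed
  show "frechet_derivative (\<lambda>z. frechet_derivative f (at z) u) (at x) v \<bullet> b =
         frechet_derivative (\<lambda>z. frechet_derivative f (at z) v) (at x) u \<bullet> b"
    unfolding * by (rule second_derivative_symmetric_real[OF smooth_on_inner[OF f(1) smooth_on_const] f(2,3)])
qed

subsection \<open>Uniqueness of derivatives within a set\<close>

text \<open>A derivative within a set need not be unique. It is unique precisely if the zero function has no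
  other derivative than \<open>0\<close>, and real functions suffice, as one can pass to components. In this
  form uniqueness is easily transported by differentiable maps.\<close>

definition unique_deriv :: "'a::real_normed_vector set \<Rightarrow> 'a \<Rightarrow> bool" where
  "unique_deriv S x \<longleftrightarrow> (\<forall>L::'a \<Rightarrow> real. ((\<lambda>_. 0) has_derivative L) (at x within S) \<longrightarrow> L = (\<lambda>_. 0))"

lemma unique_derivD:
  fixes f :: "'a::real_normed_vector \<Rightarrow> 'b::real_inner"
  assumes "unique_deriv S x" "(f has_derivative D) (at x within S)" "(f has_derivative E) (at x within S)"
  shows "D = E"
proof
  fix v
  have "((\<lambda>x. f x \<bullet> (D v - E v) - f x \<bullet> (D v - E v)) has_derivative (\<lambda>u. D u \<bullet> (D v - E v) - E u \<bullet> (D v - E v))) (at x within S)"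
    by (intro has_derivative_diff has_derivative_inner_left assms)
  then have "(\<lambda>u. D u \<bullet> (D v - E v) - E u \<bullet> (D v - E v)) = (\<lambda>_. 0)"
    using assms(1) by (simp add: unique_deriv_def)
  from fun_cong[OF this, of v] have "(D v - E v) \<bullet> (D v - E v) = 0" by (simp add: inner_diff_left)
  then show "D v = E v" by simp
qed

lemma unique_deriv_frechet:
  fixes f :: "'a::real_normed_vector \<Rightarrow> 'b::real_inner"
  assumes "unique_deriv S x" "(f has_derivative D) (at x within S)"
  shows "frechet_derivative f (at x within S) = D"
  unfolding frechet_derivative_def
  by (rule some_equality) (use assms unique_derivD in blast)+

text \<open>A derivative of \<open>0\<close> within the image, composed with \<open>F\<close>, is a derivative of \<open>0\<close> within the source.\<close>

lemma unique_deriv_image: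
  assumes "unique_deriv S x" "(F has_derivative F') (at x within S)" "F ` S \<subseteq> T" "surj F'"
  shows "unique_deriv T (F x)"
  unfolding unique_deriv_def
proof (intro allI impI)
  fix L :: "'b \<Rightarrow> real" assume L: "((\<lambda>_. 0) has_derivative L) (at (F x) within T)"
  have "((\<lambda>_. 0::real) has_derivative (\<lambda>v. L (F' v))) (at x within S)"
    using has_derivative_in_compose[OF assms(2) has_derivative_subset[OF L assms(3)]] .
  then have "(\<lambda>v. L (F' v)) = (\<lambda>_. 0)" using assms(1) by (simp add: unique_deriv_def)
  then show "L = (\<lambda>_. 0)" using assms(4) by (metis surjD)
qed

lemma at_within_Int_open: "open N \<Longrightarrow> x \<in> N \<Longrightarrow> at x within (S \<inter> N) = at x within S"
  by (rule at_within_nhd[of x N]) auto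

lemma unique_deriv_Int_open:
  "open N \<Longrightarrow> x \<in> N \<Longrightarrow> unique_deriv (S \<inter> N) x \<longleftrightarrow> unique_deriv S x"
  by (simp add: unique_deriv_def at_within_Int_open)

lemma unique_deriv_open: "open S \<Longrightarrow> x \<in> S \<Longrightarrow> unique_deriv S x"
  unfolding unique_deriv_def using has_derivative_unique[OF _ has_derivative_const]
  by (metis at_within_open)

text \<open>The local models of manifolds in which derivatives within relatively open sets are unique: the
  whole space and the orthant of corners.\<close>

definition full_model :: "'e::euclidean_space set \<Rightarrow> bool" where
  "full_model H \<longleftrightarrow> (\<forall>x\<in>H. unique_deriv H x)"

lemma full_model_UNIV [simp]: "full_model UNIV"
  by (simp add: full_model_def unique_deriv_open)

lemma full_model_openin:
  "full_model H \<Longrightarrow> openin (top_of_set H) S \<Longrightarrow> x \<in> S \<Longrightarrow> unique_deriv S x"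
  unfolding full_model_def openin_open using unique_deriv_Int_open by blast

lemma full_model_orthant: "full_model {x :: real^'m. \<forall>i. 0 \<le> x $ i}"
  unfolding full_model_def unique_deriv_def
proof (intro ballI allI impI)
  fix x :: "real^'m" and L :: "real^'m \<Rightarrow> real"
  assume x: "x \<in> {x. \<forall>i. 0 \<le> x $ i}" and L: "((\<lambda>_. 0) has_derivative L) (at x within {x. \<forall>i. 0 \<le> x $ i})"
  show "L = (\<lambda>_. 0)"
  proof (rule frechet_derivative_unique_within[OF L has_derivative_const])
    fix i :: "real^'m" and e :: real assume i: "i \<in> Basis" and e: "e > 0"
    then show "\<exists>d. 0 < \<bar>d\<bar> \<and> \<bar>d\<bar> < e \<and> x + d *\<^sub>R i \<in> {x. \<forall>i. 0 \<le> x $ i}"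
      using x by (intro exI[of _ "e/2"]) (auto simp: Basis_vec_def axis_def)
  qed
qed

subsection \<open>Inverse functions\<close>

lemma smooth_on_cramer:
  "smooth_on {M :: real^'m^'m. det M \<noteq> 0} (\<lambda>M. (\<chi> k. det (\<chi> i j. if j = k then b $ i else M $ i $ j) / det M))"
proof (rule smooth_on_vec_lambda)
  fix k :: 'm
  have "smooth_on {M :: real^'m^'m. det M \<noteq> 0} (\<lambda>M. if j = k then b $ i else M $ i $ j)" for i j
    by (cases "j = k") (auto intro!: smooth_on_nth)
  then show "smooth_on {M :: real^'m^'m. det M \<noteq> 0} (\<lambda>M. det (\<chi> i j. if j = k then b $ i else M $ i $ j) / det M)"
    by (intro smooth_on_divide[OF smooth_on_det smooth_on_det])
       (simp_all add: smooth_on_nth[OF smooth_on_nth[OF smooth_on_id]])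
qed

lemma open_det_nonzero: "open {M :: real^'m^'m. det M \<noteq> 0}"
proof -
  have "continuous_on UNIV (det :: real^'m^'m \<Rightarrow> real)"
    by (rule smooth_on_continuous[OF smooth_on_det]) (rule smooth_on_nth[OF smooth_on_nth[OF smooth_on_id]])
  then show ?thesis by (rule open_Collect_neq[OF _ continuous_on_const])
qed

lemma Ck_on_matrix:
  fixes f :: "'a::euclidean_space \<Rightarrow> real^'n^'m"
  assumes "open S" "\<And>i j. Ck_on k S (\<lambda>x. f x $ i $ j)"
  shows "Ck_on k S f"
proof -
  have "Ck_on k S (\<lambda>x. f x \<bullet> b)" if "b \<in> Basis" for b
    using that assms(2) by (auto simp: Basis_vec_def inner_axis)
  then have "Ck_on k S (\<lambda>x. \<Sum>b\<in>Basis. (f x \<bullet> b) *\<^sub>R b)"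
    by (intro Ck_on_sum[OF assms(1)] Ck_on_bilinear[OF assms(1) bounded_bilinear_scaleR] Ck_on_const[OF assms(1)])
  then show ?thesis by (simp add: euclidean_representation)
qed

text \<open>The inverse of a smooth map with invertible derivatives is smooth, since its derivative is
  given by Cramer's rule in terms of the derivative of the map and the inverse itself.\<close>

lemma smooth_inverse:
  fixes F :: "real^'m \<Rightarrow> real^'m"
  assumes F: "smooth_on U F" "open U" and V: "open V" "G ` V \<subseteq> U"
    and G: "\<And>y. y \<in> V \<Longrightarrow> (G has_derivative inv_into UNIV (frechet_derivative F (at (G y)))) (at y)"
    and bij: "\<And>y. y \<in> V \<Longrightarrow> bij (frechet_derivative F (at (G y)))"
  shows "smooth_on V G"
proof -
  define M where "M y = matrix (frechet_derivative F (at (G y)))" for y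
  have lin: "linear (frechet_derivative F (at (G y)))" if "y \<in> V" for y
    using has_derivative_linear[OF smooth_on_has_derivative[OF F]] V(2) that by blast
  have Mv: "M y *v u = frechet_derivative F (at (G y)) u" if "y \<in> V" for y u
    using fun_cong[OF matrix_vector_mul(2)[OF lin[OF that]], of u] by (simp add: M_def)
  have det: "det (M y) \<noteq> 0" if "y \<in> V" for y
    using det_nz_iff_inj[OF lin[OF that]] bij[OF that] by (simp add: M_def bij_is_inj)
  have inv_eq: "inv_into UNIV (frechet_derivative F (at (G y))) b = (\<chi> k. det (\<chi> i j. if j = k then b $ i else M y $ i $ j) / det (M y))"
    if "y \<in> V" for y b
  proof -
    have "M y *v inv_into UNIV (frechet_derivative F (at (G y))) b = b"
      using Mv[OF that] bij[OF that] by (simp add: bij_is_surj surj_f_inv_f)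
    then show ?thesis using cramer[OF det[OF that]] by blast
  qed
  have "Ck_on k V G" for k
  proof (induction k)
    case 0
    show ?case using G by (auto intro!: continuous_at_imp_continuous_on has_derivative_continuous)
  next
    case (Suc k)
    have "Ck_on k V (\<lambda>y. frechet_derivative F (at (G y)) (axis j 1) $ i)" for i j
      by (rule Ck_on_compose[OF V(1) F(2) Suc smooth_on_Ck[OF F(2) smooth_on_nth[OF smooth_on_frechet[OF F]]] V(2)])
    then have M: "Ck_on k V M"
      by (intro Ck_on_matrix[OF V(1)]) (simp add: M_def matrix_def)
    have "Ck_on k V (\<lambda>y. inv_into UNIV (frechet_derivative F (at (G y))) b)" for b
    proof (rule Ck_on_cong[OF V(1)])
      show "Ck_on k V (\<lambda>y. (\<chi> i. det (\<chi> i' j. if j = i then b $ i' else M y $ i' $ j) / det (M y)))"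
        by (rule Ck_on_compose[OF V(1) open_det_nonzero M smooth_on_Ck[OF open_det_nonzero smooth_on_cramer]])
           (use det in auto)
    qed (simp add: inv_eq)
    then show ?case using Ck_on_SucI[OF V(1) G] by blast
  qed
  then show ?thesis by (simp add: smooth_on_open_iff[OF V(1)])
qed

lemma smooth_local_inverse:
  fixes F :: "real^'m \<Rightarrow> real^'m"
  assumes F: "smooth_on N F" "open N" "x \<in> N" and inj: "inj (frechet_derivative F (at x))"
  obtains U V G where "open U" "x \<in> U" "U \<subseteq> N" "open V" "F ` U = V" "smooth_on V G"
    "\<And>z. z \<in> U \<Longrightarrow> G (F z) = z"
proof -
  let ?D = "\<lambda>x. frechet_derivative F (at x)"
  have D: "(F has_derivative ?D z) (at z)" if "z \<in> N" for z
    using smooth_on_has_derivative[OF F(1,2) that] .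
  have bl: "bounded_linear (?D z)" if "z \<in> N" for z using has_derivative_bounded_linear[OF D[OF that]] .
  define F' where "F' z = Blinfun (?D z)" for z
  have F': "blinfun_apply (F' z) = ?D z" if "z \<in> N" for z
    using bl[OF that] by (simp add: F'_def bounded_linear_Blinfun_apply)
  have cont: "continuous_on N F'"
  proof (rule continuous_on_blinfun_componentwise)
    fix i :: "real^'m" assume "i \<in> Basis"
    have "continuous_on N (\<lambda>z. ?D z i)" by (rule smooth_on_continuous[OF smooth_on_frechet[OF F(1,2)]])
    then show "continuous_on N (\<lambda>z. blinfun_apply (F' z) i)" by (rule continuous_on_eq) (simp add: F')
  qed
  obtain L where L: "linear L" "L \<circ> ?D x = id"
    using linear_injective_left_inverse[OF bounded_linear.linear[OF bl[OF F(3)]] inj] by blast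
  have "Blinfun L o\<^sub>L F' x = id_blinfun"
    by (rule blinfun_eqI)
       (use L(2) in \<open>simp add: F' F(3) bounded_linear_Blinfun_apply linear_linear[THEN iffD1] linear_conv_bounded_linear[symmetric] L(1) fun_eq_iff\<close>)
  then obtain U V G G' where UV: "open U" "U \<subseteq> N" "x \<in> U" "open V" "homeomorphism U V F G"
      and G: "\<And>y. y \<in> V \<Longrightarrow> (G has_derivative (G' y)) (at y)" "\<And>y. y \<in> V \<Longrightarrow> G' y = inv_into UNIV (blinfun_apply (F' (G y)))"
        "\<And>y. y \<in> V \<Longrightarrow> bij (blinfun_apply (F' (G y)))"
    using inverse_function_theorem[OF F(2) _ cont F(3)] D F' by (metis (no_types, lifting))
  have GV: "G ` V \<subseteq> U" using UV(5) by (simp add: homeomorphism_def)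
  have "smooth_on V G"
    by (rule smooth_inverse[OF smooth_on_subset[OF F(1) UV(2)] UV(1) UV(4) GV])
       (use G F' GV UV(2) in \<open>force\<close>)+
  then show thesis
    using UV by (intro that[of U V G]) (auto simp: homeomorphism_def)
qed

section \<open>Charts and tangent maps\<close>

text \<open>The manifold axioms on which the calculus of tangent vectors rests. Maximality is left out, since
  the atlas of the jet bundle consists of the charts induced by adapted charts only.\<close>

definition smooth_atlas :: "'e::euclidean_space set \<Rightarrow> ('a, 'e) chart set \<Rightarrow> bool" where
  "smooth_atlas H A \<longleftrightarrow> full_model H \<and> (\<forall>c\<in>A. model_chart H c) \<and> (\<forall>c\<in>A. \<forall>c'\<in>A. smooth_transition H c c')"

lemma smooth_manifold_on_atlas: "smooth_manifold_on H A \<Longrightarrow> full_model H \<Longrightarrow> smooth_atlas H A"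
  unfolding smooth_atlas_def smooth_manifold_on_def by (elim conjE) (intro conjI)

lemma atlas_inj: "smooth_atlas H A \<Longrightarrow> c \<in> A \<Longrightarrow> inj_on (cmap c) (cdom c)"
  by (simp add: smooth_atlas_def model_chart_def)

lemma atlas_openin: "smooth_atlas H A \<Longrightarrow> c \<in> A \<Longrightarrow> openin (top_of_set H) (cmap c ` cdom c)"
  by (simp add: smooth_atlas_def model_chart_def)

lemma atlas_open: "smooth_atlas UNIV A \<Longrightarrow> c \<in> A \<Longrightarrow> open (cmap c ` cdom c)"
  using atlas_openin by fastforce

lemma atlas_overlap_openin:
  "smooth_atlas H A \<Longrightarrow> c \<in> A \<Longrightarrow> c' \<in> A \<Longrightarrow> openin (top_of_set H) (cmap c ` (cdom c \<inter> cdom c'))"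
  by (simp add: smooth_atlas_def smooth_transition_def)

lemma atlas_overlap_open:
  "smooth_atlas UNIV A \<Longrightarrow> c \<in> A \<Longrightarrow> c' \<in> A \<Longrightarrow> open (cmap c ` (cdom c \<inter> cdom c'))"
  using atlas_overlap_openin by fastforce

lemma atlas_transition_smooth:
  "smooth_atlas H A \<Longrightarrow> c \<in> A \<Longrightarrow> c' \<in> A \<Longrightarrow> smooth_on (cmap c ` (cdom c \<inter> cdom c')) (cmap c' \<circ> cinv c)"
  by (simp add: smooth_atlas_def smooth_transition_def)

lemma cinv_cmap: "inj_on (cmap c) (cdom c) \<Longrightarrow> p \<in> cdom c \<Longrightarrow> cinv c (cmap c p) = p"
  by (simp add: cinv_def)

lemma cmap_cinv: "x \<in> cmap c ` cdom c \<Longrightarrow> cmap c (cinv c x) = x"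
  by (simp add: cinv_def f_inv_into_f)

lemma cinv_in: "x \<in> cmap c ` cdom c \<Longrightarrow> cinv c x \<in> cdom c"
  by (simp add: cinv_def inv_into_into)

lemma atlas_unique:
  "smooth_atlas H A \<Longrightarrow> openin (top_of_set H) S \<Longrightarrow> x \<in> S \<Longrightarrow> unique_deriv S x"
  unfolding smooth_atlas_def using full_model_openin by blast

lemma transition_has_derivative:
  assumes "smooth_atlas H A" "c \<in> A" "c' \<in> A" "p \<in> cdom c" "p \<in> cdom c'"
  shows "(cmap c' \<circ> cinv c has_derivative transition_deriv c c' p)
    (at (cmap c p) within cmap c ` (cdom c \<inter> cdom c'))"
  unfolding transition_deriv_def
  by (rule frechet_derivative_works[THEN iffD1, OF smooth_on_within_derivative[OF atlas_transition_smooth[OF assms(1-3)]]])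
     (use assms in auto)

lemma transition_has_derivative_at:
  assumes "smooth_atlas UNIV A" "c \<in> A" "c' \<in> A" "p \<in> cdom c" "p \<in> cdom c'"
  shows "(cmap c' \<circ> cinv c has_derivative transition_deriv c c' p) (at (cmap c p))"
  using transition_has_derivative[OF assms] at_within_open[OF _ atlas_overlap_open[OF assms(1-3)], of "cmap c p"] assms(4,5)
  by simp

lemma transition_deriv_linear:
  assumes "smooth_atlas H A" "c \<in> A" "c' \<in> A" "p \<in> cdom c" "p \<in> cdom c'"
  shows "linear (transition_deriv c c' p)"
  using has_derivative_linear[OF transition_has_derivative[OF assms]] .

lemma transition_deriv_self:
  assumes "smooth_atlas H A" "c \<in> A" "p \<in> cdom c"
  shows "transition_deriv c c p u = u"
proof -
  have "((\<lambda>x. x) has_derivative transition_deriv c c p) (at (cmap c p) within cmap c ` (cdom c \<inter> cdom c))"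
    by (rule has_derivative_transform[OF _ _ transition_has_derivative[OF assms(1,2,2,3,3)]])
       (use assms(3) in \<open>auto simp: cinv_cmap[OF atlas_inj[OF assms(1,2)]]\<close>)
  moreover have "unique_deriv (cmap c ` (cdom c \<inter> cdom c)) (cmap c p)"
    by (rule atlas_unique[OF assms(1) atlas_overlap_openin[OF assms(1,2,2)]]) (use assms(3) in auto)
  ultimately have "transition_deriv c c p = (\<lambda>x. x)"
    using unique_derivD[OF _ _ has_derivative_ident] by blast
  then show ?thesis by simp
qed

text \<open>The chain rule on the triple overlap. This set is relatively open in the model, so the
  derivatives within it are the ones within the larger pairwise overlaps.\<close>

lemma transition_deriv_cocycle:
  assumes A: "smooth_atlas H A" "c \<in> A" "c' \<in> A" "c'' \<in> A" and p: "p \<in> cdom c" "p \<in> cdom c'" "p \<in> cdom c''"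
  shows "transition_deriv c' c'' p (transition_deriv c c' p u) = transition_deriv c c'' p u"
proof -
  let ?O = "cmap c ` (cdom c \<inter> cdom c' \<inter> cdom c'')"
  have inj: "inj_on (cmap c) (cdom c)" "inj_on (cmap c') (cdom c')" using atlas_inj A by blast+
  have eq: "?O = cmap c ` (cdom c \<inter> cdom c') \<inter> cmap c ` (cdom c \<inter> cdom c'')"
    using inj(1) by (auto simp: inj_on_def)
  have u: "unique_deriv ?O (cmap c p)"
    by (rule atlas_unique[OF A(1)]) (use p in \<open>auto simp: eq intro!: openin_Int atlas_overlap_openin[OF A(1)] A\<close>)
  have d1: "(cmap c'' \<circ> cinv c has_derivative transition_deriv c c'' p) (at (cmap c p) within ?O)"
    by (rule has_derivative_subset[OF transition_has_derivative[OF A(1,2,4) p(1,3)]]) auto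
  have d2: "(cmap c' \<circ> cinv c has_derivative transition_deriv c c' p) (at (cmap c p) within ?O)"
    by (rule has_derivative_subset[OF transition_has_derivative[OF A(1,2,3) p(1,2)]]) auto
  have "(cmap c'' \<circ> cinv c' has_derivative transition_deriv c' c'' p) (at ((cmap c' \<circ> cinv c) (cmap c p)) within (cmap c' \<circ> cinv c) ` ?O)"
    using has_derivative_subset[OF transition_has_derivative[OF A(1,3,4) p(2,3)], of "(cmap c' \<circ> cinv c) ` ?O"] p(1)
    by (force simp: cinv_cmap[OF inj(1)])
  from has_derivative_in_compose[OF d2 this]
  have "(cmap c'' \<circ> cinv c has_derivative (\<lambda>u. transition_deriv c' c'' p (transition_deriv c c' p u))) (at (cmap c p) within ?O)"
    by (rule has_derivative_transform[rotated 2])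
       (use p in \<open>auto simp: cinv_cmap[OF inj(1)] cinv_cmap[OF inj(2)]\<close>)
  from fun_cong[OF unique_derivD[OF u d1 this]] show ?thesis by simp
qed

lemma tvec_of_in_tspace:
  assumes "smooth_atlas H A" "c \<in> A" "p \<in> cdom c"
  shows "tvec_of A p c u \<in> tspace A p"
  using assms by (auto simp: tspace_def tvec_of_def transition_deriv_cocycle)

lemma tvec_of_self:
  assumes "smooth_atlas H A" "c \<in> A" "p \<in> cdom c"
  shows "tvec_of A p c u c = u"
  using assms by (simp add: tvec_of_def transition_deriv_self)

lemma tspace_component:
  assumes "v \<in> tspace A p" "c \<in> A" "c' \<in> A" "p \<in> cdom c" "p \<in> cdom c'"
  shows "v c' = transition_deriv c c' p (v c)"
  using assms unfolding tspace_def by blast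

lemma tspace_tvec_of:
  assumes "v \<in> tspace A p" "c \<in> A" "p \<in> cdom c"
  shows "v = tvec_of A p c (v c)"
proof
  fix c'
  show "v c' = tvec_of A p c (v c) c'"
  proof (cases "c' \<in> A \<and> p \<in> cdom c'")
    case True
    then show ?thesis using tspace_component[OF assms(1,2) _ assms(3), of c'] by (simp add: tvec_of_def)
  next
    case False
    then have "v c' = 0" using assms(1) unfolding tspace_def by blast
    then show ?thesis using False unfolding tvec_of_def by (simp only: if_False)
  qed
qed

lemma tvec_of_change:
  assumes "smooth_atlas H A" "c \<in> A" "c' \<in> A" "p \<in> cdom c" "p \<in> cdom c'"
  shows "tvec_of A p c' (transition_deriv c c' p u) = tvec_of A p c u"
  using assms by (auto simp: tvec_of_def fun_eq_iff transition_deriv_cocycle)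

lemma tvec_of_lincomb:
  assumes "smooth_atlas H A" "c \<in> A" "p \<in> cdom c"
  shows "tvec_of A p c (a *\<^sub>R u + b *\<^sub>R v) = lincomb a (tvec_of A p c u) b (tvec_of A p c v)"
proof
  fix c'
  have "linear (transition_deriv c c' p)" if "c' \<in> A" "p \<in> cdom c'"
    using transition_deriv_linear[OF assms(1,2) that(1) assms(3) that(2)] .
  then show "tvec_of A p c (a *\<^sub>R u + b *\<^sub>R v) c' = lincomb a (tvec_of A p c u) b (tvec_of A p c v) c'"
    by (auto simp: tvec_of_def lincomb_def linear_add linear_cmul)
qed

lemma lincomb_in_tspace:
  assumes "smooth_atlas H A" "v \<in> tspace A p" "w \<in> tspace A p"
  shows "lincomb a v b w \<in> tspace A p"
  unfolding tspace_def lincomb_def mem_Collect_eq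
proof (intro conjI ballI impI allI)
  fix c c' assume c: "c \<in> A" "c' \<in> A" "p \<in> cdom c \<inter> cdom c'"
  then have "linear (transition_deriv c c' p)" using transition_deriv_linear[OF assms(1)] by blast
  then show "a *\<^sub>R v c' + b *\<^sub>R w c' = transition_deriv c c' p (a *\<^sub>R v c + b *\<^sub>R w c)"
    using tspace_component[OF assms(2) c(1,2)] tspace_component[OF assms(3) c(1,2)] c(3)
    by (simp add: linear_add linear_cmul)
qed (use assms in \<open>auto simp: tspace_def\<close>)

lemma chart_at:
  assumes "p \<in> mcarrier A" shows "chart_at A p \<in> A" "p \<in> cdom (chart_at A p)"
proof -
  have "\<exists>c. c \<in> A \<and> p \<in> cdom c" using assms by (auto simp: mcarrier_def)
  from someI_ex[OF this] show "chart_at A p \<in> A" "p \<in> cdom (chart_at A p)" by (simp_all add: chart_at_def)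
qed

text \<open>Domains such as \<open>U\<^sub>X\<close>, which need not be open, but have enough points in all directions for
  derivatives within them to be meaningful.\<close>

definition unique_deriv_set :: "('a, 'e::euclidean_space) chart set \<Rightarrow> 'a set \<Rightarrow> bool" where
  "unique_deriv_set A S \<longleftrightarrow> (\<forall>p\<in>S. \<forall>c\<in>A. p \<in> cdom c \<longrightarrow> unique_deriv (cmap c ` (S \<inter> cdom c)) (cmap c p))"

text \<open>The coordinate expression \<open>h\<close> of \<open>f\<close> extends beyond the image of \<open>S\<close> to an open set. At
  boundary points of \<open>S\<close> all derivatives can therefore be computed as ordinary derivatives of \<open>h\<close>.\<close>

definition local_rep :: "'a set \<Rightarrow> ('a \<Rightarrow> 'b) \<Rightarrow> ('a, 'e::euclidean_space) chart \<Rightarrow> ('b, 'f::euclidean_space) chart \<Rightarrow>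
   'e set \<Rightarrow> ('e \<Rightarrow> 'f) \<Rightarrow> bool" where
  "local_rep S f c c' N h \<longleftrightarrow> open N \<and> smooth_on N h \<and>
     (\<forall>q\<in>S \<inter> cdom c. cmap c q \<in> N \<longrightarrow> f q \<in> cdom c' \<and> h (cmap c q) = cmap c' (f q))"

definition extendable_map ::
  "('a, 'e::euclidean_space) chart set \<Rightarrow> ('b, 'f::euclidean_space) chart set \<Rightarrow> 'a set \<Rightarrow> ('a \<Rightarrow> 'b) \<Rightarrow> bool" where
  "extendable_map A B S f \<longleftrightarrow> (\<forall>p\<in>S. \<forall>c\<in>A. \<forall>c'\<in>B. p \<in> cdom c \<and> f p \<in> cdom c' \<longrightarrow>
     (\<exists>N h. cmap c p \<in> N \<and> local_rep S f c c' N h))"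

lemma extendable_mapE:
  assumes "extendable_map A B S f" "p \<in> S" "c \<in> A" "c' \<in> B" "p \<in> cdom c" "f p \<in> cdom c'"
  obtains N h where "cmap c p \<in> N" "local_rep S f c c' N h"
proof -
  have "\<exists>N h. cmap c p \<in> N \<and> local_rep S f c c' N h"
    using assms unfolding extendable_map_def by simp
  then show thesis using that by (elim exE conjE)
qed

text \<open>The tangent map is defined by charts that are chosen arbitrarily. Changing to the given charts
  inserts transition derivatives on both sides, and these are absorbed by the transformation
  behaviour of tangent vectors.\<close>

lemma tmap_local_rep:
  assumes A: "smooth_atlas UNIV A" "c \<in> A" and B: "smooth_atlas UNIV B" "c' \<in> B"
    and p: "p \<in> S" "p \<in> cdom c" and ud: "unique_deriv (cmap c ` (S \<inter> cdom c)) (cmap c p)"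
    and N: "cmap c p \<in> N" "local_rep S f c c' N h" and v: "v \<in> tspace A p"
  shows "tmap A B S f p v = tvec_of B (f p) c' (frechet_derivative h (at (cmap c p)) (v c))"
proof -
  have N': "open N" "smooth_on N h"
    "\<And>q. q \<in> S \<Longrightarrow> q \<in> cdom c \<Longrightarrow> cmap c q \<in> N \<Longrightarrow> f q \<in> cdom c' \<and> h (cmap c q) = cmap c' (f q)"
    using N(2) by (auto simp: local_rep_def)
  have fp: "f p \<in> cdom c'" "h (cmap c p) = cmap c' (f p)" using N'(3)[OF p N(1)] by auto
  define c1 where "c1 = chart_at A p"
  define c1' where "c1' = chart_at B (f p)"
  have "p \<in> mcarrier A" "f p \<in> mcarrier B" using A(2) p(2) B(2) fp(1) by (auto simp: mcarrier_def)
  then have c1: "c1 \<in> A" "p \<in> cdom c1" and c1': "c1' \<in> B" "f p \<in> cdom c1'"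
    using chart_at[of p A] chart_at[of "f p" B] by (auto simp: c1_def c1'_def)
  note inj = atlas_inj[OF A] atlas_inj[OF A(1) c1(1)] atlas_inj[OF B]
  let ?O = "cmap c1 ` (cdom c1 \<inter> cdom c)"
  let ?T = "cmap c1 ` (S \<inter> cdom c1)"
  define M where "M = ?O \<inter> (cmap c \<circ> cinv c1) -` N"
  have M: "open M"
    unfolding M_def
    by (rule continuous_open_preimage[OF smooth_on_continuous[OF atlas_transition_smooth[OF A(1) c1(1) A(2)]]
        atlas_overlap_open[OF A(1) c1(1) A(2)] N'(1)])
  have pM: "cmap c1 p \<in> M" using c1(2) p(2) N(1) by (auto simp: M_def cinv_cmap[OF inj(2)])
  have u: "unique_deriv ?T (cmap c1 p)"
  proof -
    let ?T' = "cmap c ` (S \<inter> cdom c) \<inter> cmap c ` (cdom c \<inter> cdom c1)"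
    have 1: "unique_deriv ?T' (cmap c p)"
      using ud c1(2) p(2) by (subst unique_deriv_Int_open[OF atlas_overlap_open[OF A c1(1)]]) auto
    have "surj (transition_deriv c c1 p)"
      using transition_deriv_cocycle[OF A(1) c1(1) A(2) c1(1) c1(2) p(2) c1(2)]
        transition_deriv_self[OF A(1) c1] by (metis surjI)
    moreover have "(cmap c1 \<circ> cinv c) ` ?T' \<subseteq> ?T"
    proof (rule image_subsetI)
      fix x assume "x \<in> ?T'"
      then obtain q r where q: "q \<in> S" "q \<in> cdom c" "x = cmap c q" and r: "r \<in> cdom c" "r \<in> cdom c1" "x = cmap c r" by blast
      have "q = r" using q r inj(1) by (metis inj_onD)
      then show "(cmap c1 \<circ> cinv c) x \<in> ?T" using q r by (auto simp: cinv_cmap[OF inj(1)])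
    qed
    moreover have "(cmap c1 \<circ> cinv c) (cmap c p) = cmap c1 p" using p by (simp add: cinv_cmap[OF inj(1)])
    ultimately show ?thesis
      using unique_deriv_image[OF 1 has_derivative_at_withinI[OF transition_has_derivative_at[OF A c1(1) p(2) c1(2)]], of ?T]
      by simp
  qed
  let ?D = "\<lambda>u. transition_deriv c' c1' (f p) (frechet_derivative h (at (cmap c p)) (transition_deriv c1 c p u))"
  have e: "(cmap c \<circ> cinv c1) (cmap c1 p) = cmap c p" using c1 by (simp add: cinv_cmap[OF inj(2)])
  have h1: "(h has_derivative frechet_derivative h (at (cmap c p))) (at ((cmap c \<circ> cinv c1) (cmap c1 p)))"
    unfolding e by (rule smooth_on_has_derivative[OF N'(2,1) N(1)])
  have h2: "(cmap c1' \<circ> cinv c' has_derivative transition_deriv c' c1' (f p)) (at (h ((cmap c \<circ> cinv c1) (cmap c1 p))))"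
    unfolding e fp(2) by (rule transition_has_derivative_at[OF B c1'(1) fp(1) c1'(2)])
  have "((\<lambda>x. (cmap c1' \<circ> cinv c') (h ((cmap c \<circ> cinv c1) x))) has_derivative ?D) (at (cmap c1 p))"
    using has_derivative_compose[OF has_derivative_compose[OF transition_has_derivative_at[OF A(1) c1(1) A(2) c1(2) p(2)] h1] h2] .
  then have "((\<lambda>x. (cmap c1' \<circ> cinv c') (h ((cmap c \<circ> cinv c1) x))) has_derivative ?D) (at (cmap c1 p) within (?T \<inter> M))"
    by (rule has_derivative_at_withinI)
  then have "(cmap c1' \<circ> f \<circ> cinv c1 has_derivative ?D) (at (cmap c1 p) within (?T \<inter> M))"
  proof (rule has_derivative_transform[rotated 2])
    show "cmap c1 p \<in> ?T \<inter> M" using p(1) c1(2) pM by blast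
    fix x assume x: "x \<in> ?T \<inter> M"
    then obtain q r where q: "q \<in> S" "q \<in> cdom c1" "x = cmap c1 q" and r: "r \<in> cdom c" "r \<in> cdom c1" "x = cmap c1 r"
      by (auto simp: M_def)
    have qr: "q = r" using q r inj(2) by (metis inj_onD)
    have "cmap c q \<in> N" using x q by (simp add: M_def cinv_cmap[OF inj(2)])
    from N'(3)[OF q(1) _ this] show "(cmap c1' \<circ> f \<circ> cinv c1) x = (cmap c1' \<circ> cinv c') (h ((cmap c \<circ> cinv c1) x))"
      using q r qr by (simp add: cinv_cmap[OF inj(2)] cinv_cmap[OF inj(3)])
  qed
  then have "frechet_derivative (cmap c1' \<circ> f \<circ> cinv c1) (at (cmap c1 p) within ?T) = ?D"
    by (intro unique_deriv_frechet[OF u]) (simp add: at_within_Int_open[OF M pM])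
  then have "tmap A B S f p v = tvec_of B (f p) c1' (?D (v c1))"
    by (simp add: tmap_def Let_def c1_def[symmetric] c1'_def[symmetric])
  also have "\<dots> = tvec_of B (f p) c' (frechet_derivative h (at (cmap c p)) (v c))"
    using tvec_of_change[OF B c1'(1) fp(1) c1'(2)] tspace_component[OF v c1(1) A(2) c1(2) p(2)] by simp
  finally show ?thesis .
qed

section \<open>The exterior derivative commutes with pullback\<close>

definition multilinear_list :: "nat \<Rightarrow> ('f::real_vector list \<Rightarrow> real) \<Rightarrow> bool" where
  "multilinear_list k w \<longleftrightarrow> (\<forall>us. length us = k \<longrightarrow> (\<forall>i<k. \<forall>u v a b.
     w (us[i := a *\<^sub>R u + b *\<^sub>R v]) = a * w (us[i := u]) + b * w (us[i := v])))"

lemma multilinear_list_ConsD: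
  assumes "multilinear_list (Suc k) w"
  shows "multilinear_list k (\<lambda>us. w (b # us))"
  unfolding multilinear_list_def
proof (intro allI impI)
  fix us :: "'a list" and i u v s t assume "length us = k" "i < k"
  then show "w (b # us[i := s *\<^sub>R u + t *\<^sub>R v]) = s * w (b # us[i := u]) + t * w (b # us[i := v])"
    using assms[unfolded multilinear_list_def, rule_format, of "b # us" "Suc i" s u t v] by simp
qed

lemma multilinear_list_head:
  fixes w :: "'f::euclidean_space list \<Rightarrow> real"
  assumes "multilinear_list (Suc k) w" "length us = k"
  shows "w (u # us) = (\<Sum>b\<in>Basis. (u \<bullet> b) * w (b # us))"
proof -
  have *: "w ((s *\<^sub>R u + t *\<^sub>R v) # us) = s * w (u # us) + t * w (v # us)" for s t u v
    using assms(1)[unfolded multilinear_list_def, rule_format, of "0 # us" 0 s u t v] assms(2) by simp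
  have "linear (\<lambda>u. w (u # us))"
  proof (rule linearI)
    show "w ((u + v) # us) = w (u # us) + w (v # us)" for u v using *[of 1 u 1 v] by simp
    show "w ((c *\<^sub>R u) # us) = c *\<^sub>R w (u # us)" for c u using *[of c u 0 u] by simp
  qed
  from linear_sum_Basis[OF this, of u] show ?thesis by simp
qed

text \<open>The product rule for the evaluation of a varying multilinear form on varying vectors. Expanding
  the first vector over a basis reduces the number of arguments by one.\<close>

lemma multilinear_has_derivative:
  fixes w :: "'f::euclidean_space \<Rightarrow> 'f list \<Rightarrow> real" and s :: "'e::euclidean_space \<Rightarrow> 'f"
  assumes s: "(s has_derivative s') (at x)" "open W" "s x \<in> W"
  shows "(\<And>z. z \<in> W \<Longrightarrow> multilinear_list k (w z)) \<Longrightarrow>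
    (\<And>us. length us = k \<Longrightarrow> ((\<lambda>z. w z us) has_derivative Dw us) (at (s x))) \<Longrightarrow>
    length as = k \<Longrightarrow> (\<And>a. a \<in> set as \<Longrightarrow> (a has_derivative D a) (at x)) \<Longrightarrow>
    ((\<lambda>y. w (s y) (map (\<lambda>a. a y) as)) has_derivative (\<lambda>v. Dw (map (\<lambda>a. a x) as) (s' v) +
       (\<Sum>j<k. w (s x) ((map (\<lambda>a. a x) as)[j := D (as ! j) v])))) (at x)"
proof (induction k arbitrary: w Dw as)
  case 0
  then show ?case using has_derivative_compose[OF s(1) 0(2)[of "[]"]] by simp
next
  case (Suc k)
  then obtain a r where as: "as = a # r" "length r = k" by (cases as) auto
  let ?R = "\<lambda>y. map (\<lambda>a. a y) r"
  have a: "(a has_derivative D a) (at x)" using Suc.prems(4) as by simp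
  have IH: "((\<lambda>y. w (s y) (b # ?R y)) has_derivative (\<lambda>v. Dw (b # ?R x) (s' v) +
       (\<Sum>j<k. w (s x) (b # (?R x)[j := D (r ! j) v])))) (at x)" for b
    by (rule Suc.IH[of "\<lambda>z us. w z (b # us)" "\<lambda>us. Dw (b # us)" r])
       (use Suc.prems as in \<open>simp_all add: multilinear_list_ConsD\<close>)
  let ?G = "\<lambda>v. \<Sum>b\<in>Basis. (a x \<bullet> b) * (Dw (b # ?R x) (s' v) + (\<Sum>j<k. w (s x) (b # (?R x)[j := D (r ! j) v])))
      + (D a v \<bullet> b) * w (s x) (b # ?R x)"
  have G: "((\<lambda>y. \<Sum>b\<in>Basis. (a y \<bullet> b) * w (s y) (b # ?R y)) has_derivative ?G) (at x)"
    by (intro has_derivative_sum has_derivative_mult has_derivative_inner_left a IH)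
  have ev: "\<forall>\<^sub>F y in at x. s y \<in> W"
    using topological_tendstoD[OF has_derivative_continuous[OF s(1), unfolded continuous_at] s(2,3)] .
  have head: "w z (u # us) = (\<Sum>b\<in>Basis. (u \<bullet> b) * w z (b # us))" if "z \<in> W" "length us = k" for z u us
    by (rule multilinear_list_head[OF Suc.prems(1)[OF that(1)] that(2)])
  have 1: "((\<lambda>y. w (s y) (a y # ?R y)) has_derivative ?G) (at x)"
    by (rule has_derivative_transform_eventually[OF G])
       (use ev s(3) as in \<open>auto simp: head elim!: eventually_mono\<close>)
  have Dw: "Dw (u # us) v = (\<Sum>b\<in>Basis. (u \<bullet> b) * Dw (b # us) v)" if us: "length us = k" for u us v
  proof -
    have "((\<lambda>z. \<Sum>b\<in>Basis. (u \<bullet> b) * w z (b # us)) has_derivative (\<lambda>v. \<Sum>b\<in>Basis. (u \<bullet> b) * Dw (b # us) v)) (at (s x))"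
      by (intro has_derivative_sum has_derivative_mult_right Suc.prems(2)) (use us in simp)
    then have "((\<lambda>z. w z (u # us)) has_derivative (\<lambda>v. \<Sum>b\<in>Basis. (u \<bullet> b) * Dw (b # us) v)) (at (s x))"
      by (rule has_derivative_transform_within_open[OF _ s(2,3)]) (simp add: head us)
    from has_derivative_unique[OF this Suc.prems(2)] us show ?thesis by (metis length_Cons)
  qed
  have "?G v = Dw (a x # ?R x) (s' v) + (w (s x) (D a v # ?R x) + (\<Sum>j<k. w (s x) (a x # (?R x)[j := D (r ! j) v])))" for v
  proof -
    have "?G v = (\<Sum>b\<in>Basis. (a x \<bullet> b) * Dw (b # ?R x) (s' v)) + ((\<Sum>b\<in>Basis. (D a v \<bullet> b) * w (s x) (b # ?R x)) +
       (\<Sum>j<k. \<Sum>b\<in>Basis. (a x \<bullet> b) * w (s x) (b # (?R x)[j := D (r ! j) v])))"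
      by (subst sum.swap) (simp add: sum.distrib algebra_simps sum_distrib_left)
    then show ?thesis using as by (simp add: Dw[symmetric] head[OF s(3), symmetric])
  qed
  then have "?G = (\<lambda>v. Dw (a x # ?R x) (s' v) + (\<Sum>j<Suc k. w (s x) ((a x # ?R x)[j := D ((a # r) ! j) v])))"
    by (auto simp only: sum.lessThan_Suc_shift) simp
  with 1 show ?case by (simp add: as(1))
qed

definition alternating_list :: "nat \<Rightarrow> ('f::real_vector list \<Rightarrow> real) \<Rightarrow> bool" where
  "alternating_list k w \<longleftrightarrow> multilinear_list k w \<and>
     (\<forall>us i j. length us = k \<and> i < k \<and> j < k \<and> i \<noteq> j \<and> us ! i = us ! j \<longrightarrow> w us = 0)"

lemma alternating_list_swap:
  assumes "alternating_list k w" "length (xs @ a # b # ys) = k"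
  shows "w (xs @ a # b # ys) = - w (xs @ b # a # ys)"
proof -
  let ?n = "length xs"
  have lin: "w (us[i := u + v]) = w (us[i := u]) + w (us[i := v])" if "length us = k" "i < k" for us i u v
    using assms(1)[unfolded alternating_list_def multilinear_list_def] that
    by (metis scaleR_one mult_1)
  \<comment> \<open>Polarization: expand the vanishing value at the repeated argument \<open>a + b\<close>.\<close>
  have zero: "w (xs @ c # c # ys) = 0" for c
    using assms(1)[unfolded alternating_list_def, THEN conjunct2, rule_format, of "xs @ c # c # ys" ?n "Suc ?n"] assms(2)
    by (simp add: nth_append)
  have l1: "w (xs @ (u + v) # c # ys) = w (xs @ u # c # ys) + w (xs @ v # c # ys)" for u v c
    using lin[of "xs @ u # c # ys" ?n u v] assms(2) by simp
  have l2: "w (xs @ c # (u + v) # ys) = w (xs @ c # u # ys) + w (xs @ c # v # ys)" for u v c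
    using lin[of "xs @ c # u # ys" "Suc ?n" u v] assms(2) by (simp add: list_update_append)
  show ?thesis using zero[of "a + b"] zero[of a] zero[of b] by (simp add: l1 l2)
qed

lemma alternating_list_move:
  assumes "alternating_list k w"
  shows "length (xs @ b # ys) = k \<Longrightarrow> w (xs @ b # ys) = (-1) ^ length xs * w (b # xs @ ys)"
proof (induction xs arbitrary: ys rule: rev_induct)
  case (snoc a xs)
  then show ?case
    using alternating_list_swap[OF assms, of xs a b ys] snoc.IH[of "a # ys"] by simp
qed simp

lemma alternating_list_update:
  assumes "alternating_list k w" "length us = k" "j < k"
  shows "w (us[j := b]) = (-1) ^ j * w (b # drop_nth j us)"
  using alternating_list_move[OF assms(1), of "take j us" b "drop (Suc j) us"] assms
  by (simp add: upd_conv_take_nth_drop drop_nth_def min_def)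

lemma drop_nth_nth: "j < length us - 1 \<Longrightarrow> drop_nth i us ! j = us ! (if j < i then j else Suc j)"
  by (auto simp: drop_nth_def nth_append min_def)

lemma length_drop_nth: "i < length us \<Longrightarrow> length (drop_nth i us) = length us - 1"
  by (simp add: drop_nth_def)

lemma map_drop_nth: "map f (drop_nth i us) = drop_nth i (map f us)"
  by (simp add: drop_nth_def take_map drop_map)

lemma drop_nth_drop_nth:
  assumes "j < i" "i < length us"
  shows "drop_nth j (drop_nth i us) = drop_nth (i - 1) (drop_nth j us)"
proof (rule nth_equalityI)
  show l: "length (drop_nth j (drop_nth i us)) = length (drop_nth (i - 1) (drop_nth j us))"
    using assms by (simp add: length_drop_nth)
  fix m assume "m < length (drop_nth j (drop_nth i us))"
  then have "m < length us - 2" using assms by (simp add: length_drop_nth)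
  then show "drop_nth j (drop_nth i us) ! m = drop_nth (i - 1) (drop_nth j us) ! m"
    using assms by (auto simp: drop_nth_nth length_drop_nth)
qed

text \<open>The terms in question carry a second derivative \<open>B\<close>. The term that omits argument \<open>i\<close> and
  differentiates argument \<open>l\<close> cancels the one with \<open>i\<close> and \<open>l\<close> interchanged: moving the entry
  \<open>B\<close> to the front of the alternating form shows that they are opposite. The position \<open>j\<close> counts
  the arguments that remain after the omission, hence the shifts by one.\<close>

lemma alternating_symmetric_cancel:
  fixes w :: "'f::real_vector list \<Rightarrow> real"
  assumes w: "alternating_list k w" and B: "\<And>u v. B u v = B v u" and us: "length us = Suc k"
  shows "(\<Sum>i<Suc k. (-1) ^ i * (\<Sum>j<k. w ((map L (drop_nth i us))[j := B (drop_nth i us ! j) (us ! i)]))) = 0"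
proof -
  define t where "t i j = (-1) ^ i * w ((map L (drop_nth i us))[j := B (drop_nth i us ! j) (us ! i)])" for i j
  have t: "t i j = (-1) ^ (i + j) * w (B (us ! (if j < i then j else Suc j)) (us ! i) # map L (drop_nth j (drop_nth i us)))"
    if "i < Suc k" "j < k" for i j
    using alternating_list_update[OF w, of "map L (drop_nth i us)" j] that us
    by (simp add: t_def length_drop_nth drop_nth_nth map_drop_nth power_add)
  have sym: "t j (i - 1) = - t i j" if ij: "j < i" "i < Suc k" for i j
  proof -
    have "i - 1 < k" "\<not> i - 1 < j" "Suc (i - 1) = i" using ij by auto
    then have "t j (i - 1) = (-1) ^ (j + (i - 1)) * w (B (us ! i) (us ! j) # map L (drop_nth (i - 1) (drop_nth j us)))"
      using t[of j "i - 1"] ij by simp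
    also have "(-1 :: real) ^ (j + (i - 1)) = - ((-1) ^ (i + j))" using ij by (cases i) (auto simp: add.commute)
    finally show ?thesis using t[of i j] ij drop_nth_drop_nth[of j i us] us B[of "us ! i" "us ! j"] by simp
  qed
  have "(\<Sum>i<Suc k. \<Sum>j<k. t i j) = (\<Sum>(i, j)\<in>{..<Suc k} \<times> {..<k}. t i j)" by (rule sum.cartesian_product)
  also have "{..<Suc k} \<times> {..<k} = {(i, j). j < i \<and> i < Suc k} \<union> {(i, j). i \<le> j \<and> j < k}" by auto
  also have "(\<Sum>(i, j)\<in>\<dots>. t i j) = (\<Sum>(i, j)\<in>{(i, j). j < i \<and> i < Suc k}. t i j) + (\<Sum>(i, j)\<in>{(i, j). i \<le> j \<and> j < k}. t i j)"
    by (rule sum.union_disjoint) (auto intro: finite_subset[of _ "{..<Suc k} \<times> {..<Suc k}"])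
  also have "(\<Sum>(i, j)\<in>{(i, j). i \<le> j \<and> j < k}. t i j) = (\<Sum>(i, j)\<in>{(i, j). j < i \<and> i < Suc k}. - t i j)"
    by (rule sum.reindex_bij_witness[of _ "\<lambda>(i, j). (j, i - 1)" "\<lambda>(i, j). (Suc j, i)"])
       (use sym[of _ "Suc _"] in \<open>force+\<close>)
  finally have "(\<Sum>i<Suc k. \<Sum>j<k. t i j) = 0" by (simp add: sum_negf case_prod_unfold)
  then show ?thesis by (simp add: t_def sum_distrib_left)
qed

lemma form_coordinates_alternating:
  fixes B :: "('b, 'f::euclidean_space) chart set"
  assumes "smooth_atlas H B" "c \<in> B" "q \<in> cdom c" "alternating_on (tspace B q) k \<alpha>"
  shows "alternating_list k (\<lambda>us. \<alpha> (map (tvec_of B q c) us))"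
proof -
  have t: "tvec_of B q c u \<in> tspace B q" for u by (rule tvec_of_in_tspace[OF assms(1-3)])
  then have s: "set (map (tvec_of B q c) us) \<subseteq> tspace B q" for us by auto
  show ?thesis
    unfolding alternating_list_def multilinear_list_def
  proof (intro conjI allI impI)
    fix us :: "'f list" and i u v a b assume "length us = k" "i < k"
    then show "\<alpha> (map (tvec_of B q c) (us[i := a *\<^sub>R u + b *\<^sub>R v])) =
       a * \<alpha> (map (tvec_of B q c) (us[i := u])) + b * \<alpha> (map (tvec_of B q c) (us[i := v]))"
      using assms(4)[unfolded alternating_on_def, rule_format, OF conjI[OF s], of us, THEN conjunct1] t
      by (simp add: map_update tvec_of_lincomb[OF assms(1-3)])
  next
    fix us :: "'f list" and i j assume "length us = k \<and> i < k \<and> j < k \<and> i \<noteq> j \<and> us ! i = us ! j"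
    then show "\<alpha> (map (tvec_of B q c) us) = 0"
      using assms(4)[unfolded alternating_on_def, rule_format, OF conjI[OF s], of us, THEN conjunct2, rule_format, of i j]
      by simp
  qed
qed

text \<open>By the product rule the exterior derivative of the pullback is the pullback of the exterior
  derivative plus terms with a second derivative of \<open>f\<close>; the latter is symmetric, so they cancel.
  Only the values on \<open>S\<close> enter on the left, but the derivatives within \<open>S\<close> are unique and hence are
  those of a local extension of \<open>f\<close>.\<close>

lemma ext_deriv_pullback:
  assumes A: "smooth_atlas UNIV A" and B: "smooth_atlas UNIV B"
    and S: "S \<subseteq> mcarrier A" "unique_deriv_set A S" and f: "extendable_map A B S f" "f ` S \<subseteq> mcarrier B"
    and \<omega>: "smooth_form B k \<omega>" and p: "p \<in> S" and ws: "set ws \<subseteq> tspace A p" "length ws = Suc k"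
  shows "ext_deriv A S (pullback A B S f \<omega>) p ws =
    ext_deriv B (mcarrier B) \<omega> (f p) (map (tmap A B S f p) ws)"
proof -
  define c where "c = chart_at A p"
  define c' where "c' = chart_at B (f p)"
  have c: "c \<in> A" "p \<in> cdom c" and c': "c' \<in> B" "f p \<in> cdom c'"
    using chart_at[of p A] chart_at[of "f p" B] S p f(2) by (auto simp: c_def c'_def)
  obtain N h where pN: "cmap c p \<in> N" and rep: "local_rep S f c c' N h"
    using extendable_mapE[OF f(1) p c(1) c'(1) c(2) c'(2)] .
  have N: "open N" "smooth_on N h"
    "\<And>q. q \<in> S \<Longrightarrow> q \<in> cdom c \<Longrightarrow> cmap c q \<in> N \<Longrightarrow> f q \<in> cdom c' \<and> h (cmap c q) = cmap c' (f q)"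
    using rep by (auto simp: local_rep_def)
  note inj = atlas_inj[OF A c(1)] atlas_inj[OF B c'(1)]
  let ?T = "cmap c ` (S \<inter> cdom c)"
  let ?Dh = "\<lambda>x. frechet_derivative h (at x)"
  define x where "x = cmap c p"
  define W where "W = cmap c' ` cdom c'"
  have W: "open W" unfolding W_def by (rule atlas_open[OF B c'(1)])
  have hx: "h x = cmap c' (f p)" "h x \<in> W" using N(3)[OF p c(2) pN] by (auto simp: x_def W_def)
  have ud: "unique_deriv ?T (cmap c q)" if "q \<in> S" "q \<in> cdom c" for q
    using S(2) that c(1) by (simp add: unique_deriv_set_def)
  define w where "w z us = \<omega> (cinv c' z) (map (tvec_of B (cinv c' z) c') us)" for z us
  have alt: "alternating_list k (w z)" if "z \<in> W" for z
  proof -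
    have z: "cinv c' z \<in> cdom c'" using that cinv_in by (simp add: W_def)
    then have "alternating_on (tspace B (cinv c' z)) k (\<omega> (cinv c' z))"
      using \<omega> c'(1) by (auto simp: smooth_form_def mcarrier_def)
    from form_coordinates_alternating[OF B c'(1) z this] show ?thesis by (simp add: w_def[abs_def])
  qed
  have wd: "((\<lambda>z. w z us) has_derivative frechet_derivative (\<lambda>z. w z us) (at z)) (at z)" if "length us = k" "z \<in> W" for us z
  proof (rule smooth_on_has_derivative[OF _ W that(2)])
    show "smooth_on W (\<lambda>z. w z us)" using \<omega> c'(1) that(1) by (simp add: smooth_form_def w_def W_def)
  qed
  have tm: "tmap A B S f q v = tvec_of B (f q) c' (?Dh (cmap c q) (v c))"
    if "q \<in> S" "q \<in> cdom c" "cmap c q \<in> N" "v \<in> tspace A q" for q v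
    using tmap_local_rep[OF A c(1) B c'(1) that(1,2) ud[OF that(1,2)] that(3) rep that(4)] .
  define us where "us = map (\<lambda>w. w c) ws"
  have us: "length us = Suc k" using ws by (simp add: us_def)
  define \<beta> where "\<beta> u v = frechet_derivative (\<lambda>y. ?Dh y u) (at x) v" for u v
  have Dh: "(h has_derivative ?Dh x) (at x)"
    using smooth_on_has_derivative[OF N(2,1)] pN by (simp add: x_def)
  have main: "frechet_derivative (\<lambda>y. pullback A B S f \<omega> (cinv c y) (map (tvec_of A (cinv c y) c) vs)) (at x within ?T) v =
     frechet_derivative (\<lambda>z. w z (map (?Dh x) vs)) (at (h x)) (?Dh x v) +
       (\<Sum>j<k. w (h x) ((map (?Dh x) vs)[j := \<beta> (vs ! j) v]))" if vs: "length vs = k" for vs v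
  proof -
    let ?as = "map (\<lambda>u y. ?Dh y u) vs"
    have 1: "((\<lambda>y. w (h y) (map (\<lambda>a. a y) ?as)) has_derivative
       (\<lambda>v. frechet_derivative (\<lambda>z. w z (map (\<lambda>a. a x) ?as)) (at (h x)) (?Dh x v) +
       (\<Sum>j<k. w (h x) ((map (\<lambda>a. a x) ?as)[j := frechet_derivative (?as ! j) (at x) v])))) (at x)"
    proof (rule multilinear_has_derivative[OF Dh W hx(2), where Dw="\<lambda>us. frechet_derivative (\<lambda>z. w z us) (at (h x))"
          and D="\<lambda>a. frechet_derivative a (at x)"])
      show "multilinear_list k (w z)" if "z \<in> W" for z using alt[OF that] by (simp add: alternating_list_def)
      show "((\<lambda>z. w z us) has_derivative frechet_derivative (\<lambda>z. w z us) (at (h x))) (at (h x))" if "length us = k" for us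
        by (rule wd[OF that hx(2)])
      show "(a has_derivative frechet_derivative a (at x)) (at x)" if "a \<in> set ?as" for a
        using that smooth_on_has_derivative[OF smooth_on_frechet[OF N(2,1)] N(1)] pN by (auto simp: x_def)
    qed (use vs in simp)
    let ?D = "\<lambda>v. frechet_derivative (\<lambda>z. w z (map (?Dh x) vs)) (at (h x)) (?Dh x v) +
       (\<Sum>j<k. w (h x) ((map (?Dh x) vs)[j := \<beta> (vs ! j) v]))"
    have 2: "((\<lambda>y. w (h y) (map (?Dh y) vs)) has_derivative ?D) (at x within (?T \<inter> N))"
      using has_derivative_at_withinI[OF 1] vs by (simp add: \<beta>_def comp_def)
    have "((\<lambda>y. pullback A B S f \<omega> (cinv c y) (map (tvec_of A (cinv c y) c) vs)) has_derivative ?D) (at x within (?T \<inter> N))"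
    proof (rule has_derivative_transform[OF _ _ 2])
      show "x \<in> ?T \<inter> N" using p c(2) pN by (auto simp: x_def)
      fix y assume "y \<in> ?T \<inter> N"
      then obtain q where q: "q \<in> S" "q \<in> cdom c" "y = cmap c q" "y \<in> N" by blast
      have fq: "f q \<in> cdom c'" "h y = cmap c' (f q)" using N(3)[of q] q by auto
      have "tmap A B S f q (tvec_of A q c u) = tvec_of B (f q) c' (?Dh y u)" for u
        using tm[OF q(1,2) _ tvec_of_in_tspace[OF A c(1) q(2)]] q(3,4) by (simp add: tvec_of_self[OF A c(1) q(2)])
      then show "pullback A B S f \<omega> (cinv c y) (map (tvec_of A (cinv c y) c) vs) = w (h y) (map (?Dh y) vs)"
        using q fq by (simp add: pullback_def w_def cinv_cmap[OF inj(1)] cinv_cmap[OF inj(2)] comp_def)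
    qed
    then have "((\<lambda>y. pullback A B S f \<omega> (cinv c y) (map (tvec_of A (cinv c y) c) vs)) has_derivative ?D) (at x within ?T)"
      using at_within_Int_open[OF N(1), of x ?T] pN by (simp add: x_def)
    moreover have "unique_deriv ?T x" using ud[OF p c(2)] by (simp add: x_def)
    ultimately show ?thesis by (simp add: unique_deriv_frechet)
  qed
  have "ext_deriv A S (pullback A B S f \<omega>) p ws =
     (\<Sum>i<Suc k. (-1) ^ i * frechet_derivative (\<lambda>y. pullback A B S f \<omega> (cinv c y) (map (tvec_of A (cinv c y) c) (drop_nth i us)))
        (at x within ?T) (us ! i))"
    using us by (simp only: ext_deriv_def Let_def c_def[symmetric] us_def[symmetric] x_def[symmetric])
  also have "\<dots> = (\<Sum>i<Suc k. (-1) ^ i * frechet_derivative (\<lambda>z. w z (map (?Dh x) (drop_nth i us))) (at (h x)) (?Dh x (us ! i))) +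
     (\<Sum>i<Suc k. (-1) ^ i * (\<Sum>j<k. w (h x) ((map (?Dh x) (drop_nth i us))[j := \<beta> (drop_nth i us ! j) (us ! i)])))"
    unfolding sum.distrib[symmetric] distrib_left[symmetric]
    by (intro sum.cong refl arg_cong2[where f="(*)"] main) (use us in \<open>simp add: length_drop_nth\<close>)
  also have "(\<Sum>i<Suc k. (-1) ^ i * (\<Sum>j<k. w (h x) ((map (?Dh x) (drop_nth i us))[j := \<beta> (drop_nth i us ! j) (us ! i)]))) = 0"
    by (rule alternating_symmetric_cancel[OF alt[OF hx(2)] _ us])
       (use second_derivative_symmetric[OF N(2,1)] pN in \<open>simp add: \<beta>_def x_def\<close>)
  also have "(\<Sum>i<Suc k. (-1) ^ i * frechet_derivative (\<lambda>z. w z (map (?Dh x) (drop_nth i us))) (at (h x)) (?Dh x (us ! i))) + 0 =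
     ext_deriv B (mcarrier B) \<omega> (f p) (map (tmap A B S f p) ws)"
  proof -
    have m: "map (\<lambda>w. w c') (map (tmap A B S f p) ws) = map (?Dh x) us"
      using tm[OF p c(2) pN] ws(1) tvec_of_self[OF B c'] by (auto simp: us_def x_def)
    have "cmap c' ` (mcarrier B \<inter> cdom c') = W" using c'(1) by (auto simp: W_def mcarrier_def)
    then have "at (cmap c' (f p)) within cmap c' ` (mcarrier B \<inter> cdom c') = at (h x)"
      using at_within_open[OF hx(2) W] hx(1) by simp
    moreover have "ext_deriv B (mcarrier B) \<omega> (f p) (map (tmap A B S f p) ws) =
      (\<Sum>i<length (map (?Dh x) us). (-1) ^ i * frechet_derivative
         (\<lambda>z. \<omega> (cinv c' z) (map (tvec_of B (cinv c' z) c') (drop_nth i (map (?Dh x) us))))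
         (at (cmap c' (f p)) within cmap c' ` (mcarrier B \<inter> cdom c')) (map (?Dh x) us ! i))"
      by (simp only: ext_deriv_def Let_def c'_def[symmetric] m)
    ultimately show ?thesis
      unfolding add_0_right by (auto simp: us w_def map_drop_nth intro!: sum.cong)
  qed
  finally show ?thesis .
qed

section \<open>Adapted charts\<close>

lemma openin_mtop_atlas:
  assumes "smooth_atlas UNIV A"
  shows "openin (mtop A) W \<longleftrightarrow> W \<subseteq> mcarrier A \<and> (\<forall>c\<in>A. open (cmap c ` (W \<inter> cdom c)))"
proof -
  have "openin (top_of_set (cmap c ` cdom c)) (cmap c ` (W \<inter> cdom c)) \<longleftrightarrow> open (cmap c ` (W \<inter> cdom c))" if "c \<in> A" for c
    using openin_open_eq[OF atlas_open[OF assms that]] by blast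
  then show ?thesis by (simp add: openin_mtop[OF atlas_inj[OF assms]])
qed

lemma topspace_mtop:
  assumes "\<And>c. c \<in> A \<Longrightarrow> inj_on (cmap c) (cdom c)" shows "topspace (mtop A) = mcarrier A"
proof
  show "topspace (mtop A) \<subseteq> mcarrier A"
    using openin_topspace[of "mtop A"] openin_mtop[OF assms] by blast
  have "openin (top_of_set (cmap c ` cdom c)) (cmap c ` (mcarrier A \<inter> cdom c))" if "c \<in> A" for c
  proof -
    have "mcarrier A \<inter> cdom c = cdom c" using that by (auto simp: mcarrier_def)
    then show ?thesis by simp
  qed
  then have "openin (mtop A) (mcarrier A)" using openin_mtop[OF assms] by blast
  then show "mcarrier A \<subseteq> topspace (mtop A)" by (rule openin_subset)
qed

lemma topspace_atlas: "smooth_atlas H A \<Longrightarrow> topspace (mtop A) = mcarrier A"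
  by (rule topspace_mtop[OF atlas_inj])

lemma openin_mtop_charts:
  "smooth_atlas H A \<Longrightarrow> openin (mtop A) W \<longleftrightarrow> W \<subseteq> mcarrier A \<and>
     (\<forall>c\<in>A. openin (top_of_set (cmap c ` cdom c)) (cmap c ` (W \<inter> cdom c)))"
  by (rule openin_mtop[OF atlas_inj])

lemma openin_cdom:
  assumes "smooth_atlas UNIV A" "c \<in> A" shows "openin (mtop A) (cdom c)"
  unfolding openin_mtop_atlas[OF assms(1)]
proof (intro conjI ballI)
  show "cdom c \<subseteq> mcarrier A" using assms(2) by (auto simp: mcarrier_def)
  show "open (cmap c' ` (cdom c \<inter> cdom c'))" if "c' \<in> A" for c'
    using atlas_overlap_open[OF assms(1) that assms(2)] by (simp add: Int_commute)
qed

lemma cinv_eqI: "inj_on (cmap c) (cdom c) \<Longrightarrow> p \<in> cdom c \<Longrightarrow> cmap c p = x \<Longrightarrow> cinv c x = p"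
  using cinv_cmap by metis

lemma smooth_atlas_sub:
  assumes A: "smooth_atlas UNIV A" and W: "openin (mtop A) (W \<inter> mcarrier A)"
  shows "smooth_atlas UNIV (sub_atlas A W)"
  unfolding smooth_atlas_def
proof (intro conjI ballI full_model_UNIV)
  have o: "open (cmap c ` (cdom c \<inter> W))" if "c \<in> A" for c
  proof -
    have "W \<inter> mcarrier A \<inter> cdom c = cdom c \<inter> W" using that by (auto simp: mcarrier_def)
    then show ?thesis using W that unfolding openin_mtop_atlas[OF A] by metis
  qed
  {
    fix c assume "c \<in> sub_atlas A W"
    then obtain d where d: "d \<in> A" "c = (cdom d \<inter> W, cmap d)" by (auto simp: sub_atlas_def)
    show "model_chart UNIV c"
      using atlas_inj[OF A d(1)] o[OF d(1)] by (auto simp: model_chart_def d(2) intro: inj_on_subset)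
  }
  fix c c' assume "c \<in> sub_atlas A W" "c' \<in> sub_atlas A W"
  then obtain d d' where d: "d \<in> A" "c = (cdom d \<inter> W, cmap d)" and d': "d' \<in> A" "c' = (cdom d' \<inter> W, cmap d')"
    by (auto simp: sub_atlas_def)
  note inj = atlas_inj[OF A d(1)]
  have e: "cmap d ` (cdom d \<inter> W \<inter> (cdom d' \<inter> W)) = cmap d ` (cdom d \<inter> cdom d') \<inter> cmap d ` (cdom d \<inter> W)"
    using inj by (auto simp: inj_on_def)
  have "open (cmap d ` (cdom d \<inter> W \<inter> (cdom d' \<inter> W)))"
    unfolding e using atlas_overlap_open[OF A d(1) d'(1)] o[OF d(1)] by (rule open_Int)
  moreover have "smooth_on (cmap d ` (cdom d \<inter> W \<inter> (cdom d' \<inter> W))) (cmap d' \<circ> cinv c)"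
  proof (rule smooth_on_cong_subset[OF atlas_transition_smooth[OF A d(1) d'(1)]])
    fix x assume "x \<in> cmap d ` (cdom d \<inter> W \<inter> (cdom d' \<inter> W))"
    then obtain q where q: "q \<in> cdom d" "q \<in> W" "x = cmap d q" by blast
    have "cinv c x = q" using q inj by (intro cinv_eqI) (auto simp: d(2) inj_on_def)
    moreover have "cinv d x = q" using q inj by (intro cinv_eqI) auto
    ultimately show "(cmap d' \<circ> cinv c) x = (cmap d' \<circ> cinv d) x" by simp
  qed auto
  ultimately show "smooth_transition UNIV c c'" by (simp add: smooth_transition_def d(2) d'(2))
qed

lemma smooth_atlas_prod:
  assumes A: "smooth_atlas UNIV A" and B: "smooth_atlas UNIV B"
  shows "smooth_atlas UNIV (prod_atlas A B)"
  unfolding smooth_atlas_def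
proof (intro conjI ballI full_model_UNIV)
  {
    fix c assume "c \<in> prod_atlas A B"
    then obtain a b where c: "a \<in> A" "b \<in> B" "c = (cdom a \<times> cdom b, map_prod (cmap a) (cmap b))"
      by (auto simp: prod_atlas_def)
    show "model_chart UNIV c"
      using map_prod_inj_on[OF atlas_inj[OF A c(1)] atlas_inj[OF B c(2)]] open_Times[OF atlas_open[OF A c(1)] atlas_open[OF B c(2)]]
      by (simp add: model_chart_def c(3) map_prod_surj_on)
  }
  fix c c' assume "c \<in> prod_atlas A B" "c' \<in> prod_atlas A B"
  then obtain a b a' b' where c: "a \<in> A" "b \<in> B" "c = (cdom a \<times> cdom b, map_prod (cmap a) (cmap b))"
    and c': "a' \<in> A" "b' \<in> B" "c' = (cdom a' \<times> cdom b', map_prod (cmap a') (cmap b'))"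
    by (auto simp: prod_atlas_def)
  let ?OA = "cmap a ` (cdom a \<inter> cdom a')" and ?OB = "cmap b ` (cdom b \<inter> cdom b')"
  note inj = atlas_inj[OF A c(1)] atlas_inj[OF B c(2)]
  have e: "cmap c ` (cdom c \<inter> cdom c') = ?OA \<times> ?OB"
    by (simp add: c(3) c'(3) Times_Int_Times map_prod_surj_on)
  have "open (?OA \<times> ?OB)"
    using atlas_overlap_open[OF A c(1) c'(1)] atlas_overlap_open[OF B c(2) c'(2)] by (rule open_Times)
  moreover have "smooth_on (?OA \<times> ?OB) (cmap c' \<circ> cinv c)"
  proof (rule smooth_on_cong)
    show "smooth_on (?OA \<times> ?OB) (\<lambda>z. ((cmap a' \<circ> cinv a) (fst z), (cmap b' \<circ> cinv b) (snd z)))"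
      by (intro smooth_on_Pair smooth_on_compose[OF _ atlas_transition_smooth[OF A c(1) c'(1)]]
          smooth_on_compose[OF _ atlas_transition_smooth[OF B c(2) c'(2)]] smooth_on_fst smooth_on_snd smooth_on_id) auto
    fix z assume "z \<in> ?OA \<times> ?OB"
    then obtain q r where q: "q \<in> cdom a" "r \<in> cdom b" "z = (cmap a q, cmap b r)" by auto
    have "inj_on (cmap c) (cdom c)" using map_prod_inj_on[OF inj] by (simp add: c(3))
    then have "cinv c z = (q, r)" by (rule cinv_eqI) (use q in \<open>simp_all add: c(3)\<close>)
    then show "(cmap c' \<circ> cinv c) z = ((cmap a' \<circ> cinv a) (fst z), (cmap b' \<circ> cinv b) (snd z))"
      using q by (simp add: c'(3) cinv_cmap[OF inj(1)] cinv_cmap[OF inj(2)])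
  qed
  ultimately show "smooth_transition UNIV c c'" by (simp add: smooth_transition_def e)
qed

lemma mcarrier_sub: "mcarrier (sub_atlas A W) = mcarrier A \<inter> W"
  by (auto simp: mcarrier_def sub_atlas_def)

lemma mcarrier_prod: "mcarrier (prod_atlas A B) = mcarrier A \<times> mcarrier B"
proof (intro equalityI subsetI)
  fix p assume "p \<in> mcarrier (prod_atlas A B)"
  then show "p \<in> mcarrier A \<times> mcarrier B" by (auto simp: mcarrier_def prod_atlas_def)
next
  fix p assume "p \<in> mcarrier A \<times> mcarrier B"
  then obtain a b where "a \<in> A" "fst p \<in> cdom a" "b \<in> B" "snd p \<in> cdom b" by (auto simp: mcarrier_def)
  then have "(cdom a \<times> cdom b, map_prod (cmap a) (cmap b)) \<in> prod_atlas A B" "p \<in> cdom a \<times> cdom b"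
    unfolding prod_atlas_def by (blast, simp add: mem_Times_iff)
  then show "p \<in> mcarrier (prod_atlas A B)" unfolding mcarrier_def by force
qed

lemma smooth_manifold_maximal:
  assumes "smooth_manifold A" "model_chart UNIV c" "cdom c \<subseteq> mcarrier A"
    "\<And>c'. c' \<in> A \<Longrightarrow> smooth_transition UNIV c c'" "\<And>c'. c' \<in> A \<Longrightarrow> smooth_transition UNIV c' c"
  shows "c \<in> A"
proof -
  have "\<forall>c. model_chart UNIV c \<and> cdom c \<subseteq> mcarrier A \<and>
          (\<forall>c'\<in>A. smooth_transition UNIV c c' \<and> smooth_transition UNIV c' c) \<longrightarrow> c \<in> A"
    using assms(1) unfolding smooth_manifold_on_def by (elim conjE)
  from this[rule_format, of c] show ?thesis using assms(2-5) by blast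
qed

text \<open>The transition maps to and from this chart are coordinate expressions of \<open>\<Psi>\<close> and its inverse, so
  the chart belongs to the maximal atlas.\<close>

lemma pullback_chart:
  assumes Y: "smooth_manifold Y" and W: "openin (mtop Y) (W \<inter> mcarrier Y)" and P: "smooth_atlas UNIV P"
    and \<Psi>: "diffeomorphism (sub_atlas Y W) P \<Psi>" and c': "c' \<in> P"
  shows "({y \<in> mcarrier Y \<inter> W. \<Psi> y \<in> cdom c'}, cmap c' \<circ> \<Psi>) \<in> Y" (is "(?D, ?m) \<in> Y")
proof (rule smooth_manifold_maximal[OF Y])
  let ?f = "(?D, ?m)"
  let ?Y = "sub_atlas Y W"
  let ?\<Phi> = "inv_into (mcarrier ?Y) \<Psi>"
  have AY: "smooth_atlas UNIV Y" by (rule smooth_manifold_on_atlas[OF Y]) simp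
  have AS: "smooth_atlas UNIV ?Y" by (rule smooth_atlas_sub[OF AY W])
  have mc: "mcarrier ?Y = mcarrier Y \<inter> W" by (rule mcarrier_sub)
  have bij: "bij_betw \<Psi> (mcarrier Y \<inter> W) (mcarrier P)" and s1: "smooth_map ?Y P \<Psi>" and s2: "smooth_map P ?Y ?\<Phi>"
    using \<Psi> by (simp_all add: diffeomorphism_def mc)
  have c'P: "cdom c' \<subseteq> mcarrier P" using c' by (auto simp: mcarrier_def)
  have topP: "topspace (mtop P) = mcarrier P" by (rule topspace_atlas[OF P])
  note injc' = atlas_inj[OF P c']
  have inj: "inj_on ?m ?D"
  proof (rule inj_onI)
    fix y z assume "y \<in> ?D" "z \<in> ?D" "?m y = ?m z"
    then have "\<Psi> y = \<Psi> z" using injc' by (auto simp: inj_on_def)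
    then show "y = z" using \<open>y \<in> ?D\<close> \<open>z \<in> ?D\<close> bij by (auto simp: bij_betw_def inj_on_def)
  qed
  have \<Phi>: "?\<Phi> (\<Psi> y) = y" if "y \<in> mcarrier Y \<inter> W" for y
    using bij_betw_inv_into_left[OF bij that] by (simp add: mc)
  have \<Phi>': "\<Psi> (?\<Phi> q) = q" "?\<Phi> q \<in> mcarrier Y \<inter> W" if "q \<in> mcarrier P" for q
    using bij_betw_inv_into_right[OF bij that] bij_betwE[OF bij_betw_inv_into[OF bij]] that by (auto simp: mc)
  have im: "?m ` {y \<in> ?D. y \<in> E} = cmap c' ` {q \<in> cdom c'. ?\<Phi> q \<in> E}" for E
  proof (intro equalityI subsetI)
    fix x assume "x \<in> ?m ` {y \<in> ?D. y \<in> E}"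
    then obtain y where "y \<in> ?D" "y \<in> E" "x = cmap c' (\<Psi> y)" by auto
    then show "x \<in> cmap c' ` {q \<in> cdom c'. ?\<Phi> q \<in> E}" using \<Phi>[of y] by auto
  next
    fix x assume "x \<in> cmap c' ` {q \<in> cdom c'. ?\<Phi> q \<in> E}"
    then obtain q where q: "q \<in> cdom c'" "?\<Phi> q \<in> E" "x = cmap c' q" by auto
    then show "x \<in> ?m ` {y \<in> ?D. y \<in> E}"
      using \<Phi>'[of q] c'P by (intro image_eqI[of _ _ "?\<Phi> q"]) auto
  qed
  show "model_chart UNIV ?f"
    using inj im[of UNIV] atlas_open[OF P c'] by (simp add: model_chart_def)
  show "cdom ?f \<subseteq> mcarrier Y" by auto
  fix c assume c: "c \<in> Y"
  let ?cs = "(cdom c \<inter> W, cmap c)"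
  have cs: "?cs \<in> ?Y" using c by (auto simp: sub_atlas_def)
  have csub: "cdom c \<subseteq> mcarrier Y" using c by (auto simp: mcarrier_def)
  note injc = atlas_inj[OF AY c]
  have D1: "cdom c \<inter> ?D = cdom ?cs \<inter> \<Psi> -` cdom c'" using csub by auto
  have cinvs: "cinv ?cs x = cinv c x" if "x \<in> cmap c ` (cdom c \<inter> W)" for x
  proof -
    obtain q where q: "q \<in> cdom c" "q \<in> W" "x = cmap c q" using \<open>x \<in> cmap c ` (cdom c \<inter> W)\<close> by blast
    have "cinv ?cs x = q" using q injc by (intro cinv_eqI) (auto simp: inj_on_def)
    then show ?thesis using q by (simp add: cinv_cmap[OF injc])
  qed
  show "smooth_transition UNIV c ?f"
    unfolding smooth_transition_def
  proof
    have "openin (mtop ?Y) {y \<in> topspace (mtop ?Y). \<Psi> y \<in> cdom c'}"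
      by (rule openin_continuous_map_preimage[OF s1[unfolded smooth_map_def, THEN conjunct1] openin_cdom[OF P c']])
    then have "openin (mtop ?Y) ?D" by (simp add: topspace_atlas[OF AS] mc)
    then have "open (cmap ?cs ` (?D \<inter> cdom ?cs))" using cs unfolding openin_mtop_atlas[OF AS] by blast
    moreover have "?D \<inter> cdom ?cs = cdom c \<inter> ?D" by auto
    ultimately show "openin (top_of_set UNIV) (cmap c ` (cdom c \<inter> cdom ?f))" by simp
    have "smooth_on (cmap ?cs ` (cdom ?cs \<inter> \<Psi> -` cdom c')) (cmap c' \<circ> \<Psi> \<circ> cinv ?cs)"
      using s1 cs c' by (auto simp only: smooth_map_def)
    then show "smooth_on (cmap c ` (cdom c \<inter> cdom ?f)) (cmap ?f \<circ> cinv c)"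
    proof (rule smooth_on_cong_subset)
      show "cmap c ` (cdom c \<inter> cdom ?f) \<subseteq> cmap ?cs ` (cdom ?cs \<inter> \<Psi> -` cdom c')" by auto
      show "(cmap ?f \<circ> cinv c) x = (cmap c' \<circ> \<Psi> \<circ> cinv ?cs) x" if "x \<in> cmap c ` (cdom c \<inter> cdom ?f)" for x
        using cinvs[of x] that by auto
    qed
  qed
  show "smooth_transition UNIV ?f c"
    unfolding smooth_transition_def
  proof
    have e: "cmap ?f ` (cdom ?f \<inter> cdom c) = cmap c' ` (cdom c' \<inter> ?\<Phi> -` cdom ?cs)"
    proof -
      have "cmap ?f ` (cdom ?f \<inter> cdom c) = ?m ` {y \<in> ?D. y \<in> cdom ?cs}" by auto
      also have "\<dots> = cmap c' ` (cdom c' \<inter> ?\<Phi> -` cdom ?cs)" unfolding im by auto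
      finally show ?thesis .
    qed
    have "openin (mtop P) {q \<in> topspace (mtop P). ?\<Phi> q \<in> cdom ?cs}"
      by (rule openin_continuous_map_preimage[OF s2[unfolded smooth_map_def, THEN conjunct1] openin_cdom[OF AS cs]])
    then have "open (cmap c' ` ({q \<in> mcarrier P. ?\<Phi> q \<in> cdom ?cs} \<inter> cdom c'))"
      using c' unfolding topP openin_mtop_atlas[OF P] by blast
    moreover have "{q \<in> mcarrier P. ?\<Phi> q \<in> cdom ?cs} \<inter> cdom c' = cdom c' \<inter> ?\<Phi> -` cdom ?cs" using c'P by auto
    ultimately show "openin (top_of_set UNIV) (cmap ?f ` (cdom ?f \<inter> cdom c))" unfolding e by simp
    have "smooth_on (cmap c' ` (cdom c' \<inter> ?\<Phi> -` cdom ?cs)) (cmap ?cs \<circ> ?\<Phi> \<circ> cinv c')"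
      using s2 cs c' by (auto simp only: smooth_map_def)
    then show "smooth_on (cmap ?f ` (cdom ?f \<inter> cdom c)) (cmap c \<circ> cinv ?f)"
    proof (rule smooth_on_cong_subset)
      show "cmap ?f ` (cdom ?f \<inter> cdom c) \<subseteq> cmap c' ` (cdom c' \<inter> ?\<Phi> -` cdom ?cs)" unfolding e by simp
      fix x assume "x \<in> cmap ?f ` (cdom ?f \<inter> cdom c)"
      then obtain y where y: "y \<in> ?D" "x = cmap c' (\<Psi> y)" by auto
      have "cinv ?f x = y" using y inj by (intro cinv_eqI) auto
      moreover have "cinv c' x = \<Psi> y" using y injc' by (intro cinv_eqI) auto
      ultimately show "(cmap c \<circ> cinv ?f) x = (cmap ?cs \<circ> ?\<Phi> \<circ> cinv c') x"
        using y(1) \<Phi>[of y] by simp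
    qed
  qed
qed

text \<open>A product chart, transported by a local trivialization.\<close>

lemma adapted_chart_exists:
  assumes fb: "fiber_bundle X Y F \<pi>" and y: "y \<in> mcarrier Y"
  obtains g f where "(g, f) \<in> adapted_charts X Y \<pi>" "y \<in> cdom f"
proof -
  have X: "smooth_manifold X" and Y: "smooth_manifold Y" and F: "smooth_manifold F"
    and pi: "smooth_map Y X \<pi>" "\<pi> ` mcarrier Y = mcarrier X"
    using fb by (simp_all only: fiber_bundle_def)
  have triv: "\<forall>x\<in>mcarrier X. \<exists>V \<Psi>. openin (mtop X) V \<and> x \<in> V \<and>
        diffeomorphism (sub_atlas Y (\<pi> -` V)) (prod_atlas (sub_atlas X V) F) \<Psi> \<and>
        (\<forall>y\<in>mcarrier Y \<inter> \<pi> -` V. fst (\<Psi> y) = \<pi> y)"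
    using fb unfolding fiber_bundle_def by (elim conjE)
  have AX: "smooth_atlas UNIV X" and AY: "smooth_atlas UNIV Y" and AF: "smooth_atlas UNIV F"
    using smooth_manifold_on_atlas[OF X] smooth_manifold_on_atlas[OF Y] smooth_manifold_on_atlas[OF F] by simp_all
  have x: "\<pi> y \<in> mcarrier X" using pi(2) y by blast
  obtain V \<Psi> where V: "openin (mtop X) V" "\<pi> y \<in> V"
    and \<Psi>: "diffeomorphism (sub_atlas Y (\<pi> -` V)) (prod_atlas (sub_atlas X V) F) \<Psi>"
    and fst: "\<And>y. y \<in> mcarrier Y \<inter> \<pi> -` V \<Longrightarrow> fst (\<Psi> y) = \<pi> y"
    using triv[rule_format, OF x] by (elim exE conjE) blast
  have VX: "V \<subseteq> mcarrier X" using V(1) openin_subset topspace_atlas[OF AX] by metis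
  have W: "openin (mtop Y) (\<pi> -` V \<inter> mcarrier Y)"
  proof -
    have "openin (mtop Y) {y \<in> topspace (mtop Y). \<pi> y \<in> V}"
      by (rule openin_continuous_map_preimage[OF pi(1)[unfolded smooth_map_def, THEN conjunct1] V(1)])
    moreover have "{y \<in> topspace (mtop Y). \<pi> y \<in> V} = \<pi> -` V \<inter> mcarrier Y"
      by (auto simp: topspace_atlas[OF AY])
    ultimately show ?thesis by simp
  qed
  have P: "smooth_atlas UNIV (prod_atlas (sub_atlas X V) F)"
    using V(1) VX by (intro smooth_atlas_prod smooth_atlas_sub AX AF) (simp add: Int_absorb2)
  have bij: "bij_betw \<Psi> (mcarrier Y \<inter> \<pi> -` V) ((mcarrier X \<inter> V) \<times> mcarrier F)"
    using \<Psi> by (simp add: diffeomorphism_def mcarrier_sub mcarrier_prod)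
  then have "\<Psi> y \<in> (mcarrier X \<inter> V) \<times> mcarrier F" using y V(2) bij_betw_apply[OF bij, of y] by simp
  then have "snd (\<Psi> y) \<in> mcarrier F" by (simp add: mem_Times_iff)
  then obtain h where h: "h \<in> F" "snd (\<Psi> y) \<in> cdom h" by (auto simp: mcarrier_def)
  obtain g where g: "g \<in> X" "\<pi> y \<in> cdom g" using x by (auto simp: mcarrier_def)
  let ?c' = "((cdom g \<inter> V) \<times> cdom h, map_prod (cmap g) (cmap h))"
  have c': "?c' \<in> prod_atlas (sub_atlas X V) F"
  proof -
    have "(cdom g \<inter> V, cmap g) \<in> sub_atlas X V" 
      unfolding sub_atlas_def by (rule image_eqI[OF _ g(1)]) simp
    then show ?thesis
      unfolding prod_atlas_def mem_Collect_eq using h(1)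
      by (intro exI[of _ "(cdom g \<inter> V, cmap g)"] exI[of _ h] conjI) simp_all
  qed
  let ?f = "({y \<in> mcarrier Y \<inter> \<pi> -` V. \<Psi> y \<in> cdom ?c'}, cmap ?c' \<circ> \<Psi>)"
  have f: "?f \<in> Y" by (rule pullback_chart[OF Y W P \<Psi> c'])
  have "(g, ?f) \<in> adapted_charts X Y \<pi>"
  proof -
    have "\<pi> z \<in> cdom g \<and> fst (cmap ?f z) = cmap g (\<pi> z)" if "z \<in> cdom ?f" for z
      using that fst[of z] by (cases "\<Psi> z") auto
    then show ?thesis unfolding adapted_charts_def using g(1) f by blast
  qed
  moreover have "y \<in> cdom ?f" using y V(2) g(2) h(2) fst[of y] by (cases "\<Psi> y") auto
  ultimately show thesis by (rule that)
qed

section \<open>The first jet bundle\<close>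

lemma adaptedD:
  assumes "(g, f) \<in> adapted_charts X Y \<pi>"
  shows "g \<in> X" "f \<in> Y" "y \<in> cdom f \<Longrightarrow> \<pi> y \<in> cdom g" "y \<in> cdom f \<Longrightarrow> fst (cmap f y) = cmap g (\<pi> y)"
  using assms by (auto simp: adapted_charts_def)

lemma tmap_projection:
  assumes X: "smooth_atlas UNIV X" and Y: "smooth_atlas UNIV Y" and gf: "(g, f) \<in> adapted_charts X Y \<pi>"
    and y: "y \<in> cdom f" and w: "w \<in> tspace Y y"
  shows "tmap Y X (mcarrier Y) \<pi> y w = tvec_of X (\<pi> y) g (fst (w f))"
proof -
  note g = adaptedD[OF gf]
  have sub: "mcarrier Y \<inter> cdom f = cdom f" using g(2) by (auto simp: mcarrier_def)
  have o: "open (cmap f ` cdom f)" by (rule atlas_open[OF Y g(2)])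
  have rep: "local_rep (mcarrier Y) \<pi> f g (cmap f ` cdom f) fst"
    unfolding local_rep_def using o g(3,4) by (auto intro: smooth_on_fst)
  have "tmap Y X (mcarrier Y) \<pi> y w = tvec_of X (\<pi> y) g (frechet_derivative fst (at (cmap f y)) (w f))"
    by (rule tmap_local_rep[OF Y g(2) X g(1) _ y _ _ rep w]) (use y sub unique_deriv_open[OF o] in auto)
  moreover have "frechet_derivative fst (at (cmap f y)) = fst"
    using frechet_derivative_at[OF bounded_linear_imp_has_derivative[OF bounded_linear_fst]] by metis
  ultimately show ?thesis by simp
qed

text \<open>The jet over \<open>y\<close> with fiber coordinates \<open>V\<close>.\<close>

definition make_jet ::
  "('x, 'm::finite rvec) chart set \<Rightarrow> ('y, ('m, 'a::finite) bundle_model) chart set \<Rightarrow> ('y \<Rightarrow> 'x) \<Rightarrow>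
   ('x, 'm rvec) chart \<Rightarrow> ('y, ('m, 'a) bundle_model) chart \<Rightarrow> 'y \<Rightarrow> (real^'m^'a) \<Rightarrow> ('x, 'y, 'm, 'a) jet" where
  "make_jet X Y \<pi> g f y V = (y, restrict (\<lambda>v. tvec_of Y y f (v g, V *v v g)) (tspace X (\<pi> y)))"

definition base_coords :: "('m::finite, 'a::finite) jet_model \<Rightarrow> ('m, 'a) bundle_model" where
  "base_coords z = (fst z, fst (snd z))"

lemma smooth_on_base_coords: "smooth_on S base_coords"
  unfolding base_coords_def[abs_def] by (intro smooth_on_Pair smooth_on_fst smooth_on_snd smooth_on_id)

lemma open_base_coords: "open U \<Longrightarrow> open {z. base_coords z \<in> U}"
  using continuous_open_preimage[OF smooth_on_continuous[OF smooth_on_base_coords, of UNIV] open_UNIV]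
  by (simp add: vimage_def)

lemma jet_chart_simps:
  "cdom (jet_chart X Y \<pi> (g, f)) = {p \<in> jet_space X Y \<pi>. fst p \<in> cdom f}"
  "cmap (jet_chart X Y \<pi> (g, f)) (y, \<gamma>) = (fst (cmap f y), snd (cmap f y),
         \<chi> A \<mu>. snd (\<gamma> (tvec_of X (\<pi> y) g (axis \<mu> 1)) f) $ A)"
  by (simp_all add: jet_chart_def)

lemma base_coords_jet_chart: "base_coords (cmap (jet_chart X Y \<pi> (g, f)) p) = cmap f (fst p)"
  by (cases p) (simp add: jet_chart_simps base_coords_def)

text \<open>A jet is a right inverse of the tangent map of the projection, which determines its first
  component; the second one is linear and has the matrix of fiber coordinates.\<close>

lemma jet_eval:
  assumes X: "smooth_atlas UNIV X" and Y: "smooth_atlas UNIV Y" and gf: "(g, f) \<in> adapted_charts X Y \<pi>"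
    and p: "(y, \<gamma>) \<in> jet_space X Y \<pi>" "y \<in> cdom f" and v: "v \<in> tspace X (\<pi> y)"
  shows "\<gamma> v f = (v g, snd (snd (cmap (jet_chart X Y \<pi> (g, f)) (y, \<gamma>))) *v v g)"
proof -
  note g = adaptedD[OF gf]
  note gy = g(3,4)[OF p(2)]
  let ?x = "\<pi> y"
  have \<gamma>: "\<And>v. v \<in> tspace X ?x \<Longrightarrow> \<gamma> v \<in> tspace Y y"
    "\<And>v w a b. v \<in> tspace X ?x \<Longrightarrow> w \<in> tspace X ?x \<Longrightarrow> \<gamma> (lincomb a v b w) = lincomb a (\<gamma> v) b (\<gamma> w)"
    "\<And>v. v \<in> tspace X ?x \<Longrightarrow> tmap Y X (mcarrier Y) \<pi> y (\<gamma> v) = v"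
    using p(1) by (simp_all add: jet_space_def)
  have t: "tvec_of X ?x g u \<in> tspace X ?x" for u by (rule tvec_of_in_tspace[OF X g(1) gy(1)])
  have "tvec_of X ?x g (fst (\<gamma> v f)) = v"
    using tmap_projection[OF X Y gf p(2) \<gamma>(1)[OF v]] \<gamma>(3)[OF v] by simp
  then have 1: "fst (\<gamma> v f) = v g" using tvec_of_self[OF X g(1) gy(1)] by metis
  let ?L = "\<lambda>u. snd (\<gamma> (tvec_of X ?x g u) f)"
  have comb: "?L (a *\<^sub>R u + b *\<^sub>R w) = a *\<^sub>R ?L u + b *\<^sub>R ?L w" for a u b w
    by (simp add: tvec_of_lincomb[OF X g(1) gy(1)] \<gamma>(2)[OF t t]) (simp add: lincomb_def)
  have "linear ?L"
  proof (rule linearI)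
    show "?L (u + w) = ?L u + ?L w" for u w using comb[of 1 u 1 w] by simp
    show "?L (c *\<^sub>R u) = c *\<^sub>R ?L u" for c u using comb[of c u 0 0] by simp
  qed
  then have "?L u = matrix ?L *v u" for u using fun_cong[OF matrix_vector_mul(2), of ?L u] by simp
  moreover have "matrix ?L = snd (snd (cmap (jet_chart X Y \<pi> (g, f)) (y, \<gamma>)))"
    by (simp add: jet_chart_simps matrix_def)
  moreover have "tvec_of X ?x g (v g) = v" using tspace_tvec_of[OF v g(1) gy(1)] by simp
  ultimately have "snd (\<gamma> v f) = snd (snd (cmap (jet_chart X Y \<pi> (g, f)) (y, \<gamma>))) *v v g" by metis
  with 1 show ?thesis by (simp add: prod_eq_iff)
qed

lemma make_jet_in:
  assumes X: "smooth_atlas UNIV X" and Y: "smooth_atlas UNIV Y" and gf: "(g, f) \<in> adapted_charts X Y \<pi>"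
    and y: "y \<in> cdom f"
  shows "make_jet X Y \<pi> g f y V \<in> jet_space X Y \<pi>"
    "cmap (jet_chart X Y \<pi> (g, f)) (make_jet X Y \<pi> g f y V) = (fst (cmap f y), snd (cmap f y), V)"
proof -
  note g = adaptedD[OF gf]
  note gy = g(3,4)[OF y]
  let ?x = "\<pi> y"
  let ?\<gamma> = "\<lambda>v. tvec_of Y y f (v g, V *v v g)"
  have t: "tvec_of X ?x g u \<in> tspace X ?x" for u by (rule tvec_of_in_tspace[OF X g(1) gy(1)])
  have t': "?\<gamma> v \<in> tspace Y y" for v by (rule tvec_of_in_tspace[OF Y g(2) y])
  have s: "?\<gamma> v f = (v g, V *v v g)" for v by (rule tvec_of_self[OF Y g(2) y])
  have lin: "?\<gamma> (lincomb a v b w) = lincomb a (?\<gamma> v) b (?\<gamma> w)" for a v b w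
    unfolding tvec_of_lincomb[OF Y g(2) y, symmetric]
    by (simp add: lincomb_def matrix_vector_right_distrib matrix_vector_mult_scaleR)
  have "tmap Y X (mcarrier Y) \<pi> y (?\<gamma> v) = v" if "v \<in> tspace X ?x" for v
    using tmap_projection[OF X Y gf y t'[of v]] tspace_tvec_of[OF that g(1) gy(1)] by (simp add: s)
  then show "make_jet X Y \<pi> g f y V \<in> jet_space X Y \<pi>"
    using y g(2) t' lin lincomb_in_tspace[OF X] by (auto simp: make_jet_def jet_space_def mcarrier_def)
  have "(\<chi> A \<mu>. snd (?\<gamma> (tvec_of X ?x g (axis \<mu> 1)) f) $ A) = V"
    by (simp add: tvec_of_self[OF Y g(2) y] tvec_of_self[OF X g(1) gy(1)] vec_eq_iff matrix_vector_mult_basis column_def)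
  then show "cmap (jet_chart X Y \<pi> (g, f)) (make_jet X Y \<pi> g f y V) = (fst (cmap f y), snd (cmap f y), V)"
    using t by (simp add: make_jet_def jet_chart_simps)
qed

lemma jet_chart_make_jet:
  assumes X: "smooth_atlas UNIV X" and Y: "smooth_atlas UNIV Y" and gf: "(g, f) \<in> adapted_charts X Y \<pi>"
    and p: "p \<in> cdom (jet_chart X Y \<pi> (g, f))"
  shows "p = make_jet X Y \<pi> g f (fst p) (snd (snd (cmap (jet_chart X Y \<pi> (g, f)) p)))"
proof -
  obtain y \<gamma> where y: "p = (y, \<gamma>)" by (cases p)
  have p': "(y, \<gamma>) \<in> jet_space X Y \<pi>" "y \<in> cdom f" using p by (auto simp: y jet_chart_simps)
  have \<gamma>: "\<gamma> \<in> extensional (tspace X (\<pi> y))" "\<And>v. v \<in> tspace X (\<pi> y) \<Longrightarrow> \<gamma> v \<in> tspace Y y"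
    using p'(1) by (simp_all add: jet_space_def)
  let ?V = "snd (snd (cmap (jet_chart X Y \<pi> (g, f)) p))"
  have "\<gamma> v = tvec_of Y y f (v g, ?V *v v g)" if v: "v \<in> tspace X (\<pi> y)" for v
    using tspace_tvec_of[OF \<gamma>(2)[OF v] adaptedD(2)[OF gf] p'(2)] jet_eval[OF X Y gf p' v] by (simp add: y)
  then have "\<gamma> = restrict (\<lambda>v. tvec_of Y y f (v g, ?V *v v g)) (tspace X (\<pi> y))"
    using \<gamma>(1) by (auto simp: extensional_def restrict_def fun_eq_iff)
  then show ?thesis by (simp add: make_jet_def y)
qed

lemma jet_chart_inj:
  assumes X: "smooth_atlas UNIV X" and Y: "smooth_atlas UNIV Y" and gf: "(g, f) \<in> adapted_charts X Y \<pi>"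
  shows "inj_on (cmap (jet_chart X Y \<pi> (g, f))) (cdom (jet_chart X Y \<pi> (g, f)))"
proof (rule inj_onI)
  let ?c = "jet_chart X Y \<pi> (g, f)"
  fix p q assume p: "p \<in> cdom ?c" and q: "q \<in> cdom ?c" and eq: "cmap ?c p = cmap ?c q"
  have "cmap f (fst p) = cmap f (fst q)" using eq base_coords_jet_chart by metis
  then have "fst p = fst q"
    using p q atlas_inj[OF Y adaptedD(2)[OF gf]] by (auto simp: jet_chart_simps dest: inj_onD)
  then show "p = q" using jet_chart_make_jet[OF X Y gf p] jet_chart_make_jet[OF X Y gf q] eq by metis
qed

lemma jet_chart_image:
  assumes X: "smooth_atlas UNIV X" and Y: "smooth_atlas UNIV Y" and gf: "(g, f) \<in> adapted_charts X Y \<pi>"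
  shows "cmap (jet_chart X Y \<pi> (g, f)) ` {p \<in> jet_space X Y \<pi>. fst p \<in> cdom f \<inter> E} =
     {z. base_coords z \<in> cmap f ` (cdom f \<inter> E)}"
proof (intro equalityI subsetI)
  fix z assume "z \<in> cmap (jet_chart X Y \<pi> (g, f)) ` {p \<in> jet_space X Y \<pi>. fst p \<in> cdom f \<inter> E}"
  then show "z \<in> {z. base_coords z \<in> cmap f ` (cdom f \<inter> E)}" by (auto simp: base_coords_jet_chart)
next
  fix z assume "z \<in> {z. base_coords z \<in> cmap f ` (cdom f \<inter> E)}"
  then obtain y where y: "y \<in> cdom f" "y \<in> E" "base_coords z = cmap f y" by blast
  have "cmap (jet_chart X Y \<pi> (g, f)) (make_jet X Y \<pi> g f y (snd (snd z))) = z"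
    using make_jet_in(2)[OF X Y gf y(1)] y(3) by (simp add: base_coords_def prod_eq_iff)
  moreover have "fst (make_jet X Y \<pi> g f y (snd (snd z))) = y" by (simp add: make_jet_def)
  ultimately show "z \<in> cmap (jet_chart X Y \<pi> (g, f)) ` {p \<in> jet_space X Y \<pi>. fst p \<in> cdom f \<inter> E}"
    using make_jet_in(1)[OF X Y gf y(1)] y by (metis (mono_tags, lifting) IntI image_eqI mem_Collect_eq)
qed

lemma jet_chart_overlap:
  assumes X: "smooth_atlas UNIV X" and Y: "smooth_atlas UNIV Y" and gf: "(g, f) \<in> adapted_charts X Y \<pi>"
  shows "cmap (jet_chart X Y \<pi> (g, f)) ` (cdom (jet_chart X Y \<pi> (g, f)) \<inter> cdom (jet_chart X Y \<pi> (g', f'))) =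
     {z. base_coords z \<in> cmap f ` (cdom f \<inter> cdom f')}"
proof -
  have "cdom (jet_chart X Y \<pi> (g, f)) \<inter> cdom (jet_chart X Y \<pi> (g', f')) = {p \<in> jet_space X Y \<pi>. fst p \<in> cdom f \<inter> cdom f'}"
    by (auto simp: jet_chart_simps)
  then show ?thesis using jet_chart_image[OF X Y gf] by simp
qed

lemma transition_deriv_at:
  assumes "smooth_atlas UNIV A" "c \<in> A" "c' \<in> A" "p \<in> cdom c" "p \<in> cdom c'"
  shows "transition_deriv c c' p = frechet_derivative (cmap c' \<circ> cinv c) (at (cmap c p))"
  unfolding transition_deriv_def
  using at_within_open[OF _ atlas_overlap_open[OF assms(1-3)], of "cmap c p"] assms(4,5) by simp

text \<open>With \<open>\<theta>\<close> the transition map of \<open>Y\<close> and \<open>w\<close> the old components of the new coordinate vector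
  \<open>\<partial>\<^sub>\<mu>\<close> of \<open>X\<close>, the new fiber coordinates are the fiber part of \<open>D\<theta> (w, V w)\<close>.\<close>

lemma jet_transition_smooth:
  fixes X :: "('x, 'm::finite rvec) chart set" and Y :: "('y, ('m, 'a::finite) bundle_model) chart set"
  assumes X: "smooth_atlas UNIV X" and Y: "smooth_atlas UNIV Y"
    and gf: "(g, f) \<in> adapted_charts X Y \<pi>" and gf': "(g', f') \<in> adapted_charts X Y \<pi>"
  shows "smooth_on {z. base_coords z \<in> cmap f ` (cdom f \<inter> cdom f')}
    (cmap (jet_chart X Y \<pi> (g', f')) \<circ> cinv (jet_chart X Y \<pi> (g, f)))"
proof -
  let ?S = "{z. base_coords z \<in> cmap f ` (cdom f \<inter> cdom f')} :: ('m, 'a) jet_model set"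
  note g = adaptedD[OF gf] note g' = adaptedD[OF gf']
  let ?\<theta> = "cmap f' \<circ> cinv f" and ?\<tau> = "cmap g \<circ> cinv g'"
  note injf = atlas_inj[OF Y g(2)] and injc = jet_chart_inj[OF X Y gf]
  have \<theta>: "smooth_on (cmap f ` (cdom f \<inter> cdom f')) ?\<theta>" by (rule atlas_transition_smooth[OF Y g(2) g'(2)])
  have \<tau>: "smooth_on (cmap g' ` (cdom g' \<inter> cdom g)) ?\<tau>" by (rule atlas_transition_smooth[OF X g'(1) g(1)])
  define w where "w \<mu> z = frechet_derivative ?\<tau> (at (fst (?\<theta> (base_coords z)))) (axis \<mu> 1)" for \<mu> and z :: "('m, 'a) jet_model"
  define d where "d \<mu> z = frechet_derivative ?\<theta> (at (base_coords z)) (w \<mu> z, snd (snd z) *v w \<mu> z)" for \<mu> and z :: "('m, 'a) jet_model"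
  have fst\<theta>: "fst (?\<theta> (base_coords z)) \<in> cmap g' ` (cdom g' \<inter> cdom g)" if z: "z \<in> ?S" for z
  proof -
    obtain y where y: "y \<in> cdom f" "y \<in> cdom f'" "base_coords z = cmap f y" using z by blast
    then show ?thesis using g(3)[of y] g'(3,4)[of y] by (auto simp: cinv_cmap[OF injf])
  qed
  have sb: "smooth_on ?S (\<lambda>z. ?\<theta> (base_coords z))"
    by (rule smooth_on_compose[OF smooth_on_base_coords \<theta>]) auto
  have sw: "smooth_on ?S (w \<mu>)" for \<mu>
    unfolding w_def
    by (rule smooth_on_frechet_compose[OF \<tau> atlas_overlap_open[OF X g'(1) g(1)] smooth_on_fst[OF sb] _ smooth_on_const])
       (rule image_subsetI[OF fst\<theta>])
  have sVw: "smooth_on ?S (\<lambda>z. snd (snd z) *v w \<mu> z)" for \<mu>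
    unfolding matrix_vector_mult_def
    by (intro smooth_on_vec_lambda smooth_on_sum smooth_on_mult smooth_on_nth smooth_on_snd smooth_on_id sw)
  have sd: "smooth_on ?S (d \<mu>)" for \<mu>
    unfolding d_def
    by (rule smooth_on_frechet_compose[OF \<theta> atlas_overlap_open[OF Y g(2) g'(2)] smooth_on_base_coords _ smooth_on_Pair[OF sw sVw]])
       auto
  have "smooth_on ?S (\<lambda>z. (fst (?\<theta> (base_coords z)), snd (?\<theta> (base_coords z)), \<chi> A \<mu>. snd (d \<mu> z) $ A))"
    by (intro smooth_on_Pair smooth_on_fst[OF sb] smooth_on_snd[OF sb] smooth_on_vec_lambda smooth_on_nth smooth_on_snd[OF sd])
  then show ?thesis
  proof (rule smooth_on_cong)
    fix z assume z: "z \<in> ?S"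
    then obtain y where y: "y \<in> cdom f" "y \<in> cdom f'" "base_coords z = cmap f y" by blast
    note gy = g(3,4)[OF y(1)] and gy' = g'(3,4)[OF y(2)]
    define p where "p = cinv (jet_chart X Y \<pi> (g, f)) z"
    have "z \<in> cmap (jet_chart X Y \<pi> (g, f)) ` cdom (jet_chart X Y \<pi> (g, f))"
      using jet_chart_overlap[OF X Y gf, of g' f'] z by blast
    then have p: "p \<in> cdom (jet_chart X Y \<pi> (g, f))" "cmap (jet_chart X Y \<pi> (g, f)) p = z"
      unfolding p_def by (rule cinv_in, rule cmap_cinv)
    have "cmap f (fst p) = cmap f y" using base_coords_jet_chart[of X Y \<pi> g f p] p(2) y(3) by simp
    then have "fst p = y" using p(1) y(1) injf by (auto simp: jet_chart_simps dest: inj_onD)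
    then obtain \<gamma> where p\<gamma>: "p = (y, \<gamma>)" by (cases p) simp
    have pj: "(y, \<gamma>) \<in> jet_space X Y \<pi>" using p(1) by (simp add: jet_chart_simps p\<gamma>)
    have "\<gamma> (tvec_of X (\<pi> y) g' (axis \<mu> 1)) f' = d \<mu> z" for \<mu>
    proof -
      let ?v = "tvec_of X (\<pi> y) g' (axis \<mu> 1)"
      have v: "?v \<in> tspace X (\<pi> y)" by (rule tvec_of_in_tspace[OF X g'(1) gy'(1)])
      have \<theta>z: "?\<theta> (base_coords z) = cmap f' y" using y by (simp add: cinv_cmap[OF injf])
      have vg: "?v g = w \<mu> z"
        unfolding w_def \<theta>z gy'(2)
        using transition_deriv_at[OF X g'(1) g(1) gy'(1) gy(1)] g(1) gy(1) by (simp add: tvec_of_def)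
      have "\<gamma> ?v \<in> tspace Y y" using pj v by (simp add: jet_space_def)
      then have "\<gamma> ?v f' = transition_deriv f f' y (\<gamma> ?v f)"
        by (rule tspace_component[OF _ g(2) g'(2) y(1,2)])
      then show ?thesis
        using jet_eval[OF X Y gf pj y(1) v] p(2) transition_deriv_at[OF Y g(2) g'(2) y(1,2)] y(3)
        by (simp add: vg p\<gamma> d_def)
    qed
    then show "(cmap (jet_chart X Y \<pi> (g', f')) \<circ> cinv (jet_chart X Y \<pi> (g, f))) z =
       (fst (?\<theta> (base_coords z)), snd (?\<theta> (base_coords z)), \<chi> A \<mu>. snd (d \<mu> z) $ A)"
      using y by (simp add: p_def[symmetric] p\<gamma> jet_chart_simps cinv_cmap[OF injf])
  qed
qed

lemma smooth_atlas_jet: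
  assumes X: "smooth_atlas UNIV X" and Y: "smooth_atlas UNIV Y"
  shows "smooth_atlas UNIV (jet_atlas X Y \<pi>)"
  unfolding smooth_atlas_def
proof (intro conjI ballI full_model_UNIV)
  have o: "open {z. base_coords z \<in> cmap f ` (cdom f \<inter> cdom f')}"
    if "(g, f) \<in> adapted_charts X Y \<pi>" "(g', f') \<in> adapted_charts X Y \<pi>" for g f g' f'
    by (rule open_base_coords[OF atlas_overlap_open[OF Y adaptedD(2)[OF that(1)] adaptedD(2)[OF that(2)]]])
  {
    fix c assume "c \<in> jet_atlas X Y \<pi>"
    then obtain g f where c: "(g, f) \<in> adapted_charts X Y \<pi>" "c = jet_chart X Y \<pi> (g, f)" by (auto simp: jet_atlas_def)
    show "model_chart UNIV c"
      using jet_chart_inj[OF X Y c(1)] jet_chart_overlap[OF X Y c(1), of g f] o[OF c(1) c(1)]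
      by (simp add: model_chart_def c(2))
  }
  fix c c' assume "c \<in> jet_atlas X Y \<pi>" "c' \<in> jet_atlas X Y \<pi>"
  then obtain g f g' f' where c: "(g, f) \<in> adapted_charts X Y \<pi>" "c = jet_chart X Y \<pi> (g, f)"
    and c': "(g', f') \<in> adapted_charts X Y \<pi>" "c' = jet_chart X Y \<pi> (g', f')" by (auto simp: jet_atlas_def)
  show "smooth_transition UNIV c c'"
    using o[OF c(1) c'(1)] jet_transition_smooth[OF X Y c(1) c'(1)] jet_chart_overlap[OF X Y c(1), of g' f']
    by (simp add: smooth_transition_def c(2) c'(2))
qed

lemma jet_chart_in_atlas: "(g, f) \<in> adapted_charts X Y \<pi> \<Longrightarrow> jet_chart X Y \<pi> (g, f) \<in> jet_atlas X Y \<pi>"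
  by (simp add: jet_atlas_def)

lemma mcarrier_jet:
  assumes "fiber_bundle X Y F \<pi>" shows "mcarrier (jet_atlas X Y \<pi>) = jet_space X Y \<pi>"
proof (intro equalityI subsetI)
  fix p assume "p \<in> mcarrier (jet_atlas X Y \<pi>)"
  then obtain g f where "p \<in> cdom (jet_chart X Y \<pi> (g, f))" by (auto simp: mcarrier_def jet_atlas_def)
  then show "p \<in> jet_space X Y \<pi>" by (simp add: jet_chart_simps)
next
  fix p assume p: "p \<in> jet_space X Y \<pi>"
  then have "fst p \<in> mcarrier Y" by (auto simp: jet_space_def)
  then obtain g f where gf: "(g, f) \<in> adapted_charts X Y \<pi>" "fst p \<in> cdom f" using adapted_chart_exists[OF assms] by metis
  then have "p \<in> cdom (jet_chart X Y \<pi> (g, f))" using p by (simp add: jet_chart_simps)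
  then show "p \<in> mcarrier (jet_atlas X Y \<pi>)"
    unfolding mcarrier_def using jet_chart_in_atlas[OF gf(1)] by blast
qed

section \<open>Vector fields with a prescribed value\<close>

text \<open>The image of a compact set under the inverse of a chart is compact, hence closed in a Hausdorff
  space.\<close>

lemma chart_ball_closed:
  assumes A: "smooth_atlas UNIV A" and h: "Hausdorff_space (mtop A)" and c: "c \<in> A"
    and B: "compact B" "B \<subseteq> cmap c ` cdom c"
  shows "openin (mtop A) (mcarrier A - cinv c ` B)"
proof -
  note inj = atlas_inj[OF A c]
  have top: "topspace (mtop A) = mcarrier A" by (rule topspace_atlas[OF A])
  have sub: "cdom c \<subseteq> mcarrier A" using c by (auto simp: mcarrier_def)
  have "continuous_map (top_of_set (cmap c ` cdom c)) (mtop A) (cinv c)"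
    unfolding continuous_map_def
  proof (intro conjI allI impI)
    show "cinv c \<in> topspace (top_of_set (cmap c ` cdom c)) \<rightarrow> topspace (mtop A)"
    proof
      fix x assume "x \<in> topspace (top_of_set (cmap c ` cdom c))"
      then have "x \<in> cmap c ` cdom c" by simp
      from cinv_in[OF this] sub show "cinv c x \<in> topspace (mtop A)" by (auto simp: top)
    qed
    fix U assume U: "openin (mtop A) U"
    have "{x \<in> topspace (top_of_set (cmap c ` cdom c)). cinv c x \<in> U} = cmap c ` (U \<inter> cdom c)"
      by (auto simp: cinv_cmap[OF inj])
    moreover have "open (cmap c ` (U \<inter> cdom c))" using U c unfolding openin_mtop_atlas[OF A] by blast
    ultimately show "openin (top_of_set (cmap c ` cdom c)) {x \<in> topspace (top_of_set (cmap c ` cdom c)). cinv c x \<in> U}"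
      by (auto intro!: open_subset)
  qed
  moreover have "compactin (top_of_set (cmap c ` cdom c)) B"
    using B by (simp add: compactin_subtopology)
  ultimately have "compactin (mtop A) (cinv c ` B)" by (rule image_compactin[rotated])
  then have "closedin (mtop A) (cinv c ` B)" by (rule compactin_imp_closedin[OF h])
  then show ?thesis by (simp add: closedin_def top)
qed

text \<open>The bump function depends on the point of \<open>Y\<close> only. Since a jet chart contains the whole
  fibers over its base, a function with support in the domain of a chart of \<open>Y\<close> cuts off a
  vector field on the jet bundle.\<close>

lemma vector_field_extension:
  assumes fb: "fiber_bundle X Y F \<pi>" and gf: "(g, f) \<in> adapted_charts X Y \<pi>"
    and q: "q \<in> jet_space X Y \<pi>" "fst q \<in> cdom f"
  obtains W where "smooth_vector_field (jet_atlas X Y \<pi>) W"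
    "W q = tvec_of (jet_atlas X Y \<pi>) q (jet_chart X Y \<pi> (g, f)) u"
proof -
  have "smooth_manifold X" and MY: "smooth_manifold Y" using fb by (simp_all only: fiber_bundle_def)
  then have X: "smooth_atlas UNIV X" and Y: "smooth_atlas UNIV Y" using smooth_manifold_on_atlas full_model_UNIV by blast+
  have haus: "Hausdorff_space (mtop Y)" using MY by (simp only: smooth_manifold_on_def)
  let ?J = "jet_atlas X Y \<pi>" and ?c = "jet_chart X Y \<pi> (g, f)"
  note J = smooth_atlas_jet[OF X Y, of \<pi>]
  note f = adaptedD(2)[OF gf] and cJ = jet_chart_in_atlas[OF gf]
  note injf = atlas_inj[OF Y f]
  let ?z = "cmap f (fst q)"
  obtain r where r: "r > 0" "cball ?z r \<subseteq> cmap f ` cdom f"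
    using atlas_open[OF Y f] q(2) open_contains_cball by blast
  obtain \<beta> :: "_ \<Rightarrow> real" where \<beta>: "smooth_on UNIV \<beta>" "\<beta> ?z = 1" "\<And>z. z \<notin> cball ?z r \<Longrightarrow> \<beta> z = 0"
    using bump_exists[OF r(1)] by blast
  \<comment> \<open>A linear combination with second coefficient \<open>0\<close> serves as the scalar multiple of a tangent vector.\<close>
  define W where "W p = (if p \<in> cdom ?c then lincomb (\<beta> (cmap f (fst p))) (tvec_of ?J p ?c u) 0 (tvec_of ?J p ?c u) else (\<lambda>_. 0))" for p
  have Wt: "W p \<in> tspace ?J p" if "p \<in> mcarrier ?J" for p
  proof (cases "p \<in> cdom ?c")
    case True
    then show ?thesis using lincomb_in_tspace[OF J] tvec_of_in_tspace[OF J cJ True] by (simp add: W_def)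
  next
    case False
    have "(\<lambda>_. 0) \<in> tspace ?J p"
      unfolding tspace_def mem_Collect_eq
    proof (intro conjI ballI impI allI refl)
      fix c c' assume "c \<in> ?J" "c' \<in> ?J" "p \<in> cdom c \<inter> cdom c'"
      then have "linear (transition_deriv c c' p)" using transition_deriv_linear[OF J] by blast
      then show "0 = transition_deriv c c' p 0" by (simp add: linear_0)
    qed
    then show ?thesis using False by (simp add: W_def)
  qed
  have Ws: "smooth_on (cmap c ` cdom c) (\<lambda>x. W (cinv c x) c)" if "c \<in> ?J" for c
  proof (rule smooth_onI)
    obtain g' f' where gf': "(g', f') \<in> adapted_charts X Y \<pi>" and c: "c = jet_chart X Y \<pi> (g', f')"
      using \<open>c \<in> ?J\<close> by (auto simp: jet_atlas_def)
    note f' = adaptedD(2)[OF gf'] and cJ' = \<open>c \<in> ?J\<close>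
    note injf' = atlas_inj[OF Y f'] and injc = atlas_inj[OF J cJ']
    fix z assume "z \<in> cmap c ` cdom c"
    then obtain p where p: "p \<in> cdom c" "z = cmap c p" by blast
    show "\<exists>N h. open N \<and> z \<in> N \<and> smooth_on N h \<and> (\<forall>x\<in>cmap c ` cdom c \<inter> N. h x = W (cinv c x) c)"
    proof (cases "p \<in> cdom ?c")
      case True
      let ?N = "cmap c ` (cdom c \<inter> cdom ?c)"
      let ?\<tau> = "cmap ?c \<circ> cinv c"
      let ?h = "\<lambda>x. \<beta> (base_coords (?\<tau> x)) *\<^sub>R frechet_derivative (cmap c \<circ> cinv ?c) (at (?\<tau> x)) u"
      have N: "open ?N" by (rule atlas_overlap_open[OF J cJ' cJ])
      have \<tau>: "smooth_on ?N ?\<tau>" by (rule atlas_transition_smooth[OF J cJ' cJ])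
      have im: "?\<tau> ` ?N \<subseteq> cmap ?c ` (cdom ?c \<inter> cdom c)" by (auto simp: cinv_cmap[OF injc])
      have "smooth_on ?N ?h"
        by (intro smooth_on_scaleR smooth_on_compose[OF smooth_on_compose[OF \<tau> smooth_on_base_coords] \<beta>(1)]
            smooth_on_frechet_compose[OF atlas_transition_smooth[OF J cJ cJ'] atlas_overlap_open[OF J cJ cJ'] \<tau> im] smooth_on_const) auto
      moreover have "?h x = W (cinv c x) c" if "x \<in> cmap c ` cdom c \<inter> ?N" for x
      proof -
        obtain p' where p': "p' \<in> cdom c" "p' \<in> cdom ?c" "x = cmap c p'" using \<open>x \<in> cmap c ` cdom c \<inter> ?N\<close> by blast
        then show ?thesis
          using cJ' transition_deriv_at[OF J cJ cJ' p'(2,1)]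
          by (simp add: W_def cinv_cmap[OF injc] base_coords_jet_chart lincomb_def tvec_of_def)
      qed
      moreover have "z \<in> ?N" using True p by blast
      ultimately show ?thesis using N by (intro exI[of _ ?N] exI[of _ ?h]) simp
    next
      case False
      \<comment> \<open>Off the chart domain the field vanishes near \<open>p\<close>, because the support of \<open>\<beta>\<close> is closed in \<open>Y\<close>.\<close>
      let ?O = "mcarrier Y - cinv f ` cball ?z r"
      let ?N = "{z. base_coords z \<in> cmap f' ` (?O \<inter> cdom f')}"
      have "openin (mtop Y) ?O" by (rule chart_ball_closed[OF Y haus f compact_cball r(2)])
      then have "open (cmap f' ` (?O \<inter> cdom f'))" using f' unfolding openin_mtop_atlas[OF Y] by blast
      then have N: "open ?N" by (rule open_base_coords)
      have p': "p \<in> jet_space X Y \<pi>" "fst p \<in> cdom f'" using p(1) by (simp_all add: c jet_chart_simps)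
      have "fst p \<notin> cdom f" using False p'(1) by (simp add: jet_chart_simps)
      moreover have "cinv f ` cball ?z r \<subseteq> cdom f"
      proof (rule image_subsetI)
        show "cinv f x \<in> cdom f" if "x \<in> cball ?z r" for x by (rule cinv_in) (use r(2) that in blast)
      qed
      moreover have "fst p \<in> mcarrier Y" using p'(1) by (auto simp: jet_space_def)
      ultimately have "z \<in> ?N" using p(2) p'(2) by (auto simp: c base_coords_jet_chart)
      moreover have "W (cinv c x) c = 0" if "x \<in> cmap c ` cdom c \<inter> ?N" for x
      proof (cases "cinv c x \<in> cdom ?c")
        case True
        obtain p'' where p'': "p'' \<in> cdom c" "x = cmap c p''" using \<open>x \<in> cmap c ` cdom c \<inter> ?N\<close> by blast
        then have cx: "cinv c x = p''" by (simp add: cinv_cmap[OF injc])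
        have "base_coords x = cmap f' (fst p'')" by (simp add: p''(2) c base_coords_jet_chart)
        moreover have "fst p'' \<in> cdom f'" using p''(1) by (simp add: c jet_chart_simps)
        ultimately have "fst p'' \<in> ?O" using that injf' by (auto dest: inj_onD)
        moreover have "fst p'' \<in> cdom f" using True by (simp add: cx jet_chart_simps)
        ultimately have "cmap f (fst p'') \<notin> cball ?z r"
          using cinv_cmap[OF injf, of "fst p''"] by (metis DiffD2 image_eqI)
        then show ?thesis using \<beta>(3) by (simp add: W_def cx lincomb_def)
      qed (simp add: W_def)
      ultimately show ?thesis using N by (intro exI[of _ ?N] exI[of _ "\<lambda>_. 0"]) simp
    qed
  qed
  have "smooth_vector_field ?J W" using Wt Ws by (simp add: smooth_vector_field_def)
  moreover have "W q = tvec_of ?J q ?c u"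
    using q \<beta>(2) by (simp add: W_def jet_chart_simps lincomb_def)
  ultimately show thesis by (rule that)
qed

section \<open>Sections over embedded domains with corners\<close>

lemma chart_preimage_openin:
  assumes A: "smooth_atlas H A" and c: "c \<in> A" and N: "open N"
  shows "openin (mtop A) {q \<in> cdom c. cmap c q \<in> N}"
  unfolding openin_mtop_charts[OF A]
proof (intro conjI ballI)
  show "{q \<in> cdom c. cmap c q \<in> N} \<subseteq> mcarrier A" using c by (auto simp: mcarrier_def)
  fix c' assume c': "c' \<in> A"
  let ?O = "cmap c' ` (cdom c' \<inter> cdom c)"
  note inj = atlas_inj[OF A c']
  have "openin (top_of_set ?O) (?O \<inter> (cmap c \<circ> cinv c') -` N)"
    by (rule continuous_openin_preimage_gen[OF smooth_on_continuous[OF atlas_transition_smooth[OF A c' c]] N])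
  moreover have "openin (top_of_set (cmap c' ` cdom c')) ?O"
    by (rule openin_subset_trans[OF atlas_overlap_openin[OF A c' c]])
       (use openin_imp_subset[OF atlas_openin[OF A c']] in auto)
  ultimately have "openin (top_of_set (cmap c' ` cdom c')) (?O \<inter> (cmap c \<circ> cinv c') -` N)"
    by (rule openin_trans)
  moreover have "?O \<inter> (cmap c \<circ> cinv c') -` N = cmap c' ` ({q \<in> cdom c. cmap c q \<in> N} \<inter> cdom c')"
    by (auto simp: cinv_cmap[OF inj])
  ultimately show "openin (top_of_set (cmap c' ` cdom c')) (cmap c' ` ({q \<in> cdom c. cmap c q \<in> N} \<inter> cdom c'))"
    by simp
qed

lemma smooth_map_local_rep:
  assumes A: "smooth_atlas H A" and B: "smooth_atlas UNIV B" and f: "smooth_map A B f"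
    and c: "c \<in> A" "c' \<in> B" and p: "p \<in> cdom c" "f p \<in> cdom c'"
  obtains N h where "cmap c p \<in> N" "local_rep (mcarrier A) f c c' N h"
proof -
  note inj = atlas_inj[OF A c(1)]
  let ?O = "cmap c ` (cdom c \<inter> f -` cdom c')"
  have top: "topspace (mtop A) = mcarrier A" by (rule topspace_atlas[OF A])
  have "openin (mtop A) {q \<in> topspace (mtop A). f q \<in> cdom c'}"
    by (rule openin_continuous_map_preimage[OF f[unfolded smooth_map_def, THEN conjunct1] openin_cdom[OF B c(2)]])
  then have "openin (top_of_set (cmap c ` cdom c)) (cmap c ` ({q \<in> mcarrier A. f q \<in> cdom c'} \<inter> cdom c))"
    using c(1) unfolding top openin_mtop_charts[OF A] by blast
  moreover have "{q \<in> mcarrier A. f q \<in> cdom c'} \<inter> cdom c = cdom c \<inter> f -` cdom c'"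
    using c(1) by (auto simp: mcarrier_def)
  ultimately obtain M where M: "open M" "?O = cmap c ` cdom c \<inter> M" unfolding openin_open by auto
  have s: "smooth_on ?O (cmap c' \<circ> f \<circ> cinv c)" using f c unfolding smooth_map_def by blast
  have "cmap c p \<in> ?O" using p by blast
  from smooth_onE[OF s this] obtain N h where N: "open N" "cmap c p \<in> N" "smooth_on N h"
    "\<And>z. z \<in> ?O \<Longrightarrow> z \<in> N \<Longrightarrow> h z = (cmap c' \<circ> f \<circ> cinv c) z" by metis
  show thesis
  proof
    show "cmap c p \<in> N \<inter> M" using N(2) M(2) p by blast
    show "local_rep (mcarrier A) f c c' (N \<inter> M) h"
      unfolding local_rep_def
    proof (intro conjI ballI impI)
      show "open (N \<inter> M)" using N(1) M(1) by (rule open_Int)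
      show "smooth_on (N \<inter> M) h" using N(3) by (rule smooth_on_subset) blast
      fix q assume q: "q \<in> mcarrier A \<inter> cdom c" "cmap c q \<in> N \<inter> M"
      then have z: "cmap c q \<in> ?O" using M(2) by blast
      then obtain r where "r \<in> cdom c" "f r \<in> cdom c'" "cmap c q = cmap c r" by auto
      then show "f q \<in> cdom c'" using q(1) inj by (metis IntE inj_onD)
      show "h (cmap c q) = cmap c' (f q)" using N(4)[OF z] q by (simp add: cinv_cmap[OF inj])
    qed
  qed
qed

lemma local_repD:
  assumes "local_rep S f c c' N h"
  shows "open N" "smooth_on N h" "q \<in> S \<Longrightarrow> q \<in> cdom c \<Longrightarrow> cmap c q \<in> N \<Longrightarrow> f q \<in> cdom c'"
    "q \<in> S \<Longrightarrow> q \<in> cdom c \<Longrightarrow> cmap c q \<in> N \<Longrightarrow> h (cmap c q) = cmap c' (f q)"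
  using assms by (auto simp: local_rep_def)

text \<open>The extended coordinate expression \<open>E\<close> of the embedding has the tangent map of the embedding as
  its derivative, which is injective and hence, the dimensions being equal, bijective. The inverse
  function theorem provides the local inverse \<open>G\<close>.\<close>

lemma embedding_local_diffeomorphism:
  fixes U :: "('u, 'm::finite rvec) chart set" and X :: "('x, 'm rvec) chart set"
  assumes U: "smooth_atlas H U" and X: "smooth_atlas UNIV X" and emb: "smooth_embedding U X \<psi>"
    and u: "u \<in> mcarrier U" and c: "c \<in> X" "\<psi> u \<in> cdom c"
  obtains b N V E G where "b \<in> U" "u \<in> cdom b" "cmap b u \<in> N" "local_rep (mcarrier U) \<psi> b c N E"
    "surj (frechet_derivative E (at (cmap b u)))" "open V" "E ` N = V" "smooth_on V G" "\<And>z. z \<in> N \<Longrightarrow> G (E z) = z"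
proof -
  have sm: "smooth_map U X \<psi>" and tinj: "inj_on (tmap U X (mcarrier U) \<psi> u) (tspace U u)"
    using emb u by (auto simp: smooth_embedding_def)
  define b where "b = chart_at U u"
  define c1 where "c1 = chart_at X (\<psi> u)"
  have b: "b \<in> U" "u \<in> cdom b" using chart_at[OF u] by (simp_all add: b_def)
  have c1: "c1 \<in> X" "\<psi> u \<in> cdom c1"
    using chart_at[of "\<psi> u" X] c by (auto simp: c1_def mcarrier_def)
  note injb = atlas_inj[OF U b(1)] and injc = atlas_inj[OF X c(1)]
  obtain N E where N: "cmap b u \<in> N" and rep: "local_rep (mcarrier U) \<psi> b c N E"
    by (rule smooth_map_local_rep[OF U X sm b(1) c(1) b(2) c(2)])
  note E = local_repD[OF rep]
  let ?D = "frechet_derivative E (at (cmap b u))"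
  have D: "(E has_derivative ?D) (at (cmap b u))" by (rule smooth_on_has_derivative[OF E(2,1) N])
  have Eu: "E (cmap b u) = cmap c (\<psi> u)" by (rule E(4)[OF u b(2) N])
  have sub: "mcarrier U \<inter> cdom b = cdom b" using b(1) by (auto simp: mcarrier_def)
  have tm: "tmap U X (mcarrier U) \<psi> u v = tvec_of X (\<psi> u) c (?D (v b))" for v
  proof -
    let ?T = "cmap b ` cdom b"
    have d: "(cmap c1 \<circ> cinv c has_derivative transition_deriv c c1 (\<psi> u)) (at (E (cmap b u)))"
      unfolding Eu by (rule transition_has_derivative_at[OF X c(1) c1(1) c(2) c1(2)])
    have "((\<lambda>x. (cmap c1 \<circ> cinv c) (E x)) has_derivative (\<lambda>a. transition_deriv c c1 (\<psi> u) (?D a))) (at (cmap b u) within ?T \<inter> N)"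
      by (rule has_derivative_at_withinI[OF has_derivative_compose[OF D d]])
    then have "(cmap c1 \<circ> \<psi> \<circ> cinv b has_derivative (\<lambda>a. transition_deriv c c1 (\<psi> u) (?D a))) (at (cmap b u) within ?T \<inter> N)"
    proof (rule has_derivative_transform[rotated 2])
      show "cmap b u \<in> ?T \<inter> N" using b(2) N by blast
      fix x assume "x \<in> ?T \<inter> N"
      then obtain q where q: "q \<in> cdom b" "x = cmap b q" "cmap b q \<in> N" by blast
      then have "q \<in> mcarrier U" using sub by blast
      then show "(cmap c1 \<circ> \<psi> \<circ> cinv b) x = (cmap c1 \<circ> cinv c) (E x)"
        using E(3,4)[of q] q by (simp add: cinv_cmap[OF injb] cinv_cmap[OF injc])
    qed
    then have "(cmap c1 \<circ> \<psi> \<circ> cinv b has_derivative (\<lambda>a. transition_deriv c c1 (\<psi> u) (?D a))) (at (cmap b u) within ?T)"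
      by (simp add: at_within_Int_open[OF E(1) N])
    moreover have "unique_deriv ?T (cmap b u)"
      by (rule atlas_unique[OF U atlas_openin[OF U b(1)]]) (use b(2) in blast)
    ultimately have "frechet_derivative (cmap c1 \<circ> \<psi> \<circ> cinv b) (at (cmap b u) within ?T) = (\<lambda>a. transition_deriv c c1 (\<psi> u) (?D a))"
      by (intro unique_deriv_frechet)
    then show ?thesis
      by (simp add: tmap_def Let_def b_def[symmetric] c1_def[symmetric] sub tvec_of_change[OF X c(1) c1(1) c(2) c1(2)])
  qed
  have inj: "inj ?D"
  proof (rule injI)
    fix a a' assume eq: "?D a = ?D a'"
    let ?v = "tvec_of U u b"
    have "tmap U X (mcarrier U) \<psi> u (?v a) = tmap U X (mcarrier U) \<psi> u (?v a')"
      by (simp add: tm tvec_of_self[OF U b] eq)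
    then have "?v a = ?v a'"
      using tinj tvec_of_in_tspace[OF U b] by (auto dest: inj_onD)
    then show "a = a'" using tvec_of_self[OF U b] by metis
  qed
  have surj: "surj ?D"
    by (rule linear_inj_imp_surj[OF has_derivative_linear[OF D] inj])
  obtain N' V G where N': "open N'" "cmap b u \<in> N'" "N' \<subseteq> N" "open V" "E ` N' = V" "smooth_on V G"
    "\<And>z. z \<in> N' \<Longrightarrow> G (E z) = z"
    using smooth_local_inverse[OF E(2,1) N inj] by metis
  have "local_rep (mcarrier U) \<psi> b c N' E"
    using rep N'(1,3) smooth_on_subset[OF E(2) N'(3)] unfolding local_rep_def by blast
  then show thesis using b N' surj by (intro that[of b N' E V G])
qed

text \<open>In the parameter domain, a relatively open part of the orthant, derivatives are unique, and a
  local diffeomorphism preserves this.\<close>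

lemma embedding_unique_deriv:
  fixes U :: "('u, 'm::finite rvec) chart set" and X :: "('x, 'm rvec) chart set"
  assumes U: "smooth_atlas H U" and X: "smooth_atlas UNIV X" and emb: "smooth_embedding U X \<psi>"
  shows "unique_deriv_set X (\<psi> ` mcarrier U)"
  unfolding unique_deriv_set_def
proof (intro ballI impI)
  fix p c assume "p \<in> \<psi> ` mcarrier U" and c: "c \<in> X" "p \<in> cdom c"
  then obtain u where u: "u \<in> mcarrier U" "p = \<psi> u" by blast
  obtain b N V E G where b: "b \<in> U" "u \<in> cdom b" "cmap b u \<in> N" "local_rep (mcarrier U) \<psi> b c N E"
    "surj (frechet_derivative E (at (cmap b u)))"
    using embedding_local_diffeomorphism[OF U X emb u(1) c(1)] c(2) u(2) by metis
  note E = local_repD[OF b(4)]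
  let ?R = "cmap b ` cdom b \<inter> N"
  have "unique_deriv (cmap b ` cdom b) (cmap b u)"
    by (rule atlas_unique[OF U atlas_openin[OF U b(1)]]) (use b(2) in blast)
  then have R: "unique_deriv ?R (cmap b u)" by (simp add: unique_deriv_Int_open[OF E(1) b(3)])
  have im: "E ` ?R \<subseteq> cmap c ` (\<psi> ` mcarrier U \<inter> cdom c)"
  proof (rule image_subsetI)
    fix x assume "x \<in> ?R"
    then obtain q where q: "q \<in> cdom b" "x = cmap b q" "cmap b q \<in> N" by blast
    then have "q \<in> mcarrier U" using b(1) by (auto simp: mcarrier_def)
    then show "E x \<in> cmap c ` (\<psi> ` mcarrier U \<inter> cdom c)" using E(3,4)[of q] q by auto
  qed
  have "unique_deriv (cmap c ` (\<psi> ` mcarrier U \<inter> cdom c)) (E (cmap b u))"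
    by (rule unique_deriv_image[OF R has_derivative_at_withinI[OF smooth_on_has_derivative[OF E(2,1) b(3)]] im b(5)])
  then show "unique_deriv (cmap c ` (\<psi> ` mcarrier U \<inter> cdom c)) (cmap c p)"
    using E(4)[OF u(1) b(2,3)] u(2) by simp
qed

text \<open>In charts the section is \<open>K \<circ> G\<close>, where \<open>K\<close> extends the coordinate expression of \<open>\<phi>\<close> and \<open>G\<close>
  inverts that of the embedding. A point of the image near \<open>p\<close> might come from a distant parameter;
  this is excluded because an embedding is open onto its image.\<close>

lemma embedding_extendable_section:
  fixes U :: "('u, 'm::finite rvec) chart set" and X :: "('x, 'm rvec) chart set"
  assumes U: "smooth_atlas H U" and X: "smooth_atlas UNIV X" and Y: "smooth_atlas UNIV Y"
    and emb: "smooth_embedding U X \<psi>" and \<phi>: "smooth_map U Y \<phi>"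
  shows "extendable_map X Y (\<psi> ` mcarrier U) (\<phi> \<circ> inv_into (mcarrier U) \<psi>)"
  unfolding extendable_map_def
proof (intro ballI impI, elim conjE)
  let ?S = "\<psi> ` mcarrier U" and ?\<sigma> = "\<phi> \<circ> inv_into (mcarrier U) \<psi>"
  fix p c f assume "p \<in> ?S" and c: "c \<in> X" and f: "f \<in> Y" and p: "p \<in> cdom c" and \<sigma>p: "?\<sigma> p \<in> cdom f"
  then obtain u where u: "u \<in> mcarrier U" "p = \<psi> u" by blast
  have top: "topspace (mtop U) = mcarrier U" by (rule topspace_atlas[OF U])
  have hom: "homeomorphic_map (mtop U) (subtopology (mtop X) ?S) \<psi>"
    using emb by (simp add: smooth_embedding_def embedding_map_def top)
  have inj\<psi>: "inj_on \<psi> (mcarrier U)" using homeomorphic_imp_injective_map[OF hom] by (simp add: top)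
  have \<psi>inv: "inv_into (mcarrier U) \<psi> (\<psi> q) = q" if "q \<in> mcarrier U" for q
    using inv_into_f_f[OF inj\<psi> that] .
  obtain b N V E G where b: "b \<in> U" "u \<in> cdom b" "cmap b u \<in> N" "local_rep (mcarrier U) \<psi> b c N E"
    and V: "open V" "E ` N = V" "smooth_on V G" "\<And>z. z \<in> N \<Longrightarrow> G (E z) = z"
    using embedding_local_diffeomorphism[OF U X emb u(1) c] p u(2) by metis
  note E = local_repD[OF b(4)]
  have \<phi>u: "\<phi> u \<in> cdom f" using \<sigma>p u \<psi>inv by simp
  obtain M K where M: "cmap b u \<in> M" and repK: "local_rep (mcarrier U) \<phi> b f M K"
    by (rule smooth_map_local_rep[OF U Y \<phi> b(1) f b(2) \<phi>u])
  note K = local_repD[OF repK]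
  let ?Q = "{q \<in> cdom b. cmap b q \<in> N}"
  have "openin (subtopology (mtop X) ?S) (\<psi> ` ?Q)"
    using homeomorphic_imp_open_map[OF hom] chart_preimage_openin[OF U b(1) E(1)] by (simp add: open_map_def)
  then obtain R where R: "openin (mtop X) R" "\<psi> ` ?Q = R \<inter> ?S" by (auto simp: openin_subtopology)
  define N' where "N' = (V \<inter> G -` M) \<inter> cmap c ` (R \<inter> cdom c)"
  have oG: "open (V \<inter> G -` M)" by (rule continuous_open_preimage[OF smooth_on_continuous[OF V(3)] V(1) K(1)])
  have "open (cmap c ` (R \<inter> cdom c))" using R(1) c unfolding openin_mtop_atlas[OF X] by blast
  then have N': "open N'" unfolding N'_def by (rule open_Int[OF oG])
  have Eu: "E (cmap b u) = cmap c p" using E(4)[OF u(1) b(2,3)] u(2) by simp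
  show "\<exists>N h. cmap c p \<in> N \<and> local_rep ?S ?\<sigma> c f N h"
  proof (intro exI conjI)
    have "p \<in> R" using R(2) b(2,3) u by blast
    moreover have "cmap c p \<in> V" using V(2) b(3) Eu by force
    moreover have "G (cmap c p) \<in> M" using V(4)[OF b(3)] Eu M by simp
    ultimately show "cmap c p \<in> N'" using p by (simp add: N'_def)
    show "local_rep ?S ?\<sigma> c f N' (\<lambda>x. K (G x))"
      unfolding local_rep_def
    proof (intro conjI ballI impI N')
      show "smooth_on N' (\<lambda>x. K (G x))"
        by (rule smooth_on_compose[OF smooth_on_subset[OF V(3)] K(2)]) (auto simp: N'_def)
      fix q' assume q': "q' \<in> ?S \<inter> cdom c" "cmap c q' \<in> N'"
      then have "q' \<in> R" using atlas_inj[OF X c] by (auto simp: N'_def dest: inj_onD)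
      then obtain q where q: "q \<in> cdom b" "cmap b q \<in> N" "q' = \<psi> q" using R(2) q'(1) by blast
      have qU: "q \<in> mcarrier U" using q(1) b(1) by (auto simp: mcarrier_def)
      have "G (cmap c q') = cmap b q" using E(4)[OF qU q(1,2)] V(4)[OF q(2)] q(3) by simp
      moreover have "G (cmap c q') \<in> M" using q'(2) by (simp add: N'_def)
      ultimately show "?\<sigma> q' \<in> cdom f" "K (G (cmap c q')) = cmap f (?\<sigma> q')"
        using K(3,4)[OF qU q(1)] \<psi>inv[OF qU] q(3) by simp_all
    qed
  qed
qed

section \<open>The jet of a section\<close>

lemma tmap_in_tspace:
  assumes "smooth_atlas H B" "f p \<in> mcarrier B" shows "tmap A B S f p v \<in> tspace B (f p)"
  using tvec_of_in_tspace[OF assms(1) chart_at[OF assms(2)]] by (simp add: tmap_def Let_def)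

text \<open>Differentiating \<open>\<pi> \<circ> \<sigma> = id\<close> within \<open>S\<close> shows that the tangent map of \<open>\<sigma>\<close> is a right inverse
  of that of \<open>\<pi>\<close>.\<close>

lemma jet_section_in_jet_space:
  fixes X :: "('x, 'm::finite rvec) chart set" and Y :: "('y, ('m, 'a::finite) bundle_model) chart set"
  assumes fb: "fiber_bundle X Y F \<pi>" and X: "smooth_atlas UNIV X" and Y: "smooth_atlas UNIV Y"
    and S: "unique_deriv_set X S" and \<sigma>: "extendable_map X Y S \<sigma>" "\<sigma> ` S \<subseteq> mcarrier Y" "\<And>q. q \<in> S \<Longrightarrow> \<pi> (\<sigma> q) = q"
    and q: "q \<in> S"
  shows "jet_section X Y S \<sigma> q \<in> jet_space X Y \<pi>"
proof -
  have yY: "\<sigma> q \<in> mcarrier Y" using \<sigma>(2) q by blast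
  obtain g f where gf: "(g, f) \<in> adapted_charts X Y \<pi>" and yf: "\<sigma> q \<in> cdom f"
    using adapted_chart_exists[OF fb yY] by metis
  note g = adaptedD[OF gf]
  have qg: "q \<in> cdom g" using g(3)[OF yf] \<sigma>(3)[OF q] by simp
  obtain N h where qN: "cmap g q \<in> N" and rep: "local_rep S \<sigma> g f N h"
    by (rule extendable_mapE[OF \<sigma>(1) q g(1,2) qg yf])
  note h = local_repD[OF rep]
  let ?T = "cmap g ` (S \<inter> cdom g)" and ?D = "frechet_derivative h (at (cmap g q))"
  have ud: "unique_deriv ?T (cmap g q)" using S q g(1) qg by (simp add: unique_deriv_set_def)
  have tm: "tmap X Y S \<sigma> q v = tvec_of Y (\<sigma> q) f (?D (v g))" if "v \<in> tspace X q" for v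
    by (rule tmap_local_rep[OF X g(1) Y g(2) q qg ud qN rep that])
  have D: "(h has_derivative ?D) (at (cmap g q))" by (rule smooth_on_has_derivative[OF h(2,1) qN])
  have "((\<lambda>x. x) has_derivative (\<lambda>v. fst (?D v))) (at (cmap g q) within ?T \<inter> N)"
  proof (rule has_derivative_transform[OF _ _ has_derivative_at_withinI[OF has_derivative_fst[OF D]]])
    show "cmap g q \<in> ?T \<inter> N" using q qg qN by blast
    fix x assume "x \<in> ?T \<inter> N"
    then obtain r where r: "r \<in> S" "r \<in> cdom g" "x = cmap g r" "cmap g r \<in> N" by blast
    then show "x = fst (h x)" using h(3,4)[OF r(1,2,4)] g(4)[of "\<sigma> r"] \<sigma>(3)[OF r(1)] by simp
  qed
  then have "(\<lambda>v. fst (?D v)) = (\<lambda>x. x)"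
    using unique_derivD[OF ud _ has_derivative_ident] by (simp add: at_within_Int_open[OF h(1) qN])
  then have fstD: "fst (?D v) = v" for v by metis
  have "tmap X Y S \<sigma> q (lincomb a v b w) = lincomb a (tmap X Y S \<sigma> q v) b (tmap X Y S \<sigma> q w)"
    if "v \<in> tspace X q" "w \<in> tspace X q" for a v b w
  proof -
    have "lincomb a v b w g = a *\<^sub>R v g + b *\<^sub>R w g" by (simp add: lincomb_def)
    then show ?thesis
      using tvec_of_lincomb[OF Y g(2) yf] has_derivative_linear[OF D]
      by (simp add: tm[OF lincomb_in_tspace[OF X that]] tm[OF that(1)] tm[OF that(2)] linear_add linear_cmul)
  qed
  moreover have "tmap Y X (mcarrier Y) \<pi> (\<sigma> q) (tmap X Y S \<sigma> q v) = v" if "v \<in> tspace X q" for v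
    using tmap_projection[OF X Y gf yf tvec_of_in_tspace[OF Y g(2) yf]] tspace_tvec_of[OF that g(1) qg, symmetric]
    by (simp add: tm that \<sigma>(3)[OF q] tvec_of_self[OF Y g(2) yf] fstD)
  ultimately show ?thesis
    using tmap_in_tspace[where f=\<sigma> and p=q and A=X, OF Y yY] lincomb_in_tspace[OF X] yY
    by (simp add: jet_section_def jet_space_def \<sigma>(3)[OF q])
qed

text \<open>If \<open>h\<close> extends the section in charts, the jet coordinates extend to \<open>(h, Dh \<partial>\<^sub>\<mu>)\<close>. The coordinate
  vectors \<open>\<partial>\<^sub>\<mu>\<close> belong to the chart \<open>g\<close> underlying the jet chart, while \<open>h\<close> is expressed in \<open>c\<close>;
  this accounts for the derivative of the transition map.\<close>

lemma extendable_jet_section: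
  fixes X :: "('x, 'm::finite rvec) chart set" and Y :: "('y, ('m, 'a::finite) bundle_model) chart set"
  assumes fb: "fiber_bundle X Y F \<pi>" and X: "smooth_atlas UNIV X" and Y: "smooth_atlas UNIV Y"
    and S: "unique_deriv_set X S" and \<sigma>: "extendable_map X Y S \<sigma>" "\<sigma> ` S \<subseteq> mcarrier Y" "\<And>q. q \<in> S \<Longrightarrow> \<pi> (\<sigma> q) = q"
  shows "extendable_map X (jet_atlas X Y \<pi>) S (jet_section X Y S \<sigma>)"
  unfolding extendable_map_def
proof (intro ballI impI, elim conjE)
  fix p c cJ assume p: "p \<in> S" "p \<in> cdom c" and c: "c \<in> X" and cJ: "cJ \<in> jet_atlas X Y \<pi>" "jet_section X Y S \<sigma> p \<in> cdom cJ"
  then obtain g f where gf: "(g, f) \<in> adapted_charts X Y \<pi>" "cJ = jet_chart X Y \<pi> (g, f)" by (auto simp: jet_atlas_def)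
  note g = adaptedD[OF gf(1)]
  have \<sigma>p: "\<sigma> p \<in> cdom f" using cJ(2) by (simp add: gf(2) jet_chart_simps jet_section_def)
  have pg: "p \<in> cdom g" using g(3)[OF \<sigma>p] \<sigma>(3)[OF p(1)] by simp
  obtain N h where pN: "cmap c p \<in> N" and rep: "local_rep S \<sigma> c f N h"
    by (rule extendable_mapE[OF \<sigma>(1) p(1) c g(2) p(2) \<sigma>p])
  note h = local_repD[OF rep]
  note inj = atlas_inj[OF X c]
  let ?O = "cmap c ` (cdom c \<inter> cdom g)"
  let ?w = "\<lambda>\<mu> x. frechet_derivative (cmap c \<circ> cinv g) (at ((cmap g \<circ> cinv c) x)) (axis \<mu> 1)"
  let ?H = "\<lambda>x. (fst (h x), snd (h x), \<chi> A \<mu>. snd (frechet_derivative h (at x) (?w \<mu> x)) $ A)"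
  have hs: "smooth_on (N \<inter> ?O) h" by (rule smooth_on_subset[OF h(2)]) blast
  have ks: "smooth_on (N \<inter> ?O) (cmap g \<circ> cinv c)"
    by (rule smooth_on_subset[OF atlas_transition_smooth[OF X c g(1)]]) blast
  have ws: "smooth_on (N \<inter> ?O) (?w \<mu>)" for \<mu>
    by (rule smooth_on_frechet_compose[OF atlas_transition_smooth[OF X g(1) c] atlas_overlap_open[OF X g(1) c] ks _ smooth_on_const])
       (auto simp: cinv_cmap[OF inj])
  have ds: "smooth_on (N \<inter> ?O) (\<lambda>x. frechet_derivative h (at x) (?w \<mu> x))" for \<mu>
    by (rule smooth_on_frechet_compose[OF h(2,1) smooth_on_id _ ws]) auto
  show "\<exists>N h. cmap c p \<in> N \<and> local_rep S (jet_section X Y S \<sigma>) c cJ N h"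
  proof (intro exI conjI)
    show "cmap c p \<in> N \<inter> ?O" using pN p(2) pg by blast
    show "local_rep S (jet_section X Y S \<sigma>) c cJ (N \<inter> ?O) ?H"
      unfolding local_rep_def
    proof (intro conjI ballI impI)
      show "open (N \<inter> ?O)" using h(1) atlas_overlap_open[OF X c g(1)] by (rule open_Int)
      show "smooth_on (N \<inter> ?O) ?H"
        by (intro smooth_on_Pair smooth_on_fst[OF hs] smooth_on_snd[OF hs] smooth_on_vec_lambda smooth_on_nth smooth_on_snd[OF ds])
      fix q assume q: "q \<in> S \<inter> cdom c" "cmap c q \<in> N \<inter> ?O"
      then have qS: "q \<in> S" "q \<in> cdom c" "cmap c q \<in> N" and qg: "q \<in> cdom g" using inj by (auto dest: inj_onD)
      have \<sigma>q: "\<sigma> q \<in> cdom f" "h (cmap c q) = cmap f (\<sigma> q)" using h(3,4)[OF qS] by simp_all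
      show "jet_section X Y S \<sigma> q \<in> cdom cJ"
        using jet_section_in_jet_space[OF fb X Y S \<sigma> qS(1)] \<sigma>q(1) by (simp add: gf(2) jet_chart_simps jet_section_def)
      have ud: "unique_deriv (cmap c ` (S \<inter> cdom c)) (cmap c q)" using S qS c by (simp add: unique_deriv_set_def)
      have "tmap X Y S \<sigma> q (tvec_of X q g (axis \<mu> 1)) f = frechet_derivative h (at (cmap c q)) (?w \<mu> (cmap c q))" for \<mu>
      proof -
        let ?v = "tvec_of X q g (axis \<mu> 1)"
        have "?v c = ?w \<mu> (cmap c q)"
          using transition_deriv_at[OF X g(1) c qg qS(2)] c qS(2) by (simp add: tvec_of_def cinv_cmap[OF inj])
        then show ?thesis
          using tmap_local_rep[OF X c Y g(2) qS(1,2) ud qS(3) rep tvec_of_in_tspace[OF X g(1) qg]]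
            tvec_of_self[OF Y g(2) \<sigma>q(1)] by simp
      qed
      then show "?H (cmap c q) = cmap cJ (jet_section X Y S \<sigma> q)"
        using tvec_of_in_tspace[OF X g(1) qg] \<sigma>(3)[OF qS(1)] \<sigma>q(2)
        by (simp add: gf(2) jet_section_def jet_chart_simps)
    qed
  qed
qed

text \<open>The exterior derivative sees a list of arguments only through its components in one chart at the
  base point.\<close>

lemma ext_deriv_components:
  assumes "map (\<lambda>w. w (chart_at A p)) ws = map (\<lambda>w. w (chart_at A p)) ws'"
  shows "ext_deriv A S \<omega> p ws = ext_deriv A S \<omega> p ws'"
  unfolding ext_deriv_def Let_def assms ..

section \<open>Noether's theorem\<close>

theorem mainTheorem4:
  fixes X Or :: "('x, 'm::{finite,linorder} rvec) chart set"
    and Y :: "('y, ('m, 'a::finite) bundle_model) chart set"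
    and F :: "('f, 'a rvec) chart set"
    and \<pi> :: "'y \<Rightarrow> 'x"
    and U :: "('u, 'm rvec) chart set"
    and \<L> :: "('x, 'y, 'm, 'a) lagrangian"
    and G :: "('g, 'k) monoid_scheme"
    and A :: "('g, 'h::euclidean_space) chart set"
    and \<rho> :: "'g \<Rightarrow> 'y \<Rightarrow> 'y"
    and \<rho>X :: "'g \<Rightarrow> 'x \<Rightarrow> 'x"
    and \<J> :: "('g, 'h) tvec \<Rightarrow> (('x, 'y, 'm, 'a) jet, ('m, 'a) jet_model) form"
  assumes "fiber_bundle X Y F \<pi>" and "orientation X Or"
    and "smooth_manifold_corners U" and "compact_space (mtop U)"
    and "lagrangian_density X Y \<pi> \<L>"
    and "acts_by_bundle_automorphisms G A X Y \<pi> \<rho> \<rho>X"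
    and "action_invariant G X Or Y \<pi> \<L> U \<rho> \<rho>X"
    and "covariant_momentum_map G A X Y \<pi> \<L> \<rho> \<rho>X \<J>"
  shows "\<forall>\<phi>\<in>el_solutions X Y \<pi> \<L> U. \<forall>\<xi>\<in>lie_algebra G A.
    form_eq_on X (base_image \<pi> U \<phi>) CARD('m)
      (ext_deriv X (base_image \<pi> U \<phi>)
        (pullback X (jet_atlas X Y \<pi>) (base_image \<pi> U \<phi>)
          (jet_section X Y (base_image \<pi> U \<phi>) (section_of \<pi> U \<phi>)) (\<J> \<xi>)))
      (\<lambda>_ _. 0)"
proof (intro ballI)
  fix \<phi> \<xi> assume \<phi>: "\<phi> \<in> el_solutions X Y \<pi> \<L> U" and \<xi>: "\<xi> \<in> lie_algebra G A"
  note fb = \<open>fiber_bundle X Y F \<pi>\<close>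
  define S where "S = base_image \<pi> U \<phi>"
  define \<sigma> where "\<sigma> = section_of \<pi> U \<phi>"
  define s where "s = jet_section X Y S \<sigma>"
  let ?J = "jet_atlas X Y \<pi>" and ?\<Omega> = "cartan_omega X Y \<pi> \<L>"
  let ?\<psi> = "\<pi> \<circ> \<phi>"
  have MX: "smooth_manifold X" and MY: "smooth_manifold Y" using fb by (simp_all only: fiber_bundle_def)
  have X: "smooth_atlas UNIV X" by (rule smooth_manifold_on_atlas[OF MX full_model_UNIV])
  have Y: "smooth_atlas UNIV Y" by (rule smooth_manifold_on_atlas[OF MY full_model_UNIV])
  note J = smooth_atlas_jet[OF X Y, of \<pi>]
  have U: "smooth_atlas {x. \<forall>i. 0 \<le> x $ i} U"
    using \<open>smooth_manifold_corners U\<close> unfolding smooth_manifold_corners_def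
    by (rule smooth_manifold_on_atlas[OF _ full_model_orthant])
  note el = \<phi>[unfolded el_solutions_def mem_Collect_eq]
  have conf: "\<phi> \<in> configurations X Y \<pi> U" using el by (rule conjunct1)
  have EL: "form_eq_on X S CARD('m) (pullback X ?J S s (interior_product W ?\<Omega>)) (\<lambda>_ _. 0)"
    if "smooth_vector_field ?J W" for W
    unfolding S_def \<sigma>_def s_def by (rule el[THEN conjunct2, rule_format, OF that])
  have sm: "smooth_map U Y \<phi>" and emb: "smooth_embedding U X ?\<psi>" using conf by (simp_all add: configurations_def)
  have S_eq: "S = ?\<psi> ` mcarrier U" and \<sigma>_eq: "\<sigma> = \<phi> \<circ> inv_into (mcarrier U) ?\<psi>"
    by (simp_all add: S_def base_image_def \<sigma>_def section_of_def)
  have ud: "unique_deriv_set X S" unfolding S_eq by (rule embedding_unique_deriv[OF U X emb])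
  have ex: "extendable_map X Y S \<sigma>" unfolding S_eq \<sigma>_eq by (rule embedding_extendable_section[OF U X Y emb sm])
  have inv: "inv_into (mcarrier U) ?\<psi> q \<in> mcarrier U" "?\<psi> (inv_into (mcarrier U) ?\<psi> q) = q" if "q \<in> S" for q
    using that unfolding S_eq by (rule inv_into_into, rule f_inv_into_f)
  have sec: "\<pi> (\<sigma> q) = q" if "q \<in> S" for q using inv(2)[OF that] by (simp add: \<sigma>_eq)
  have cont: "continuous_map (mtop U) (mtop Y) \<phi>" using sm by (simp add: smooth_map_def)
  have \<phi>Y: "\<phi> q \<in> mcarrier Y" if "q \<in> mcarrier U" for q
    using continuous_map_image_subset_topspace[OF cont] that
    unfolding topspace_atlas[OF U] topspace_atlas[OF Y] by blast
  have \<sigma>Y: "\<sigma> ` S \<subseteq> mcarrier Y" using inv(1) \<phi>Y by (auto simp: \<sigma>_eq)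
  have SX: "S \<subseteq> mcarrier X"
  proof
    fix q assume "q \<in> S"
    then have "\<pi> (\<sigma> q) \<in> \<pi> ` mcarrier Y" using \<sigma>Y by blast
    then show "q \<in> mcarrier X" using fb sec[OF \<open>q \<in> S\<close>] by (simp add: fiber_bundle_def)
  qed
  have mJ: "mcarrier ?J = jet_space X Y \<pi>" by (rule mcarrier_jet[OF fb])
  have sJ: "s ` S \<subseteq> mcarrier ?J"
    unfolding mJ s_def using jet_section_in_jet_space[OF fb X Y ud ex \<sigma>Y sec] by blast
  have exJ: "extendable_map X ?J S s" unfolding s_def by (rule extendable_jet_section[OF fb X Y ud ex \<sigma>Y sec])
  have n: "CARD('m) = Suc (CARD('m) - 1)" by simp
  have form: "smooth_form ?J (CARD('m) - 1) (\<J> \<xi>)"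
    and mom: "form_eq_on ?J (jet_space X Y \<pi>) CARD('m)
          (interior_product (jet_generator G A X Y \<pi> \<rho> \<rho>X \<xi>) ?\<Omega>) (ext_deriv ?J (jet_space X Y \<pi>) (\<J> \<xi>))"
    using \<open>covariant_momentum_map G A X Y \<pi> \<L> \<rho> \<rho>X \<J>\<close> \<xi>
    by (simp_all only: covariant_momentum_map_def)
  show "form_eq_on X (base_image \<pi> U \<phi>) CARD('m)
      (ext_deriv X (base_image \<pi> U \<phi>)
        (pullback X (jet_atlas X Y \<pi>) (base_image \<pi> U \<phi>)
          (jet_section X Y (base_image \<pi> U \<phi>) (section_of \<pi> U \<phi>)) (\<J> \<xi>)))
      (\<lambda>_ _. 0)"
    unfolding S_def[symmetric] \<sigma>_def[symmetric] s_def[symmetric] form_eq_on_def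
  proof (intro ballI allI impI, elim conjE)
    fix p and ws :: "('x, 'm rvec) tvec list"
    assume p: "p \<in> S" and ws: "set ws \<subseteq> tspace X p" "length ws = CARD('m)"
    let ?ws = "map (tmap X ?J S s p) ws"
    have sp: "s p \<in> mcarrier ?J" "s p \<in> jet_space X Y \<pi>" using sJ p mJ by auto
    have ws': "set ?ws \<subseteq> tspace ?J (s p)" "length ?ws = CARD('m)"
      using tmap_in_tspace[where f=s and p=p, OF J sp(1)] ws(2) by auto
    define c where "c = chart_at ?J (s p)"
    have c: "c \<in> ?J" "s p \<in> cdom c" using chart_at[OF sp(1)] by (simp_all add: c_def)
    then obtain g f where gf: "(g, f) \<in> adapted_charts X Y \<pi>" "c = jet_chart X Y \<pi> (g, f)" by (auto simp: jet_atlas_def)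
    have f: "fst (s p) \<in> cdom f" using c(2) by (simp add: gf(2) jet_chart_simps)
    let ?v = "jet_generator G A X Y \<pi> \<rho> \<rho>X \<xi> (s p)"
    \<comment> \<open>Only the value of the generator at this one jet is extended to a smooth vector field.\<close>
    obtain W where W: "smooth_vector_field ?J W" "W (s p) = tvec_of ?J (s p) c (?v c)"
      using vector_field_extension[OF fb gf(1) sp(2) f] unfolding gf(2) by metis
    have "ext_deriv X S (pullback X ?J S s (\<J> \<xi>)) p ws = ext_deriv ?J (mcarrier ?J) (\<J> \<xi>) (s p) ?ws"
      by (rule ext_deriv_pullback[OF X J SX ud exJ sJ form p ws(1)]) (use ws(2) n in simp)
    also have "\<dots> = ?\<Omega> (s p) (?v # ?ws)"
      using mom sp(2) ws' unfolding form_eq_on_def mJ interior_product_def by metis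
    also have "\<dots> = ?\<Omega> (s p) (W (s p) # ?ws)"
      unfolding cartan_omega_def
      by (rule arg_cong[where f=uminus], rule ext_deriv_components)
         (simp add: c_def[symmetric] W(2) tvec_of_self[OF J c])
    also have "\<dots> = 0"
      using EL[OF W(1)] p ws unfolding form_eq_on_def pullback_def interior_product_def by metis
    finally show "ext_deriv X S (pullback X ?J S s (\<J> \<xi>)) p ws = 0" .
  qed
qed

end
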